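(* Let $X$ be a simplicial complex triangulating a polyhedral domain $\Omega=|X|\subset\mathbb R^n$ that is star-shaped with respect to a point $a\in\Omega$, and assume that $a$ does not lie in any $\sigma\in X^{n-1}$. For $u\in\mathring V_h^n$ let $\mathcal Bu\in V_h^{n-1}$ be the Whitney form determined by $$\int_\sigma\mathcal Bu=\int_{L[a,\sigma]}u-\int_{L^\vee[a,\sigma]}u\qquad\text{for all }\sigma\in X^{n-1},$$ where $u$ is extended by zero to $\mathbb R^n$. Then for all $u\in\mathring V_h^n$ it holds that $\mathcal Bu\in\mathring V_h^{n-1}$, and moreover $\mathcal B\,du+d\,\mathcal Bu=u$ (where $du=0$, so that $d\,\mathcal Bu=u$).
   Context: $X^k$ is the set of (oriented) $k$-simplices of $X$. $\Omega$ is star-shaped with respect to $a$ if for each $x\in\Omega$ the segment from $x$ to $a$ lies in $\Omega$. $V_h^k$ is the space of Whitney $k$-forms on $X$: the span of $w_\sigma=k!\sum_{i=0}^k(-1)^i\lambda_{v_i}\,d\lambda_{v_0}\wedge\dots\wedge\widehat{d\lambda_{v_i}}\wedge\dots\wedge d\lambda_{v_k}$, $\sigma=[v_0,\dots,v_k]\in X^k$, with $\lambda_v$ the piecewise linear hat function of the vertex $v$. A Whitney $k$-form is determined by its integrals over the $\sigma\in X^k$, which may be prescribed arbitrarily. $\mathring V_h^{n-1}\subset V_h^{n-1}$ is the subspace of forms with vanishing trace on $\partial\Omega$ (equivalently $\int_\sigma u=0$ for all $\sigma\in X^{n-1}$ with $\sigma\subset\partial\Omega$); $\mathring V_h^n$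 is the space of $u\in V_h^n$ with $\int_\Omega u=0$. $Q_n$ is the standard $n$-simplex with vertices $0,e_1,\dots,e_n$ and $O_n=\{x\in\mathbb R^n:x_i\ge0\}$. For $\sigma=[v_0,\dots,v_{n-1}]$, the maps $L[a,\sigma]:Q_n\to\mathbb R^n$ and $L^\vee[a,\sigma]:O_n\to\mathbb R^n$ are both given by $x\mapsto a+\sum_{i=1}^nx_i(v_{i-1}-a)$. Integrals are $\int_{L[a,\sigma]}u=\int_{Q_n}L[a,\sigma]^*u$ and $\int_{L^\vee[a,\sigma]}u=\int_{O_n}L^\vee[a,\sigma]^*u$; both are $0$ when $a,v_0,\dots,v_{n-1}$ are affinely dependent. *)

theory Defs
  imports "HOL-Analysis.Analysis"
begin

text \<open>
  The library's \<^const>\<open>simplicial_complex\<close> is a finite set of closed geometric simplices. With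
  \<open>n = CARD('n)\<close>, its cells are the \<open>n\<close>-simplices.

  A \<open>k\<close>-form \<open>u\<close> on \<open>\<real>\<^sup>n\<close> assigns to a point \<open>x\<close> and vectors \<open>v 0, \<dots>, v (k - 1)\<close> the number
  \<open>u x v\<close>; the later entries of \<open>v\<close> are never inspected. Whitney forms are piecewise smooth and only
  defined almost everywhere. Each one is represented here by the function that vanishes outside the
  interiors of the cells. Hence forms are equal almost everywhere iff their representatives are
  equal, and a representative is already extended by zero to \<open>\<real>\<^sup>n\<close>.
\<close>

type_synonym 'n form = "real ^ 'n \<Rightarrow> (nat \<Rightarrow> real ^ 'n) \<Rightarrow> real"

text \<open>A domain in the sense of the closure of a bounded connected open set with polyhedral boundary.
  No Lipschitz condition is imposed.\<close>

definition polyhedral_domain :: "(real ^ 'n) set \<Rightarrow> bool" where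
  "polyhedral_domain \<Omega> \<longleftrightarrow>
     \<Omega> \<noteq> {} \<and> closure (interior \<Omega>) = \<Omega> \<and> connected (interior \<Omega>) \<and>
     (\<exists>F. finite F \<and> (\<forall>P\<in>F. polytope P) \<and> \<Omega> = \<Union>F)"

definition star_shaped_wrt :: "(real ^ 'n) set \<Rightarrow> real ^ 'n \<Rightarrow> bool" where
  "star_shaped_wrt \<Omega> a \<longleftrightarrow> (\<forall>x\<in>\<Omega>. closed_segment x a \<subseteq> \<Omega>)"

definition cells :: "(real ^ 'n) set set \<Rightarrow> (real ^ 'n) set set" where
  "cells X = {T \<in> X. int CARD('n) simplex T}"

definition cell_interiors :: "(real ^ 'n) set set \<Rightarrow> (real ^ 'n) set" where
  "cell_interiors X = (\<Union>T\<in>cells X. interior T)"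

text \<open>An oriented simplex \<open>[v\<^sub>0, \<dots>, v\<^sub>k]\<close> is given by the list of its vertices. All orderings are
  included: everything below is alternating under reordering, so the redundancy is harmless.\<close>

definition oriented_simplices :: "(real ^ 'n) set set \<Rightarrow> nat \<Rightarrow> (real ^ 'n) list set" where
  "oriented_simplices X k =
     {\<sigma>. length \<sigma> = Suc k \<and> distinct \<sigma> \<and> \<not> affine_dependent (set \<sigma>) \<and> convex hull (set \<sigma>) \<in> X}"


section \<open>Whitney forms\<close>

definition hat :: "(real ^ 'n) set set \<Rightarrow> real ^ 'n \<Rightarrow> real ^ 'n \<Rightarrow> real" where
  "hat X p = (THE f.
     (\<forall>q. {q} \<in> X \<longrightarrow> f q = (if q = p then 1 else 0)) \<and>
     (\<forall>S\<in>X. \<forall>x\<in>S. \<forall>y\<in>S. \<forall>t\<in>{0..1}.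
        f ((1 - t) *\<^sub>R x + t *\<^sub>R y) = (1 - t) * f x + t * f y) \<and>
     (\<forall>x. x \<notin> \<Union>X \<longrightarrow> f x = 0))"

text \<open>The wedge product of a list of covectors, normalised by
  \<open>(\<alpha>\<^sub>1 \<and> \<dots> \<and> \<alpha>\<^sub>k) (v\<^sub>1, \<dots>, v\<^sub>k) = det (\<alpha>\<^sub>i v\<^sub>j)\<close>.\<close>

definition wedge :: "(real ^ 'n \<Rightarrow> real) list \<Rightarrow> (nat \<Rightarrow> real ^ 'n) \<Rightarrow> real" where
  "wedge \<alpha>s v = (\<Sum>p | p permutes {..<length \<alpha>s}.
     of_int (sign p) * (\<Prod>j<length \<alpha>s. (\<alpha>s ! j) (v (p j))))"

definition omit :: "nat \<Rightarrow> 'a list \<Rightarrow> 'a list" where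
  "omit i xs = take i xs @ drop (Suc i) xs"

definition whitney_form :: "(real ^ 'n) set set \<Rightarrow> (real ^ 'n) list \<Rightarrow> 'n form" where
  "whitney_form X \<sigma> x v =
     (if x \<in> cell_interiors X
      then fact (length \<sigma> - 1) * (\<Sum>i<length \<sigma>. (- 1) ^ i * hat X (\<sigma> ! i) x *
             wedge (map (\<lambda>p. frechet_derivative (hat X p) (at x)) (omit i \<sigma>)) v)
      else 0)"

text \<open>The span of the Whitney forms, i.e. \<open>V\<^sub>h\<^sup>k\<close>.\<close>

definition whitney_space :: "(real ^ 'n) set set \<Rightarrow> nat \<Rightarrow> 'n form set" where
  "whitney_space X k =
     {u. \<exists>c. u = (\<lambda>x v. \<Sum>\<sigma>\<in>oriented_simplices X k. c \<sigma> * whitney_form X \<sigma> x v)}"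

text \<open>The exterior derivative of a \<open>k\<close>-form, taken cell by cell. On Whitney forms this is the weak
  exterior derivative, because their tangential traces are continuous across faces.\<close>

definition ext_deriv :: "(real ^ 'n) set set \<Rightarrow> nat \<Rightarrow> 'n form \<Rightarrow> 'n form" where
  "ext_deriv X k u x v =
     (if x \<in> cell_interiors X
      then \<Sum>i\<le>k. (- 1) ^ i *
             frechet_derivative (\<lambda>y. u y (\<lambda>j. if j < i then v j else v (Suc j))) (at x) (v i)
      else 0)"


section \<open>Integrals\<close>

text \<open>Here \<open>\<real>\<^sup>k\<close> is the product space of functions on \<open>{..<k}\<close>, so that \<open>k\<close> may be any number;
  the coordinate \<open>x\<^sub>i\<close> of the paper-and-pencil notation is \<open>x (i - 1)\<close>.\<close>

abbreviation lborel_pow :: "nat \<Rightarrow> (nat \<Rightarrow> real) measure" where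
  "lborel_pow k \<equiv> Pi\<^sub>M {..<k} (\<lambda>_. lborel)"

definition orthant :: "nat \<Rightarrow> (nat \<Rightarrow> real) set" where
  "orthant k = {x \<in> space (lborel_pow k). \<forall>i<k. 0 \<le> x i}"

definition std_simplex_pow :: "nat \<Rightarrow> (nat \<Rightarrow> real) set" where
  "std_simplex_pow k = {x \<in> orthant k. (\<Sum>i<k. x i) \<le> 1}"

text \<open>The integral over \<open>D \<subseteq> \<real>\<^sup>k\<close> of the pullback of the \<open>k\<close>-form \<open>u\<close> along the affine map
  \<open>\<phi> x = p + (\<Sum>i<k. x i *\<^sub>R e i)\<close>. The differential of \<open>\<phi>\<close> sends the \<open>i\<close>-th basis vector to \<open>e i\<close>.
  If \<open>e 0, \<dots>, e (k - 1)\<close> are linearly dependent and \<open>u\<close> is alternating, the integrand and hence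
  the integral is zero, also for unbounded \<open>D\<close>.\<close>

definition affine_integral ::
    "nat \<Rightarrow> (nat \<Rightarrow> real) set \<Rightarrow> real ^ 'n \<Rightarrow> (nat \<Rightarrow> real ^ 'n) \<Rightarrow> 'n form \<Rightarrow> real" where
  "affine_integral k D p e u =
     set_lebesgue_integral (lborel_pow k) D (\<lambda>x. u (p + (\<Sum>i<k. x i *\<^sub>R e i)) e)"

text \<open>The continuous extension to \<open>T\<close> of the restriction of \<open>u\<close> to the interior of the cell \<open>T\<close>.\<close>

definition cell_extension :: "(real ^ 'n) set \<Rightarrow> 'n form \<Rightarrow> 'n form" where
  "cell_extension T u x v = Lim (at x within interior T) (\<lambda>y. u y v)"

text \<open>The integral of a \<open>k\<close>-form over \<open>\<sigma> = [v\<^sub>0, \<dots>, v\<^sub>k]\<close>, i.e. of its trace on \<open>\<sigma>\<close>, which is taken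
  from a cell containing \<open>\<sigma>\<close>. For Whitney forms the result does not depend on the cell.\<close>

definition simplex_integral ::
    "(real ^ 'n) set set \<Rightarrow> 'n form \<Rightarrow> (real ^ 'n) list \<Rightarrow> real" where
  "simplex_integral X u \<sigma> =
     (let k = length \<sigma> - 1; T = (SOME T. T \<in> cells X \<and> set \<sigma> \<subseteq> T) in
      affine_integral k (std_simplex_pow k) (\<sigma> ! 0) (\<lambda>i. \<sigma> ! Suc i - \<sigma> ! 0) (cell_extension T u))"

text \<open>The integrals over \<open>L[a,\<sigma>]\<close> and over \<open>L\<^sup>\<or>[a,\<sigma>]\<close>.\<close>

definition cone_integral :: "real ^ 'n \<Rightarrow> (real ^ 'n) list \<Rightarrow> 'n form \<Rightarrow> real" where
  "cone_integral a \<sigma> u =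
     affine_integral (length \<sigma>) (std_simplex_pow (length \<sigma>)) a (\<lambda>i. \<sigma> ! i - a) u"

definition dual_cone_integral :: "real ^ 'n \<Rightarrow> (real ^ 'n) list \<Rightarrow> 'n form \<Rightarrow> real" where
  "dual_cone_integral a \<sigma> u =
     affine_integral (length \<sigma>) (orthant (length \<sigma>)) a (\<lambda>i. \<sigma> ! i - a) u"

text \<open>The integral of an \<open>n\<close>-form over \<open>\<Omega>\<close>. The enumeration of the index type \<open>'n\<close> picks one of the
  two orientations of \<open>\<real>\<^sup>n\<close>; it only affects the sign, hence not whether the integral vanishes.\<close>

definition domain_integral :: "(real ^ 'n) set \<Rightarrow> 'n form \<Rightarrow> real" where
  "domain_integral \<Omega> u =
     set_lebesgue_integral lborel \<Omega> (\<lambda>x. u x (\<lambda>i. axis (from_nat_into (UNIV :: 'n set) i) 1))"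


section \<open>Boundary conditions and the operator\<close>

text \<open>The trace on the boundary consists of the tangential components on the boundary facets;
  \<open>w\<close> is tangential to the facet \<open>S\<close> at \<open>x \<in> S\<close> iff \<open>x + w\<close> lies in the affine hull of \<open>S\<close>.\<close>

definition vanishing_trace :: "(real ^ 'n) set set \<Rightarrow> nat \<Rightarrow> 'n form \<Rightarrow> bool" where
  "vanishing_trace X k u \<longleftrightarrow>
     (\<forall>S\<in>X. (int CARD('n) - 1) simplex S \<and> S \<subseteq> frontier (\<Union>X) \<longrightarrow>
        (\<forall>T\<in>cells X. S \<subseteq> T \<longrightarrow>
           (\<forall>x\<in>S. \<forall>v. (\<forall>i<k. x + v i \<in> affine hull S) \<longrightarrow> cell_extension T u x v = 0)))"

definition whitney_space_trace0 :: "(real ^ 'n) set set \<Rightarrow> nat \<Rightarrow> 'n form set" where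
  "whitney_space_trace0 X k = {u \<in> whitney_space X k. vanishing_trace X k u}"

definition whitney_space_mean0 :: "(real ^ 'n) set set \<Rightarrow> 'n form set" where
  "whitney_space_mean0 X = {u \<in> whitney_space X CARD('n). domain_integral (\<Union>X) u = 0}"

text \<open>The operator \<open>\<B>\<close> from \<open>(k + 1)\<close>-forms to Whitney \<open>k\<close>-forms. The case of interest is
  \<open>k = n - 1\<close>; the same formula for \<open>k = n\<close> gives a meaning to \<open>\<B> du\<close>, where \<open>du\<close> is an
  \<open>(n + 1)\<close>-form and therefore zero.\<close>

definition B_op :: "(real ^ 'n) set set \<Rightarrow> real ^ 'n \<Rightarrow> nat \<Rightarrow> 'n form \<Rightarrow> 'n form" where
  "B_op X a k u = (THE w. w \<in> whitney_space X k \<and>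
     (\<forall>\<sigma>\<in>oriented_simplices X k.
        simplex_integral X w \<sigma> = cone_integral a \<sigma> u - dual_cone_integral a \<sigma> u))"

end

theory Submission
  imports Defs "Jordan_Normal_Form.Determinant"
begin

text \<open>
  On a cell the homogenised barycentric coordinates turn the Whitney forms into determinants. This
  gives unisolvence, and it gives \<open>d w = n! (\<Sum>\<^sub>i (- 1)\<^sup>i f\<^sub>i) D vol\<close> on a cell for the Whitney
  \<open>(n - 1)\<close>-form \<open>w\<close> with integrals \<open>f\<^sub>i\<close> over the facets of the cell, where \<open>\<bar>D\<bar>\<close> is \<open>1 / n!\<close>
  divided by the volume of the cell.

  Hence \<open>d (\<B> u) = u\<close> amounts to Stokes' theorem for the joins of \<open>a\<close> with the facets, minus
  the same for the infinite cones. If \<open>\<mu>\<close> are the barycentric coordinates of \<open>a\<close> and \<open>d\<close> those of the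
  direction \<open>y - a\<close>, then \<open>y\<close> lies in the cone over a facet iff the line \<open>s \<mapsto> d + s \<mu>\<close> meets the
  nonnegative orthant in the corresponding coordinate hyperplane; the sign of \<open>\<mu>\<close> tells whether the
  line enters or leaves the orthant there, and the joins correspond to \<open>s \<le> 1\<close>. For generic \<open>y\<close>,
  counting entries minus exits shows that the joins contribute the indicator function of the cell,
  and the cones the constant \<open>1\<close> or \<open>0\<close>, according to whether \<open>a\<close> lies in the cell. A
  constant integrates to \<open>0\<close> against \<open>u\<close>.

  The trace of \<open>\<B> u\<close> vanishes because no interior point of the domain lies behind a boundary facet,
  as seen from \<open>a\<close>.
\<close>

section \<open>Determinants\<close>

text \<open>Lifting a point \<open>x\<close> to \<open>(1, x)\<close> and a vector \<open>v\<close>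
  to \<open>(0, v)\<close> makes a barycentric coordinate and its differential two values of one
  linear functional. The alternating sum defining a Whitney form is then the Laplace expansion of
  one determinant, and reordering vertices, restricting to a face and differentiating become row and
  column operations. Sizes \<open>k + 1\<close>, \<open>n\<close> and \<open>n + 1\<close> all
  occur, so determinants are indexed by natural numbers and not by a type.

  \<open>hat\<close> and \<open>B_op\<close> are definite descriptions, so existence and uniqueness
  precede every computation. For \<open>B_op\<close> this needs that each simplex lies in a cell and
  that the prescribed values change sign with the orientation.

  The assumption on \<open>a\<close> makes all coordinates \<mu> of \<open>a\<close> positive in a
  cell containing \<open>a\<close>; otherwise the count for the cones would depend on
  \<open>y\<close> through the constraints with \<mu> = 0. A facet whose hyperplane passes through
  \<open>a\<close> needs no general position argument: its coefficient is
  \<open>sgn 0 = 0\<close>.\<close>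

definition fdet :: "nat \<Rightarrow> (nat \<Rightarrow> nat \<Rightarrow> real) \<Rightarrow> real" where
  "fdet n A = Determinant.det (Matrix.mat n n (\<lambda>(i, j). A i j))"

lemma fdet_cong:
  assumes "\<And>i j. i < n \<Longrightarrow> j < n \<Longrightarrow> A i j = B i j"
  shows "fdet n A = fdet n B"
  unfolding fdet_def using assms by (intro arg_cong[where f = Determinant.det] eq_matI) auto

lemma fdet_permutes:
  "fdet n A = (\<Sum>p | p permutes {..<n}. of_int (sign p) * (\<Prod>i<n. A i (p i)))"
proof -
  have "fdet n A = (\<Sum>p | p permutes {0..<n}. of_int (sign p) *
      (\<Prod>i = 0..<n. Matrix.mat n n (\<lambda>(i, j). A i j) $$ (i, p i)))"
    unfolding fdet_def by (rule det_def') simp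
  also have "\<dots> = (\<Sum>p | p permutes {0..<n}. of_int (sign p) * (\<Prod>i = 0..<n. A i (p i)))"
    by (intro sum.cong prod.cong refl arg_cong2[where f = "(*)"])
       (auto dest: permutes_in_image)
  finally show ?thesis by (simp add: atLeast0LessThan)
qed

lemma fdet_mult: "fdet n (\<lambda>i j. \<Sum>k<n. A i k * B k j) = fdet n A * fdet n B"
proof -
  let ?A = "Matrix.mat n n (\<lambda>(i, j). A i j)" and ?B = "Matrix.mat n n (\<lambda>(i, j). B i j)"
  have "Matrix.mat n n (\<lambda>(i, j). \<Sum>k<n. A i k * B k j) = ?A * ?B"
    by (rule eq_matI) (auto simp: scalar_prod_def atLeast0LessThan)
  thus ?thesis
    unfolding fdet_def by (simp add: det_mult[of _ n])
qed

lemma fdet_transpose: "fdet n (\<lambda>i j. A j i) = fdet n A"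
proof -
  have "Matrix.mat n n (\<lambda>(i, j). A j i) = transpose_mat (Matrix.mat n n (\<lambda>(i, j). A i j))"
    by (rule eq_matI) auto
  thus ?thesis
    unfolding fdet_def by (simp add: det_transpose[of _ n])
qed

lemma fdet_zero_row:
  assumes "i < n" "\<And>j. j < n \<Longrightarrow> A i j = 0"
  shows "fdet n A = 0"
proof -
  have "(\<Prod>r<n. A r (p r)) = 0" if "p permutes {..<n}" for p
    using assms permutes_in_image[OF that, of i] by (auto simp: prod_zero_iff)
  thus ?thesis unfolding fdet_permutes by (intro sum.neutral) auto
qed

lemma fdet_upper_triangular:
  assumes "\<And>i j. i < n \<Longrightarrow> j < i \<Longrightarrow> A i j = 0"
  shows "fdet n A = (\<Prod>i<n. A i i)"
proof -
  have "fdet n A = prod_list (diag_mat (Matrix.mat n n (\<lambda>(i, j). A i j)))"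
    unfolding fdet_def by (rule det_upper_triangular[of _ n]) (auto simp: upper_triangular_def assms)
  also have "\<dots> = (\<Prod>i<n. A i i)"
    by (simp add: diag_mat_def prod.list_conv_set_nth atLeast0LessThan)
  finally show ?thesis .
qed

lemma fdet_lower_triangular:
  assumes "\<And>i j. j < n \<Longrightarrow> i < j \<Longrightarrow> A i j = 0"
  shows "fdet n A = (\<Prod>i<n. A i i)"
  using fdet_upper_triangular[of n "\<lambda>i j. A j i"] assms fdet_transpose[of n A] by simp

text \<open>The coface map of simplicial combinatorics: the increasing injection that misses
  \<open>i\<close>. It indexes the rows of minors and the vertices of the facet opposite to vertex
  \<open>i\<close>.\<close>

definition skip :: "nat \<Rightarrow> nat \<Rightarrow> nat" where "skip i j = (if j < i then j else Suc j)"

lemma fdet_laplace_column: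
  "fdet (Suc n) A = (\<Sum>i\<le>n. (- 1) ^ i * A i 0 * fdet n (\<lambda>r j. A (skip i r) (Suc j)))"
proof -
  let ?A = "Matrix.mat (Suc n) (Suc n) (\<lambda>(i, j). A i j)"
  have "mat_delete ?A i 0 = Matrix.mat n n (\<lambda>(r, j). A (skip i r) (Suc j))" if "i \<le> n" for i
    using that by (intro eq_matI) (auto simp: mat_delete_def skip_def)
  hence "fdet (Suc n) A = (\<Sum>i<Suc n. (- 1) ^ i * A i 0 * fdet n (\<lambda>r j. A (skip i r) (Suc j)))"
    unfolding fdet_def by (subst laplace_expansion_column[of _ "Suc n" 0])
      (auto simp: cofactor_def intro!: sum.cong)
  thus ?thesis by (simp add: lessThan_Suc_atMost)
qed

text \<open>The columns undergo a cycle of length \<open>k + 1\<close>, whose sign is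
  \<open>(- 1) ^ k\<close>. This yields the sign with which the \<open>i\<close>-th facet of a cell
  is oriented, and the signs that cancel those in the exterior derivative.\<close>

lemma fdet_column_to_front:
  assumes "k < n"
  shows "fdet n (\<lambda>i j. A i (if j = 0 then k else skip k (j - 1))) = (- 1) ^ k * fdet n A"
proof -
  let ?A = "Matrix.mat n n (\<lambda>(i, j). A i j)"
  have "Matrix.mat n n (\<lambda>(i, j). A i (if j = 0 then k else skip k (j - 1))) = swap_col_to_front ?A k"
    using assms by (subst swap_col_to_front_result[of _ n n]) (auto simp: skip_def intro!: eq_matI)
  thus ?thesis
    unfolding fdet_def using assms by (simp add: swap_col_to_front_det[of _ n])
qed

text \<open>The matrix of this column operation becomes triangular when its other rows are added to row \<open>0\<close>.\<close>
lemma fdet_affine_columns: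
  assumes t: "(\<Sum>k\<le>n. t k) = 1"
  shows "fdet (Suc n) (\<lambda>i j. if j = 0 then \<Sum>k\<le>n. t k * A i k else A i j - A i 0) = fdet (Suc n) A"
proof -
  let ?C = "\<lambda>k j::nat. if j = 0 then t k else of_bool (k = j) - of_bool (k = 0)"
  let ?E = "\<lambda>i k::nat. if i = 0 then 1 else of_bool (k = i) :: real"
  have sumE: "(\<Sum>k<Suc n. ?E i k * B k) = (if i = 0 then \<Sum>k<Suc n. B k else B i)"
    if "i < Suc n" for i and B :: "nat \<Rightarrow> real"
    using that by (cases "i = 0") (simp_all del: sum.lessThan_Suc)
  have "fdet (Suc n) ?E * fdet (Suc n) ?C = fdet (Suc n) (\<lambda>i j. \<Sum>k<Suc n. ?E i k * ?C k j)"
    by (simp only: fdet_mult)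
  also have "\<dots> = fdet (Suc n) (\<lambda>i j. if i = 0 then of_bool (j = 0) else ?C i j)"
  proof (rule fdet_cong)
    fix i j assume ij: "i < Suc n" "j < Suc n"
    have "(\<Sum>k<Suc n. ?C k j) = of_bool (j = 0)"
      using ij t by (cases "j = 0") (simp_all add: sum_subtractf flip: lessThan_Suc_atMost del: sum.lessThan_Suc)
    thus "(\<Sum>k<Suc n. ?E i k * ?C k j) = (if i = 0 then of_bool (j = 0) else ?C i j)"
      by (simp only: sumE[OF ij(1)])
  qed
  also have "\<dots> = 1"
    by (subst fdet_lower_triangular) (auto intro!: prod.neutral)
  also have "fdet (Suc n) ?E = 1"
    by (subst fdet_upper_triangular) (auto intro!: prod.neutral)
  finally have C: "fdet (Suc n) ?C = 1" by simp
  have "fdet (Suc n) (\<lambda>i j. \<Sum>k<Suc n. A i k * ?C k j) = fdet (Suc n) A"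
    by (simp only: fdet_mult C mult_1_right)
  also have "fdet (Suc n) (\<lambda>i j. \<Sum>k<Suc n. A i k * ?C k j) =
      fdet (Suc n) (\<lambda>i j. if j = 0 then \<Sum>k\<le>n. t k * A i k else A i j - A i 0)"
  proof (rule fdet_cong)
    fix i j assume ij: "i < Suc n" "j < Suc n"
    have "(\<Sum>k<Suc n. A i k * (of_bool (k = j) - of_bool (k = 0))) = A i j - A i 0"
      unfolding right_diff_distrib sum_subtractf using ij by (simp del: sum.lessThan_Suc)
    thus "(\<Sum>k<Suc n. A i k * ?C k j) = (if j = 0 then \<Sum>k\<le>n. t k * A i k else A i j - A i 0)"
      by (cases "j = 0") (simp_all add: lessThan_Suc_atMost mult.commute)
  qed
  finally show ?thesis by simp
qed

section \<open>Linear changes of variables\<close>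

abbreviation idx :: "nat \<Rightarrow> 'n::finite" where "idx \<equiv> from_nat_into UNIV"

lemma bij_betw_idx: "bij_betw (idx :: nat \<Rightarrow> 'n::finite) {..<CARD('n)} UNIV"
  using bij_betw_from_nat_into_finite[of "UNIV :: 'n set"] by simp

lemma sum_idx: "(\<Sum>i<CARD('n). f (idx i :: 'n::finite)) = sum f UNIV"
  by (rule sum.reindex_bij_betw[OF bij_betw_idx])

lemma idx_eq_iff: "i < CARD('n) \<Longrightarrow> j < CARD('n) \<Longrightarrow> (idx i :: 'n::finite) = idx j \<longleftrightarrow> i = j"
  using bij_betw_idx[where 'n = 'n] by (auto simp: bij_betw_def inj_on_eq_iff)

text \<open>The volume form, oriented by the same enumeration of the index type as in
  \<open>domain_integral\<close>. Whitney forms of top degree will be densities times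
  \<open>vdet\<close>.\<close>

definition vdet :: "(nat \<Rightarrow> real ^ 'n) \<Rightarrow> real" where
  "vdet v = fdet CARD('n) (\<lambda>i j. v j $ idx i)"

text \<open>Conjugation with the enumeration is a sign-preserving bijection between the permutations
  of the two index sets. The bridge is needed because the change of variables is proved for matrices
  over the index type.\<close>

lemma fdet_idx:
  "fdet CARD('n::finite) (\<lambda>i j. A $ idx i $ idx j) = Determinants.det (A :: real ^ 'n ^ 'n)"
proof -
  let ?I = "{..<CARD('n)}" and ?m = "\<lambda>p. map_permutation {..<CARD('n)} (idx :: nat \<Rightarrow> 'n) p"
  have m: "?m = (\<lambda>p x. if x \<in> UNIV then idx (p (inv_into ?I idx x)) else x)"
    using bij_betw_idx[where 'n = 'n]
    by (auto simp: map_permutation_def restrict_id_def fun_eq_iff bij_betw_def)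
  have bij: "bij_betw ?m {p. p permutes ?I} {p. p permutes UNIV}"
    unfolding m by (rule bij_betw_permutations[OF bij_betw_idx])
  have "Determinants.det A = (\<Sum>p | p permutes ?I. of_int (sign (?m p)) * (\<Prod>i\<in>UNIV. A $ i $ ?m p i))"
    unfolding Determinants.det_def
    by (rule sum.reindex_bij_betw[OF bij, symmetric])
  also have "\<dots> = (\<Sum>p | p permutes ?I. of_int (sign p) * (\<Prod>i\<in>?I. A $ idx i $ idx (p i)))"
  proof (intro sum.cong refl arg_cong2[where f = "(*)"])
    fix p assume "p \<in> {p. p permutes ?I}"
    hence p: "p permutes ?I" by simp
    show "real_of_int (sign (?m p)) = real_of_int (sign p)"
      using sign_map_permutation[OF bij_betw_imp_inj_on[OF bij_betw_idx[where 'n = 'n]] p] by simp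
    have "(\<Prod>i\<in>UNIV. A $ i $ ?m p i) = (\<Prod>i\<in>?I. A $ idx i $ ?m p (idx i))"
      by (rule prod.reindex_bij_betw[OF bij_betw_idx, symmetric])
    also have "\<dots> = (\<Prod>i\<in>?I. A $ idx i $ idx (p i))"
      using bij_betw_inv_into_left[OF bij_betw_idx[where 'n = 'n]] by (intro prod.cong) (auto simp: m)
    finally show "(\<Prod>i\<in>UNIV. A $ i $ ?m p i) = (\<Prod>i\<in>?I. A $ idx i $ idx (p i))" .
  qed
  finally show ?thesis by (simp add: fdet_permutes)
qed

section \<open>Lebesgue measure as a product measure, and its behaviour under linear maps\<close>

lemma borel_measurable_vec_lambda_PiM:
  assumes "\<And>j. g j \<in> I"
  shows "(\<lambda>x. \<chi> j. (x (g j) :: real)) \<in> borel_measurable (Pi\<^sub>M I (\<lambda>_. lborel))"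
proof -
  have "(\<lambda>x. x (g j) :: real) \<in> measurable (Pi\<^sub>M I (\<lambda>_. lborel)) lborel" for j
    by (rule measurable_component_singleton) (rule assms)
  thus ?thesis
    by (subst borel_measurable_euclidean_space) (auto simp: Basis_vec_def inner_axis)
qed

text \<open>The bijection is arbitrary because three are used: the identity for Fubini, a
  transposition for the invariance under swaps, and \<open>idx\<close> to pass from functions on
  \<open>{..<n}\<close> to vectors.\<close>

lemma lborel_eq_distr_PiM:
  fixes h :: "'i \<Rightarrow> 'n::finite"
  assumes h: "bij_betw h I UNIV" and I: "finite I"
  shows "lborel = distr (Pi\<^sub>M I (\<lambda>_. lborel)) borel (\<lambda>x. \<chi> j. (x (inv_into I h j) :: real))"
proof (rule lborel_eqI)
  interpret product_sigma_finite "\<lambda>_::'i. lborel :: real measure" by standard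
  let ?f = "\<lambda>x. \<chi> j. (x (inv_into I h j) :: real)"
  have inv: "inv_into I h j \<in> I" "h (inv_into I h j) = j" for j
    using h by (auto simp: bij_betw_def inv_into_into f_inv_into_f)
  have f[measurable]: "?f \<in> borel_measurable (Pi\<^sub>M I (\<lambda>_. lborel))"
    by (intro borel_measurable_vec_lambda_PiM inv)
  fix l u :: "real ^ 'n"
  assume le': "\<And>b. b \<in> Basis \<Longrightarrow> l \<bullet> b \<le> u \<bullet> b"
  have le: "l $ j \<le> u $ j" for j
    using le'[of "axis j 1"] by (auto simp: inner_axis Basis_vec_def)
  have "?f -` box l u \<inter> space (Pi\<^sub>M I (\<lambda>_. lborel)) = (\<Pi>\<^sub>E i\<in>I. {l $ h i <..< u $ h i})"
    using inv h by (auto simp: mem_box_cart space_PiM PiE_def Pi_def bij_betw_def)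
      (metis inv_into_f_f)+
  hence "emeasure (distr (Pi\<^sub>M I (\<lambda>_. lborel)) borel ?f) (box l u) =
      (\<Prod>i\<in>I. emeasure lborel {l $ h i <..< u $ h i})"
    using I by (simp add: emeasure_distr emeasure_PiM)
  also have "\<dots> = (\<Prod>i\<in>I. ennreal (u $ h i - l $ h i))"
    using le by simp
  also have "\<dots> = (\<Prod>j\<in>UNIV. ennreal (u $ j - l $ j))"
    by (rule prod.reindex_bij_betw[OF h])
  also have "\<dots> = ennreal (\<Prod>j\<in>UNIV. u $ j - l $ j)"
    using le by (intro prod_ennreal) simp
  also have "(\<Prod>j\<in>UNIV. u $ j - l $ j) = (\<Prod>b\<in>(\<lambda>j. axis j 1) ` UNIV. (u - l) \<bullet> b)"
    by (subst prod.reindex) (auto simp: inj_on_def axis_eq_axis inner_axis)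
  also have "(\<lambda>j. axis j 1) ` UNIV = (Basis :: (real ^ 'n) set)"
    by (auto simp: Basis_vec_def)
  finally show "emeasure (distr (Pi\<^sub>M I (\<lambda>_. lborel)) borel ?f) (box l u) =
    ennreal (\<Prod>b\<in>Basis. (u - l) \<bullet> b)" .
qed simp

text \<open>Fubini with coordinate \<open>m\<close> integrated first: for fixed other coordinates
  the shear is a translation by \<open>x $ k\<close>, which is constant because
  \<open>m \<noteq> k\<close>.\<close>

lemma nn_integral_lborel_shear:
  fixes F :: "real ^ 'n \<Rightarrow> ennreal"
  assumes [measurable]: "F \<in> borel_measurable borel" and "m \<noteq> k"
  shows "(\<integral>\<^sup>+x. F (\<chi> i. if i = m then x $ m + x $ k else x $ i) \<partial>lborel) = (\<integral>\<^sup>+x. F x \<partial>lborel)"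
proof -
  interpret product_sigma_finite "\<lambda>_::'n. lborel :: real measure" by standard
  let ?I = "UNIV - {m}"
  let ?s = "\<lambda>x. (\<chi> i. if i = m then x $ m + x $ k else x $ i) :: real ^ 'n"
  have U: "insert m ?I = UNIV" by auto
  have meas: "(\<lambda>x. \<chi> j. (x j :: real)) \<in> borel_measurable (Pi\<^sub>M (UNIV :: 'n set) (\<lambda>_. lborel))"
    by (rule borel_measurable_vec_lambda_PiM) simp
  have "continuous_on UNIV (\<lambda>x. if i = m then x $ m + x $ k else x $ i :: real)" for i
    by (cases "i = m") (auto intro!: continuous_intros)
  hence s[measurable]: "?s \<in> borel_measurable borel"
    by (intro borel_measurable_continuous_onI continuous_on_vec_lambda)
  have eq: "(\<integral>\<^sup>+x. G x \<partial>lborel) =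
      (\<integral>\<^sup>+x. \<integral>\<^sup>+y. G (\<chi> j. (x(m := y)) j) \<partial>lborel \<partial>Pi\<^sub>M ?I (\<lambda>_. lborel))"
    if G[measurable]: "G \<in> borel_measurable borel" for G :: "real ^ 'n \<Rightarrow> ennreal"
  proof -
    have "(\<integral>\<^sup>+x. G x \<partial>lborel) = (\<integral>\<^sup>+x. G (\<chi> j. x j) \<partial>Pi\<^sub>M UNIV (\<lambda>_. lborel))"
      by (subst lborel_eq_distr_PiM[of "\<lambda>i. i" UNIV])
         (auto simp: nn_integral_distr meas inv_into_def bij_betw_def)
    also have "\<dots> = (\<integral>\<^sup>+x. \<integral>\<^sup>+y. G (\<chi> j. (x(m := y)) j) \<partial>lborel \<partial>Pi\<^sub>M ?I (\<lambda>_. lborel))"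
      using product_nn_integral_insert[of ?I m "\<lambda>x. G (\<chi> j. x j)"] measurable_compose[OF meas G]
      unfolding U by simp
    finally show ?thesis .
  qed
  have "(\<integral>\<^sup>+y. F (?s (\<chi> j. (x(m := y)) j)) \<partial>lborel) = (\<integral>\<^sup>+y. F (\<chi> j. (x(m := y)) j) \<partial>lborel)" for x
  proof -
    have "continuous_on UNIV (\<lambda>y. (x(m := y)) j)" for j
      by (cases "j = m") auto
    hence "(\<lambda>y. \<chi> j. (x(m := y)) j) \<in> borel_measurable borel"
      by (intro borel_measurable_continuous_onI continuous_on_vec_lambda)
    hence "(\<lambda>y. F (\<chi> j. (x(m := y)) j)) \<in> borel_measurable borel"
      by (rule measurable_compose) simp
    hence "(\<integral>\<^sup>+y. F (\<chi> j. (x(m := y)) j) \<partial>lborel) = (\<integral>\<^sup>+y. F (\<chi> j. (x(m := x k + 1 * y)) j) \<partial>lborel)"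
      using nn_integral_real_affine[of "\<lambda>y. F (\<chi> j. (x(m := y)) j)" 1 "x k"]
      by (simp del: fun_upd_apply)
    moreover have "(\<chi> j. (x(m := x k + 1 * y)) j) = ?s (\<chi> j. (x(m := y)) j)" for y
      using \<open>m \<noteq> k\<close> by (auto simp: Finite_Cartesian_Product.vec_eq_iff)
    ultimately show ?thesis by simp
  qed
  moreover have "(\<lambda>x. F (?s x)) \<in> borel_measurable borel" by measurable
  ultimately show ?thesis by (simp add: eq[of F] eq[of "\<lambda>x. F (?s x)"])
qed

text \<open>Both sides equal one integral over the product space, from which Lebesgue measure arises
  through the identity as well as through the transposition.\<close>

lemma nn_integral_lborel_swap:
  fixes F :: "real ^ 'n \<Rightarrow> ennreal"
  assumes [measurable]: "F \<in> borel_measurable borel"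
  shows "(\<integral>\<^sup>+x. F (\<chi> i. x $ Transposition.transpose m k i) \<partial>lborel) = (\<integral>\<^sup>+x. F x \<partial>lborel)"
proof -
  have meas: "(\<lambda>x. \<chi> j. (x j :: real)) \<in> borel_measurable (Pi\<^sub>M (UNIV :: 'n set) (\<lambda>_. lborel))"
    "(\<lambda>x. \<chi> j. (x (Transposition.transpose m k j) :: real)) \<in> borel_measurable (Pi\<^sub>M (UNIV :: 'n set) (\<lambda>_. lborel))"
    by (rule borel_measurable_vec_lambda_PiM, simp)+
  have s[measurable]: "(\<lambda>x. \<chi> i. (x $ Transposition.transpose m k i :: real)) \<in> borel_measurable borel"
    by (intro borel_measurable_continuous_onI continuous_on_vec_lambda continuous_intros)
  have inv: "inv_into UNIV (Transposition.transpose m k) = Transposition.transpose m k"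
    by (rule inv_unique_comp) auto
  have "(\<integral>\<^sup>+x. F (\<chi> i. x $ Transposition.transpose m k i) \<partial>lborel) =
      (\<integral>\<^sup>+x. F (\<chi> j. x (Transposition.transpose m k j)) \<partial>Pi\<^sub>M UNIV (\<lambda>_. lborel))"
    by (subst lborel_eq_distr_PiM[of "\<lambda>i. i" UNIV])
       (auto simp: nn_integral_distr meas inv_into_def bij_betw_def)
  also have "\<dots> = (\<integral>\<^sup>+x. F x \<partial>lborel)"
    by (subst lborel_eq_distr_PiM[of "Transposition.transpose m k" UNIV])
       (auto simp: nn_integral_distr meas inv)
  finally show ?thesis .
qed

lemma nn_integral_lborel_stretch:
  fixes F :: "real ^ 'n \<Rightarrow> ennreal"
  assumes [measurable]: "F \<in> borel_measurable borel" and c: "\<And>i. c i \<noteq> 0"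
  shows "(\<integral>\<^sup>+x. F x \<partial>lborel) = ennreal \<bar>\<Prod>i\<in>UNIV. c i\<bar> * (\<integral>\<^sup>+x. F (\<chi> i. c i * x $ i) \<partial>lborel)"
proof -
  let ?c = "\<lambda>b. \<Sum>i\<in>UNIV. c i * b $ i"
  have B: "(Basis :: (real ^ 'n) set) = (\<lambda>j. axis j 1) ` UNIV"
    by (auto simp: Basis_vec_def)
  have inj: "inj_on (\<lambda>j. axis j 1 :: real ^ 'n) UNIV" by (auto simp: inj_on_def axis_eq_axis)
  have c': "?c (axis j 1) = c j" for j
    by (simp add: axis_def if_distrib[of "\<lambda>x. _ * x"] cong: if_cong)
  have T: "0 + (\<Sum>j\<in>Basis. (?c j * (x \<bullet> j)) *\<^sub>R j) = (\<chi> i. c i * x $ i)" for x :: "real ^ 'n"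
    unfolding B sum.reindex[OF inj]
    by (simp add: c' inner_axis) (simp add: Finite_Cartesian_Product.vec_eq_iff sum_component axis_def if_distrib[of "\<lambda>x. _ * x"] cong: if_cong)
  have s[measurable]: "(\<lambda>x. \<chi> i. (c i * x $ i :: real)) \<in> borel_measurable borel"
    by (intro borel_measurable_continuous_onI continuous_on_vec_lambda continuous_intros)
  have "(\<Prod>j\<in>(Basis :: (real ^ 'n) set). \<bar>?c j\<bar>) = \<bar>\<Prod>i\<in>UNIV. c i\<bar>"
    unfolding B prod.reindex[OF inj] by (simp add: c' abs_prod)
  moreover have "lborel = density (distr lborel borel (\<lambda>x. 0 + (\<Sum>j\<in>Basis. (?c j * (x \<bullet> j)) *\<^sub>R j)))
      (\<lambda>_. \<Prod>j\<in>(Basis :: (real ^ 'n) set). \<bar>?c j\<bar>)"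
    by (rule lborel_affine_euclidean) (auto simp: B c' c)
  ultimately have lb: "lborel = density (distr lborel borel (\<lambda>x. \<chi> i. c i * x $ i)) (\<lambda>_. \<bar>\<Prod>i\<in>UNIV. c i\<bar>)"
    unfolding T by simp
  have "(\<integral>\<^sup>+x. F x \<partial>lborel) = (\<integral>\<^sup>+x. F x \<partial>density (distr lborel borel (\<lambda>x. \<chi> i. c i * x $ i))
      (\<lambda>_. \<bar>\<Prod>i\<in>UNIV. c i\<bar>))"
    by (rule arg_cong[OF lb])
  thus ?thesis
    by (simp add: nn_integral_density nn_integral_distr nn_integral_cmult)
qed

lemma nn_integral_lborel_linear:
  fixes f :: "real ^ 'n \<Rightarrow> real ^ 'n"
  assumes "linear f" "Determinants.det (matrix f) \<noteq> 0" "F \<in> borel_measurable borel"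
  shows "(\<integral>\<^sup>+x. F x \<partial>lborel) = ennreal \<bar>Determinants.det (matrix f)\<bar> * (\<integral>\<^sup>+x. F (f x) \<partial>lborel)"
proof -
  \<comment> \<open>\<open>F\<close> is quantified inside the induction because for a composition
    the hypothesis on \<open>g\<close> is applied to \<open>F\<close> composed with
    \<open>f\<close>. The condition on the determinant is inside because it passes to both factors
    and makes the case of a zero component vacuous.\<close>
  have "Determinants.det (matrix f) \<noteq> 0 \<longrightarrow> (\<forall>F \<in> borel_measurable borel.
    (\<integral>\<^sup>+x. F x \<partial>lborel) = ennreal \<bar>Determinants.det (matrix f)\<bar> * (\<integral>\<^sup>+x. F (f x) \<partial>lborel))"
  proof (rule induct_linear_elementary[OF \<open>linear f\<close>]; intro impI ballI)
    fix f g :: "real ^ 'n \<Rightarrow> real ^ 'n" and F :: "real ^ 'n \<Rightarrow> ennreal"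
    assume f: "linear f" "Determinants.det (matrix f) \<noteq> 0 \<longrightarrow> (\<forall>F \<in> borel_measurable borel.
        (\<integral>\<^sup>+x. F x \<partial>lborel) = ennreal \<bar>Determinants.det (matrix f)\<bar> * (\<integral>\<^sup>+x. F (f x) \<partial>lborel))"
      and g: "linear g" "Determinants.det (matrix g) \<noteq> 0 \<longrightarrow> (\<forall>F \<in> borel_measurable borel.
        (\<integral>\<^sup>+x. F x \<partial>lborel) = ennreal \<bar>Determinants.det (matrix g)\<bar> * (\<integral>\<^sup>+x. F (g x) \<partial>lborel))"
      and d: "Determinants.det (matrix (f \<circ> g)) \<noteq> 0" and F[measurable]: "F \<in> borel_measurable borel"
    have [measurable]: "f \<in> borel_measurable borel"
      using f(1) by (intro borel_measurable_continuous_onI linear_continuous_on) (simp add: linear_linear)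
    have det: "Determinants.det (matrix (f \<circ> g)) = Determinants.det (matrix f) * Determinants.det (matrix g)"
      using f g by (simp add: matrix_compose Determinants.det_mul)
    have "(\<integral>\<^sup>+x. F x \<partial>lborel) = ennreal \<bar>Determinants.det (matrix f)\<bar> * (\<integral>\<^sup>+x. F (f x) \<partial>lborel)"
      by (rule f(2)[rule_format, OF _ F]) (use d det in simp)
    also have "(\<integral>\<^sup>+x. F (f x) \<partial>lborel) =
        ennreal \<bar>Determinants.det (matrix g)\<bar> * (\<integral>\<^sup>+x. F (f (g x)) \<partial>lborel)"
      by (rule g(2)[rule_format]) (use d det in simp, measurable)
    finally show "(\<integral>\<^sup>+x. F x \<partial>lborel) =
        ennreal \<bar>Determinants.det (matrix (f \<circ> g))\<bar> * (\<integral>\<^sup>+x. F ((f \<circ> g) x) \<partial>lborel)"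
      by (simp add: det abs_mult ennreal_mult mult.assoc)
  next
    fix f :: "real ^ 'n \<Rightarrow> real ^ 'n" and i and F :: "real ^ 'n \<Rightarrow> ennreal"
    assume "\<And>x. f x $ i = 0" and d: "Determinants.det (matrix f) \<noteq> 0"
    hence "Finite_Cartesian_Product.row i (matrix f) = 0" by (auto simp: Finite_Cartesian_Product.row_def matrix_def Finite_Cartesian_Product.vec_eq_iff)
    hence "Determinants.det (matrix f) = 0" by (rule Determinants.det_zero_row)
    with d show "(\<integral>\<^sup>+x. F x \<partial>lborel) =
        ennreal \<bar>Determinants.det (matrix f)\<bar> * (\<integral>\<^sup>+x. F (f x) \<partial>lborel)" by simp
  next
    fix c and F :: "real ^ 'n \<Rightarrow> ennreal"
    let ?f = "\<lambda>x. (\<chi> i. c i * x $ i) :: real ^ 'n"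
    assume d: "Determinants.det (matrix ?f) \<noteq> 0" and F: "F \<in> borel_measurable borel"
    have det: "Determinants.det (matrix ?f) = (\<Prod>i\<in>UNIV. c i)"
      by (subst Determinants.det_diagonal) (auto simp: matrix_def axis_def)
    show "(\<integral>\<^sup>+x. F x \<partial>lborel) = ennreal \<bar>Determinants.det (matrix ?f)\<bar> * (\<integral>\<^sup>+x. F (?f x) \<partial>lborel)"
      unfolding det using d det by (intro nn_integral_lborel_stretch[OF F]) auto
  next
    fix m k :: 'n and F :: "real ^ 'n \<Rightarrow> ennreal"
    let ?f = "\<lambda>x. (\<chi> i. x $ Transposition.transpose m k i) :: real ^ 'n"
    assume "m \<noteq> k" and F: "F \<in> borel_measurable borel"
    have "matrix ?f = (\<chi> i. Finite_Cartesian_Product.mat 1 $ Transposition.transpose m k i)"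
      by (auto simp: matrix_def axis_def Finite_Cartesian_Product.mat_def Finite_Cartesian_Product.vec_eq_iff)
    hence "\<bar>Determinants.det (matrix ?f)\<bar> = 1"
      by (simp add: Determinants.det_permute_rows permutes_swap_id sign_swap_id abs_mult)
    thus "(\<integral>\<^sup>+x. F x \<partial>lborel) = ennreal \<bar>Determinants.det (matrix ?f)\<bar> * (\<integral>\<^sup>+x. F (?f x) \<partial>lborel)"
      by (simp add: nn_integral_lborel_swap[OF F])
  next
    fix m k :: 'n and F :: "real ^ 'n \<Rightarrow> ennreal"
    let ?f = "\<lambda>x. (\<chi> i. if i = m then x $ m + x $ k else x $ i) :: real ^ 'n"
    assume mk: "m \<noteq> k" and F: "F \<in> borel_measurable borel"
    have "matrix ?f = (\<chi> i. if i = m then Finite_Cartesian_Product.row m (Finite_Cartesian_Product.mat 1) + 1 *s Finite_Cartesian_Product.row k (Finite_Cartesian_Product.mat 1)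
        else Finite_Cartesian_Product.row i (Finite_Cartesian_Product.mat 1))"
      by (auto simp: matrix_def axis_def Finite_Cartesian_Product.mat_def Finite_Cartesian_Product.row_def Finite_Cartesian_Product.vec_eq_iff)
    hence "Determinants.det (matrix ?f) = 1"
      using Determinants.det_row_operation[OF mk, of "Finite_Cartesian_Product.mat 1" 1] by simp
    thus "(\<integral>\<^sup>+x. F x \<partial>lborel) = ennreal \<bar>Determinants.det (matrix ?f)\<bar> * (\<integral>\<^sup>+x. F (?f x) \<partial>lborel)"
      by (simp add: nn_integral_lborel_shear[OF F mk])
  qed
  thus ?thesis using assms by blast
qed

text \<open>The parametrisation is the coordinate isomorphism followed by the linear map with
  columns \<open>e i\<close> and a translation. The measure is pushed forward, so the density is the
  reciprocal of the Jacobian.\<close>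

lemma distr_affine_param:
  fixes a :: "real ^ 'n" and e :: "nat \<Rightarrow> real ^ 'n"
  defines "\<phi> \<equiv> \<lambda>x::nat \<Rightarrow> real. a + (\<Sum>i<CARD('n). x i *\<^sub>R e i)"
  assumes d: "vdet e \<noteq> 0"
  shows "\<phi> \<in> borel_measurable (lborel_pow CARD('n))"
    and "distr (lborel_pow CARD('n)) borel \<phi> = density lborel (\<lambda>_. ennreal (1 / \<bar>vdet e\<bar>))"
proof -
  let ?I = "{..<CARD('n)}"
  let ?iota = "\<lambda>x::nat \<Rightarrow> real. (\<chi> j. x (inv_into ?I idx j)) :: real ^ 'n"
  define f where "f = (\<lambda>y::real ^ 'n. \<Sum>i<CARD('n). y $ idx i *\<^sub>R e i)"
  note bij = bij_betw_idx[where 'n = 'n]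
  have "linear f"
    by (auto simp: f_def linear_iff scaleR_add_left sum.distrib scaleR_sum_right)
  have "matrix f $ idx i $ idx j = e j $ idx i" if "j < CARD('n)" for i j
    using that by (simp add: f_def matrix_def axis_def idx_eq_iff if_distrib[of "\<lambda>x. x * _"]
        cong: if_cong)
  hence det: "Determinants.det (matrix f) = vdet e"
    unfolding vdet_def by (subst fdet_idx[symmetric]) (auto intro!: fdet_cong)
  have \<phi>: "\<phi> = (\<lambda>y. a + f y) \<circ> ?iota"
    by (auto simp: \<phi>_def f_def fun_eq_iff bij_betw_inv_into_left[OF bij])
  have [measurable]: "?iota \<in> borel_measurable (lborel_pow CARD('n))"
    using bij by (intro borel_measurable_vec_lambda_PiM) (metis UNIV_I bij_betw_def inv_into_into)
  have [measurable]: "f \<in> borel_measurable borel"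
    using \<open>linear f\<close> by (intro borel_measurable_continuous_onI linear_continuous_on) (simp add: linear_linear)
  show m[measurable]: "\<phi> \<in> borel_measurable (lborel_pow CARD('n))"
    unfolding \<phi> by measurable
  show "distr (lborel_pow CARD('n)) borel \<phi> = density lborel (\<lambda>_. ennreal (1 / \<bar>vdet e\<bar>))"
  proof (rule measure_eqI)
    fix A assume "A \<in> sets (distr (lborel_pow CARD('n)) borel \<phi>)"
    hence [measurable]: "A \<in> sets borel" by simp
    let ?F = "\<lambda>y. indicator A (a + y) :: ennreal"
    have "emeasure (distr (lborel_pow CARD('n)) borel \<phi>) A = (\<integral>\<^sup>+y. indicator A (\<phi> y) \<partial>lborel_pow CARD('n))"
      by (simp flip: nn_integral_indicator add: nn_integral_distr)
    also have "\<dots> = (\<integral>\<^sup>+y. ?F (f y) \<partial>lborel)"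
      by (subst lborel_eq_distr_PiM[OF bij]) (auto simp: nn_integral_distr \<phi>)
    also have "\<dots> = ennreal (1 / \<bar>vdet e\<bar>) * (\<integral>\<^sup>+y. ?F y \<partial>lborel)"
      using d by (subst nn_integral_lborel_linear[OF \<open>linear f\<close>, of ?F])
        (auto simp: det simp flip: mult.assoc ennreal_mult)
    also have "(\<integral>\<^sup>+y. ?F y \<partial>lborel) = (\<integral>\<^sup>+y. indicator A y \<partial>lborel)"
      using nn_integral_distr[of "(+) a" lborel borel "indicator A"]
      by (simp add: lborel_distr_plus)
    finally show "emeasure (distr (lborel_pow CARD('n)) borel \<phi>) A =
        emeasure (density lborel (\<lambda>_. ennreal (1 / \<bar>vdet e\<bar>))) A"
      by (simp add: emeasure_density nn_integral_cmult)
  qed simp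
qed

section \<open>Integrals of forms along affine parametrisations\<close>

lemma emeasure_std_simplex_pow: "emeasure (lborel_pow k) (std_simplex_pow k) = ennreal (1 / fact k)"
proof -
  have "std_simplex_pow k = {x. (\<forall>i\<in>{..<k}. 0 \<le> x i) \<and> sum x {..<k} \<le> 1} \<inter> space (lborel_pow k)"
    by (auto simp: std_simplex_pow_def orthant_def)
  thus ?thesis using emeasure_std_simplex_aux[of "{..<k}" 1] by simp
qed

lemma sets_orthant: "orthant k \<in> sets (lborel_pow k)"
proof -
  have "orthant k = (\<Pi>\<^sub>E i\<in>{..<k}. {0..})"
    by (auto simp: orthant_def space_PiM PiE_def Pi_def)
  thus ?thesis by (auto intro!: sets_PiM_I_finite)
qed

lemma sets_std_simplex_pow: "std_simplex_pow k \<in> sets (lborel_pow k)"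
proof -
  have "(\<lambda>x. sum x {..<k}) \<in> borel_measurable (lborel_pow k)" by measurable
  hence "(\<lambda>x. sum x {..<k}) -` {..1} \<inter> space (lborel_pow k) \<in> sets (lborel_pow k)"
    by (rule measurable_sets) auto
  hence "orthant k \<inter> ((\<lambda>x. sum x {..<k}) -` {..1} \<inter> space (lborel_pow k)) \<in> sets (lborel_pow k)"
    by (rule sets.Int[OF sets_orthant])
  also have "orthant k \<inter> ((\<lambda>x. sum x {..<k}) -` {..1} \<inter> space (lborel_pow k)) = std_simplex_pow k"
    by (auto simp: std_simplex_pow_def orthant_def)
  finally show ?thesis .
qed

text \<open>The divisor comes from the volume of the standard simplex; it will cancel the factorial
  in the normalisation of the Whitney forms.\<close>

lemma affine_integral_const_form:
  "(\<And>x. x \<in> std_simplex_pow k \<Longrightarrow> u (p + (\<Sum>i<k. x i *\<^sub>R e i)) e = c) \<Longrightarrow>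
   affine_integral k (std_simplex_pow k) p e u = c / fact k"
proof -
  assume u: "\<And>x. x \<in> std_simplex_pow k \<Longrightarrow> u (p + (\<Sum>i<k. x i *\<^sub>R e i)) e = c"
  have "affine_integral k (std_simplex_pow k) p e u = (LINT x:std_simplex_pow k|lborel_pow k. c)"
    unfolding affine_integral_def using u by (intro set_lebesgue_integral_cong sets_std_simplex_pow) auto
  also have "\<dots> = c * measure (lborel_pow k) (std_simplex_pow k)"
    by (subst set_integral_const) (auto simp: sets_std_simplex_pow emeasure_std_simplex_pow)
  finally show ?thesis by (simp add: measure_def emeasure_std_simplex_pow)
qed

text \<open>The pullback contributes \<open>vdet e\<close> and the change of variables its inverse
  modulus, so only the orientation sign of the parametrisation survives.\<close>

lemma affine_integral_eq_lborel:
  fixes a :: "real ^ 'n" and e :: "nat \<Rightarrow> real ^ 'n"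
  assumes u: "\<And>x. u x e = g x * vdet e" and d: "vdet e \<noteq> 0"
    and [measurable]: "g \<in> borel_measurable borel" "S \<in> sets borel"
    and S: "\<And>x. x \<in> space (lborel_pow CARD('n)) \<Longrightarrow> a + (\<Sum>i<CARD('n). x i *\<^sub>R e i) \<in> S \<longleftrightarrow> x \<in> D"
  shows "affine_integral CARD('n) D a e u = sgn (vdet e) * (LINT x:S|lborel. g x)"
proof -
  let ?\<phi> = "\<lambda>x::nat \<Rightarrow> real. a + (\<Sum>i<CARD('n). x i *\<^sub>R e i)"
  note [measurable] = distr_affine_param(1)[OF d, of a]
  have "affine_integral CARD('n) D a e u =
      (LINT x|lborel_pow CARD('n). (indicator S (?\<phi> x) * g (?\<phi> x)) * vdet e)"
    unfolding affine_integral_def set_lebesgue_integral_def u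
    by (intro Bochner_Integration.integral_cong refl) (auto simp: S indicator_def)
  also have "\<dots> = vdet e * (LINT y|distr (lborel_pow CARD('n)) borel ?\<phi>. indicator S y * g y)"
    by (subst integral_distr) auto
  also have "\<dots> = vdet e * (1 / \<bar>vdet e\<bar> * (LINT y|lborel. indicator S y * g y))"
    unfolding distr_affine_param(2)[OF d] by (subst integral_density) auto
  also have "vdet e * (1 / \<bar>vdet e\<bar> * (LINT y|lborel. indicator S y * g y)) =
      sgn (vdet e) * (LINT y|lborel. indicator S y * g y)"
    using d by (simp add: sgn_if)
  finally show ?thesis by (simp add: set_lebesgue_integral_def)
qed

section \<open>Barycentric coordinates\<close>

text \<open>For a real parameter \<open>s\<close>, the constraint
  \<open>0 \<le> d j + s * \<mu> j\<close> is a half-line bounded below if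
  \<open>\<mu> j > 0\<close>, bounded above if \<open>\<mu> j < 0\<close>, and independent of
  \<open>s\<close> otherwise. Together they cut out an interval, and the \<open>i\<close>-th summand
  is nonzero only if the bound \<open>r i\<close> is one of its endpoints. A lower endpoint counts
  1, an upper one -1, so a bounded interval contributes nothing. As some \<open>\<mu> i\<close> is
  positive, what remains is the case of a half-line unbounded above. Genericity makes the bounds
  distinct, so that no endpoint is counted twice.\<close>

lemma sum_sgn_first_exit:
  fixes \<mu> d :: "'i \<Rightarrow> real"
  assumes J: "finite J"
    and generic: "\<And>i j. i \<in> J \<Longrightarrow> j \<in> J \<Longrightarrow> i \<noteq> j \<Longrightarrow> \<mu> i \<noteq> 0 \<Longrightarrow> \<mu> j \<noteq> 0 \<Longrightarrow> d i * \<mu> j \<noteq> d j * \<mu> i"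
    and pos: "\<exists>i\<in>J. 0 < \<mu> i"
  shows "(\<Sum>i\<in>J. sgn (\<mu> i) * of_bool (\<forall>j\<in>J. 0 \<le> d j + (- d i / \<mu> i) * \<mu> j)) =
    of_bool (\<forall>j\<in>J. 0 \<le> \<mu> j \<and> (\<mu> j = 0 \<longrightarrow> 0 \<le> d j))"
proof -
  define r where "r i = - d i / \<mu> i" for i
  define P where "P = {i \<in> J. 0 < \<mu> i}"
  define N where "N = {i \<in> J. \<mu> i < 0}"
  define Z where "Z \<longleftrightarrow> (\<forall>j\<in>J. \<mu> j = 0 \<longrightarrow> 0 \<le> d j)"
  let ?A = "\<lambda>i. \<forall>j\<in>J. 0 \<le> d j + r i * \<mu> j"
  have fin: "finite P" "finite N" "P \<noteq> {}" using J pos by (auto simp: P_def N_def)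
  have inj: "inj_on r (P \<union> N)"
  proof (rule inj_onI)
    fix i j assume ij: "i \<in> P \<union> N" "j \<in> P \<union> N" "r i = r j"
    hence "d i * \<mu> j = d j * \<mu> i" by (auto simp: P_def N_def r_def field_simps)
    thus "i = j" using generic[of i j] ij by (cases "i = j") (auto simp: P_def N_def)
  qed
  have A: "?A i \<longleftrightarrow> Z \<and> (\<forall>j\<in>P. r j \<le> r i) \<and> (\<forall>j\<in>N. r i \<le> r j)" for i
  proof -
    have "0 \<le> d j + r i * \<mu> j \<longleftrightarrow>
        (if \<mu> j = 0 then 0 \<le> d j else if 0 < \<mu> j then r j \<le> r i else r i \<le> r j)" for j
      by (auto simp: r_def field_simps)
    thus ?thesis by (auto simp: P_def N_def Z_def split: if_splits)
  qed
  \<comment> \<open>Indices with \<open>\<mu> i = 0\<close>, where the quotient has the default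
    value 0, drop out through \<open>sgn 0 = 0\<close>.\<close>
  have "(\<Sum>i\<in>J. sgn (\<mu> i) * of_bool (?A i)) = (\<Sum>i\<in>P \<union> N. sgn (\<mu> i) * of_bool (?A i))"
    using J by (intro sum.mono_neutral_right) (auto simp: P_def N_def sgn_if)
  also have "\<dots> = (\<Sum>i\<in>P. sgn (\<mu> i) * of_bool (?A i)) + (\<Sum>i\<in>N. sgn (\<mu> i) * of_bool (?A i))"
    using fin by (intro sum.union_disjoint) (auto simp: P_def N_def)
  also have "(\<Sum>i\<in>P. sgn (\<mu> i) * of_bool (?A i)) = (\<Sum>i\<in>P. of_bool (?A i))"
    by (intro sum.cong) (auto simp: P_def)
  also have "(\<Sum>i\<in>N. sgn (\<mu> i) * of_bool (?A i)) = (\<Sum>i\<in>N. - of_bool (?A i))"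
    by (intro sum.cong) (auto simp: N_def)
  finally have S: "(\<Sum>i\<in>J. sgn (\<mu> i) * of_bool (?A i)) = (\<Sum>i\<in>P. of_bool (?A i)) - (\<Sum>i\<in>N. of_bool (?A i))"
    by (simp add: sum_negf)
  obtain lo where lo: "lo \<in> P" "\<And>j. j \<in> P \<Longrightarrow> r j \<le> r lo"
    using Max_in[of "r ` P"] Max_ge[of "r ` P"] fin by (metis (no_types, lifting) finite_imageI image_iff image_is_empty)
  have P_sum: "(\<Sum>i\<in>P. of_bool (?A i)) = (of_bool (?A lo) :: real)"
  proof -
    have "?A i \<longleftrightarrow> i = lo \<and> ?A lo" if "i \<in> P" for i
      using that lo inj A by (metis UnI1 antisym inj_onD)
    hence "(\<Sum>i\<in>P. of_bool (?A i)) = (\<Sum>i\<in>P. if i = lo then of_bool (?A lo) else 0 :: real)"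
      by (intro sum.cong) auto
    thus ?thesis using lo fin by simp
  qed
  have "(\<Sum>i\<in>J. sgn (\<mu> i) * of_bool (?A i)) = of_bool (N = {} \<and> Z)"
  proof (cases "N = {}")
    case True
    thus ?thesis using lo unfolding S P_sum by (simp add: A)
  next
    case False
    then obtain hi where hi: "hi \<in> N" "\<And>j. j \<in> N \<Longrightarrow> r hi \<le> r j"
      using Min_in[of "r ` N"] Min_le[of "r ` N"] fin by (metis (no_types, lifting) finite_imageI image_iff image_is_empty)
    have "?A i \<longleftrightarrow> i = hi \<and> ?A hi" if "i \<in> N" for i
      using that hi inj A by (metis UnI2 antisym inj_onD)
    hence "(\<Sum>i\<in>N. of_bool (?A i)) = (\<Sum>i\<in>N. if i = hi then of_bool (?A hi) else 0 :: real)"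
      by (intro sum.cong) auto
    also have "\<dots> = of_bool (?A hi)" using hi fin by simp
    \<comment> \<open>Each of the two says that the interval from \<open>r lo\<close> to
      \<open>r hi\<close> is nonempty and that the constraints without \<open>s\<close> hold; hence
      entry and exit cancel.\<close>
    also have "?A hi \<longleftrightarrow> ?A lo" unfolding A using lo hi by (meson order_trans)
    finally show ?thesis using False unfolding S P_sum by simp
  qed
  also have "(N = {} \<and> Z) \<longleftrightarrow> (\<forall>j\<in>J. 0 \<le> \<mu> j \<and> (\<mu> j = 0 \<longrightarrow> 0 \<le> d j))"
    by (auto simp: N_def Z_def not_less)
  finally show ?thesis by (simp add: r_def)
qed

section \<open>Homogenised barycentric coordinates\<close>

definition affine_frame :: "(real ^ 'n) set \<Rightarrow> bool" where
  "affine_frame V \<longleftrightarrow> \<not> affine_dependent V \<and> card V = Suc CARD('n)"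

lemma affine_frameD: "affine_frame V \<Longrightarrow> finite V" "affine_frame V \<Longrightarrow> \<not> affine_dependent V"
  "affine_frame (V :: (real ^ 'n) set) \<Longrightarrow> card V = Suc CARD('n)"
  by (auto simp: affine_frame_def intro: card_ge_0_finite)

text \<open>Affine independence of \<open>V\<close> is linear independence of the vectors
  \<open>(1, p)\<close>. There are \<open>n + 1\<close> of them, so they form a basis, and the
  functionals are the dual basis.\<close>

lemma barycentric_functionals_exist:
  fixes V :: "(real ^ 'n) set"
  assumes "affine_frame V"
  shows "\<exists>c. (\<forall>p. linear (c p)) \<and> (\<forall>p. p \<notin> V \<longrightarrow> c p = (\<lambda>_. 0)) \<and>
    (\<forall>p\<in>V. \<forall>q\<in>V. c p (1 :: real, q) = of_bool (p = q)) \<and>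
    (\<forall>s x. (\<Sum>p\<in>V. c p (s, x)) = s \<and> (\<Sum>p\<in>V. c p (s, x) *\<^sub>R p) = x)"
proof -
  note V = affine_frameD[OF assms]
  define B where "B = (\<lambda>p. (1 :: real, p)) ` V"
  have inj: "inj_on (\<lambda>p. (1 :: real, p)) V" by (simp add: inj_on_def)
  have fB: "finite B" using V by (simp add: B_def)
  have indep: "independent B"
  proof (rule independent_if_scalars_zero[OF fB])
    fix f z assume f: "(\<Sum>x\<in>B. f x *\<^sub>R x) = 0" and "z \<in> B"
    have "(\<Sum>p\<in>V. f (1, p) *\<^sub>R (1 :: real, p)) = 0"
      using f unfolding B_def sum.reindex[OF inj] by simp
    hence "(\<Sum>p\<in>V. f (1, p)) = 0 \<and> (\<Sum>p\<in>V. f (1, p) *\<^sub>R p) = 0"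
      by (simp add: prod_eq_iff fst_sum snd_sum)
    hence "\<forall>p\<in>V. f (1, p) = 0"
      using V(2) unfolding affine_dependent_explicit_finite[OF V(1)] by fast
    thus "f z = 0" using \<open>z \<in> B\<close> by (auto simp: B_def)
  qed
  have "card B = DIM(real \<times> (real ^ 'n))"
    using V(3) by (simp add: B_def card_image[OF inj])
  hence span: "span B = UNIV"
    using card_eq_dim[of B UNIV] indep fB by auto
  have "\<exists>g. linear g \<and> (\<forall>b\<in>B. g b = (of_bool (b = (1, p)) :: real))" for p :: "real ^ 'n"
    using linear_independent_extend[OF indep, of "\<lambda>b. of_bool (b = (1, p)) :: real"] by blast
  then obtain g where g: "\<And>p. linear (g p)" "\<And>p b. b \<in> B \<Longrightarrow> g p b = (of_bool (b = (1, p)) :: real)"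
    by metis
  have repr: "(\<Sum>p\<in>V. g p y *\<^sub>R (1 :: real, p)) = y" for y
  proof -
    have "y \<in> span B" by (simp add: span)
    then obtain u where u: "y = (\<Sum>b\<in>B. u b *\<^sub>R b)"
      unfolding span_finite[OF fB] by blast
    hence y: "y = (\<Sum>q\<in>V. u (1, q) *\<^sub>R (1, q))"
      unfolding B_def sum.reindex[OF inj] by simp
    have "g p y = u (1, p)" if "p \<in> V" for p
    proof -
      have "g p y = (\<Sum>q\<in>V. u (1, q) * g p (1, q))"
        by (subst y) (simp only: linear_sum[OF g(1)] linear_scale[OF g(1)] real_scaleR_def)
      also have "\<dots> = (\<Sum>q\<in>V. if q = p then u (1, q) else 0)"
        by (intro sum.cong) (auto simp: g(2) B_def)
      finally show ?thesis using that V(1) by simp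
    qed
    thus ?thesis using y by simp
  qed
  \<comment> \<open>Points outside \<open>V\<close> get the zero functional, so that the formula for
    hat functions on a cell also covers vertices that the cell does not contain.\<close>
  define c where "c p = (if p \<in> V then g p else (\<lambda>_. 0))" for p
  have "(\<Sum>p\<in>V. c p (s, x)) = s \<and> (\<Sum>p\<in>V. c p (s, x) *\<^sub>R p) = x" for s x
    using repr[of "(s, x)"] by (simp add: c_def prod_eq_iff fst_sum snd_sum)
  moreover have "linear (c p)" for p by (simp add: c_def g(1) linear_zero)
  moreover have "c p (1, q) = of_bool (p = q)" if "p \<in> V" "q \<in> V" for p q
    using that by (auto simp: c_def g(2) B_def)
  ultimately show ?thesis by (intro exI[of _ c]) (auto simp: c_def)
qed

text \<open>The functional \<open>bary V p\<close> is the homogenised barycentric coordinate of \<open>p\<close>: at \<open>(1, x)\<close> it is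
  the coordinate of the point \<open>x\<close>, and at \<open>(0, w)\<close> its derivative in the direction \<open>w\<close>.\<close>
definition bary :: "(real ^ 'n) set \<Rightarrow> real ^ 'n \<Rightarrow> real \<times> (real ^ 'n) \<Rightarrow> real" where
  "bary V = (SOME c. (\<forall>p. linear (c p)) \<and> (\<forall>p. p \<notin> V \<longrightarrow> c p = (\<lambda>_. 0)) \<and>
    (\<forall>p\<in>V. \<forall>q\<in>V. c p (1, q) = of_bool (p = q)) \<and>
    (\<forall>s x. (\<Sum>p\<in>V. c p (s, x)) = s \<and> (\<Sum>p\<in>V. c p (s, x) *\<^sub>R p) = x))"

context
  fixes V :: "(real ^ 'n) set"
  assumes V: "affine_frame V"
begin

lemma linear_bary: "linear (bary V p)"
  and bary_not_in: "p \<notin> V \<Longrightarrow> bary V p y = 0"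
  and bary_vertex_in: "p \<in> V \<Longrightarrow> q \<in> V \<Longrightarrow> bary V p (1, q) = of_bool (p = q)"
  and sum_bary: "(\<Sum>p\<in>V. bary V p (s, x)) = s"
  and sum_bary_scaleR: "(\<Sum>p\<in>V. bary V p (s, x) *\<^sub>R p) = x"
  using someI_ex[OF barycentric_functionals_exist[OF V]] unfolding bary_def[symmetric]
  by simp_all

lemma bary_vertex: "q \<in> V \<Longrightarrow> bary V p (1, q) = of_bool (p = q)"
  by (cases "p \<in> V") (auto simp: bary_vertex_in bary_not_in)

lemma bary_diff: "bary V p (s, x) - bary V p (t, y) = bary V p (s - t, x - y)"
  using linear_diff[OF linear_bary, of p "(s, x)" "(t, y)"] by simp

lemma bary_unique:
  assumes "(\<Sum>q\<in>V. u q) = s" "(\<Sum>q\<in>V. u q *\<^sub>R q) = x" "p \<in> V"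
  shows "bary V p (s, x) = u p"
proof -
  have "(s, x) = (\<Sum>q\<in>V. u q *\<^sub>R (1, q))"
    using assms by (simp add: prod_eq_iff fst_sum snd_sum)
  hence "bary V p (s, x) = (\<Sum>q\<in>V. u q * bary V p (1, q))"
    by (simp only: linear_sum[OF linear_bary] linear_scale[OF linear_bary] real_scaleR_def)
  also have "\<dots> = (\<Sum>q\<in>V. if q = p then u q else 0)"
    by (intro sum.cong) (auto simp: bary_vertex)
  finally show ?thesis using assms affine_frameD(1)[OF V] by simp
qed

lemma convex_hull_iff_bary: "x \<in> convex hull V \<longleftrightarrow> (\<forall>p\<in>V. 0 \<le> bary V p (1, x))"
proof
  assume "x \<in> convex hull V"
  then obtain u where "\<forall>q\<in>V. 0 \<le> u q" "sum u V = 1" "(\<Sum>q\<in>V. u q *\<^sub>R q) = x"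
    unfolding convex_hull_finite[OF affine_frameD(1)[OF V]] by blast
  thus "\<forall>p\<in>V. 0 \<le> bary V p (1, x)" using bary_unique[of u 1 x] by simp
next
  assume "\<forall>p\<in>V. 0 \<le> bary V p (1, x)"
  thus "x \<in> convex hull V"
    unfolding convex_hull_finite[OF affine_frameD(1)[OF V]]
    using sum_bary[of 1 x] sum_bary_scaleR[of 1 x]
    by (intro CollectI exI[of _ "\<lambda>p. bary V p (1, x)"]) auto
qed

lemma convex_hull_subset_iff_bary:
  assumes "W \<subseteq> V"
  shows "x \<in> convex hull W \<longleftrightarrow> x \<in> convex hull V \<and> (\<forall>p\<in>V - W. bary V p (1, x) = 0)"
proof -
  note fin = affine_frameD(1)[OF V]
  have finW: "finite W" using assms fin finite_subset by blast
  show ?thesis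
  proof safe
    assume "x \<in> convex hull W"
    then obtain u where u: "\<forall>q\<in>W. 0 \<le> u q" "sum u W = 1" "(\<Sum>q\<in>W. u q *\<^sub>R q) = x"
      unfolding convex_hull_finite[OF finW] by blast
    show "x \<in> convex hull V" using \<open>x \<in> convex hull W\<close> hull_mono[OF assms] by blast
    fix p assume p: "p \<in> V" "p \<notin> W"
    let ?u = "\<lambda>q. if q \<in> W then u q else 0"
    have "(\<Sum>q\<in>V. ?u q) = 1"
      using u(2) sum.mono_neutral_right[OF fin assms, of ?u] by simp
    moreover have "(\<Sum>q\<in>V. ?u q *\<^sub>R q) = x"
      using u(3) sum.mono_neutral_right[OF fin assms, of "\<lambda>q. ?u q *\<^sub>R q"] by simp
    ultimately show "bary V p (1, x) = 0" using bary_unique[of ?u 1 x p] p by simp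
  next
    assume x: "x \<in> convex hull V" "\<forall>p\<in>V - W. bary V p (1, x) = 0"
    have "(\<Sum>q\<in>W. bary V q (1, x)) = 1"
      using x(2) sum_bary[of 1 x] sum.mono_neutral_right[OF fin assms, of "\<lambda>q. bary V q (1, x)"] by simp
    moreover have "(\<Sum>q\<in>W. bary V q (1, x) *\<^sub>R q) = x"
      using x(2) sum_bary_scaleR[of 1 x]
        sum.mono_neutral_right[OF fin assms, of "\<lambda>q. bary V q (1, x) *\<^sub>R q"] by simp
    ultimately show "x \<in> convex hull W"
      unfolding convex_hull_finite[OF finW]
      using x(1) assms unfolding convex_hull_iff_bary
      by (intro CollectI exI[of _ "\<lambda>p. bary V p (1, x)"]) auto
  qed
qed

lemma continuous_bary: "continuous_on S (\<lambda>x. bary V p (s, x))"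
  by (intro continuous_on_compose2[OF linear_continuous_on[of "bary V p" UNIV]] continuous_intros)
     (simp_all add: linear_bary linear_linear)

lemma has_derivative_bary: "((\<lambda>x. bary V p (1, x)) has_derivative (\<lambda>w. bary V p (0, w))) (at x)"
proof -
  have "((\<lambda>x. bary V p (1, x)) has_derivative (\<lambda>w. bary V p ((\<lambda>w. (0, w)) w))) (at x)"
    by (rule bounded_linear.has_derivative[where f = "bary V p"])
       (auto simp: linear_bary linear_linear intro!: derivative_eq_intros)
  thus ?thesis by simp
qed

end

section \<open>Determinants of homogenised points and vectors\<close>

definition hdet :: "(nat \<Rightarrow> real \<times> (real ^ 'n)) \<Rightarrow> real" where
  "hdet q = fdet (Suc CARD('n)) (\<lambda>i j. if i = 0 then fst (q j) else snd (q j) $ idx (i - 1))"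

definition hvec :: "real ^ 'n \<Rightarrow> (nat \<Rightarrow> real ^ 'n) \<Rightarrow> nat \<Rightarrow> real \<times> (real ^ 'n)" where
  "hvec x v j = (if j = 0 then (1, x) else (0, v (j - 1)))"

lemma hvec_simps [simp]: "hvec x v 0 = (1, x)" "hvec x v (Suc j) = (0, v j)"
  by (simp_all add: hvec_def)

text \<open>The standard basis of the homogenised space: \<open>(1, 0)\<close> followed by the
  coordinate directions at height 0.\<close>

definition hframe :: "nat \<Rightarrow> real \<times> (real ^ 'n)" where
  "hframe = hvec 0 (\<lambda>r. axis (idx r) 1)"

text \<open>Expanding each \<open>q j\<close> in the standard basis factors the matrix. Thus
  \<open>n + 1\<close> functionals see the arguments only through \<open>hdet q\<close>, and the
  other factor is a constant of the functionals.\<close>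

lemma fdet_linear_functionals:
  fixes f :: "nat \<Rightarrow> real \<times> (real ^ 'n) \<Rightarrow> real"
  assumes f: "\<And>i. i \<le> CARD('n) \<Longrightarrow> linear (f i)"
  shows "fdet (Suc CARD('n)) (\<lambda>i j. f i (q j)) = fdet (Suc CARD('n)) (\<lambda>i j. f i (hframe j)) * hdet q"
proof -
  have "f i (q j) = (\<Sum>r<Suc CARD('n). f i (hframe r) *
      (if r = 0 then fst (q j) else snd (q j) $ idx (r - 1)))" if i: "i < Suc CARD('n)" for i j
  proof -
    have lin: "linear (f i)" using f i by simp
    have "snd (q j) = (\<Sum>k\<in>UNIV. snd (q j) $ k *\<^sub>R axis k 1)"
      by (simp add: basis_expansion scalar_mult_eq_scaleR[symmetric])
    also have "\<dots> = (\<Sum>r<CARD('n). snd (q j) $ idx r *\<^sub>R axis (idx r) 1)"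
      by (rule sum_idx[symmetric])
    finally have qj: "q j = fst (q j) *\<^sub>R hframe 0 + (\<Sum>r<CARD('n). snd (q j) $ idx r *\<^sub>R hframe (Suc r))"
      by (simp add: hframe_def prod_eq_iff fst_sum snd_sum)
    have "f i (q j) = fst (q j) * f i (hframe 0) + (\<Sum>r<CARD('n). snd (q j) $ idx r * f i (hframe (Suc r)))"
      using arg_cong[OF qj, of "f i"]
      by (simp only: linear_add[OF lin] linear_sum[OF lin] linear_scale[OF lin] real_scaleR_def)
    thus ?thesis by (subst sum.lessThan_Suc_shift) (simp add: mult.commute)
  qed
  hence "fdet (Suc CARD('n)) (\<lambda>i j. f i (q j)) = fdet (Suc CARD('n)) (\<lambda>i j. \<Sum>r<Suc CARD('n).
      f i (hframe r) * (if r = 0 then fst (q j) else snd (q j) $ idx (r - 1)))"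
    by (intro fdet_cong) blast
  thus ?thesis unfolding hdet_def by (simp only: fdet_mult)
qed

text \<open>The row of heights is \<open>(1, 0, ..., 0)\<close>, so the point \<open>x\<close> drops
  out. This is why Whitney forms of top degree have constant coefficients on a cell.\<close>

lemma hdet_hvec: "hdet (hvec x v) = vdet v"
proof -
  have "hdet (hvec x v) = fdet (Suc CARD('a)) (\<lambda>i j. if j = 0 then fst (hvec x v i) else snd (hvec x v i) $ idx (j - 1))"
    unfolding hdet_def
    by (rule fdet_transpose[of _ "\<lambda>i j. if j = 0 then fst (hvec x v i) else snd (hvec x v i) $ idx (j - 1)"])
  also have "\<dots> = (\<Sum>i\<le>CARD('a). if i = 0 then fdet CARD('a) (\<lambda>r j. v r $ idx j) else 0)"
    unfolding fdet_laplace_column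
  proof (intro sum.cong refl)
    fix i
    show "(- 1) ^ i * (if (0::nat) = 0 then fst (hvec x v i) else snd (hvec x v i) $ idx (0 - 1)) *
        fdet CARD('a) (\<lambda>r j. if Suc j = 0 then fst (hvec x v (skip i r))
          else snd (hvec x v (skip i r)) $ idx (Suc j - 1)) =
      (if i = 0 then fdet CARD('a) (\<lambda>r j. v r $ idx j) else 0)"
      by (cases "i = 0") (simp_all add: skip_def hvec_def)
  qed
  also have "\<dots> = vdet v"
    unfolding vdet_def using fdet_transpose[of "CARD('a)" "\<lambda>i j. v j $ idx i"] by simp
  finally show ?thesis .
qed

lemma hdet_points: "hdet (\<lambda>j. (1, q j)) = vdet (\<lambda>j. q (Suc j) - q 0)"
proof -
  let ?A = "\<lambda>i j. if i = 0 then 1 else q j $ idx (i - 1)"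
  have "hdet (\<lambda>j. (1, q j)) = fdet (Suc CARD('a)) ?A"
    unfolding hdet_def by (intro fdet_cong) auto
  also have "\<dots> = fdet (Suc CARD('a)) (\<lambda>i j. if j = 0 then \<Sum>k\<le>CARD('a). of_bool (k = 0) * ?A i k else ?A i j - ?A i 0)"
    by (rule fdet_affine_columns[symmetric]) simp
  also have "\<dots> = hdet (hvec (q 0) (\<lambda>j. q (Suc j) - q 0))"
    unfolding hdet_def by (intro fdet_cong) (auto simp: hvec_def)
  finally show ?thesis by (simp add: hdet_hvec)
qed

section \<open>Whitney forms on a cell and unisolvence\<close>

lemma affine_independent_unique_coefficients:
  fixes V :: "'a::euclidean_space set"
  assumes "\<not> affine_dependent V" "sum c V = sum d V" "(\<Sum>v\<in>V. c v *\<^sub>R v) = (\<Sum>v\<in>V. d v *\<^sub>R v)" "p \<in> V"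
  shows "c p = (d p :: real)"
proof -
  have fin: "finite V" using aff_independent_finite[OF assms(1)] .
  have "(\<Sum>v\<in>V. c v - d v) = 0" "(\<Sum>v\<in>V. (c v - d v) *\<^sub>R v) = 0"
    using assms(2,3) by (simp_all add: sum_subtractf scaleR_diff_left)
  hence "\<forall>v\<in>V. c v - d v = 0"
    using assms(1) unfolding affine_dependent_explicit_finite[OF fin] by fast
  thus ?thesis using assms(4) by simp
qed

text \<open>A relation for simplices of every dimension, which the hat functions require;
  \<open>bary\<close> is available for cells only.\<close>

definition convex_coords :: "'a::real_vector set \<Rightarrow> ('a \<Rightarrow> real) \<Rightarrow> 'a \<Rightarrow> bool" where
  "convex_coords V c x \<longleftrightarrow> (\<forall>v\<in>V. 0 \<le> c v) \<and> sum c V = 1 \<and> (\<Sum>v\<in>V. c v *\<^sub>R v) = x"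

lemma convex_coords_exists: "finite V \<Longrightarrow> x \<in> convex hull V \<longleftrightarrow> (\<exists>c. convex_coords V c x)"
  unfolding convex_hull_finite convex_coords_def by blast

lemma convex_coords_combine:
  assumes "convex_coords V c x" "convex_coords V d y" "t \<in> {0..1}"
  shows "convex_coords V (\<lambda>v. (1 - t) * c v + t * d v) ((1 - t) *\<^sub>R x + t *\<^sub>R y)"
  using assms unfolding convex_coords_def
  by (auto simp: sum.distrib scaleR_add_left scaleR_sum_right simp flip: sum_distrib_left)

text \<open>Such a function is convex and concave, and Jensen's inequality holds in both
  directions.\<close>

lemma affine_on_segments_sum:
  fixes f :: "'a::real_vector \<Rightarrow> real"
  assumes f: "\<forall>x\<in>S. \<forall>y\<in>S. \<forall>t\<in>{0..1}. f ((1 - t) *\<^sub>R x + t *\<^sub>R y) = (1 - t) * f x + t * f y"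
    and S: "convex S" "V \<subseteq> S" "finite V" "convex_coords V c x"
  shows "f x = (\<Sum>v\<in>V. c v * f v)"
proof -
  have ne: "V \<noteq> {}" using S(4) by (auto simp: convex_coords_def)
  have f': "f (u *\<^sub>R x + v *\<^sub>R y) = u * f x + v * f y"
    if "x \<in> S" "y \<in> S" "0 \<le> u" "0 \<le> v" "u + v = 1" for x y u v
    using f[rule_format, of x y v] that by (simp add: eq_diff_eq[symmetric])
  have "convex_on S f" "convex_on S (\<lambda>x. - f x)"
    using S(1) by (auto simp: convex_on_def f')
  hence "f (\<Sum>v\<in>V. c v *\<^sub>R v) \<le> (\<Sum>v\<in>V. c v * f v)"
    "- f (\<Sum>v\<in>V. c v *\<^sub>R v) \<le> (\<Sum>v\<in>V. c v * (- f v))"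
    using S ne by (intro convex_on_sum[of V S]; auto simp: convex_coords_def)+
  thus ?thesis using S(4) by (auto simp: convex_coords_def sum_negf)
qed

lemma interior_frame_nonempty: "affine_frame V \<Longrightarrow> interior (convex hull V :: (real ^ 'n) set) \<noteq> {}"
proof -
  assume V: "affine_frame V"
  have "aff_dim (convex hull V) = int DIM(real ^ 'n)"
    using affine_frameD[OF V] affine_independent_iff_card[of V] by (simp add: aff_dim_convex_hull)
  moreover have "convex hull V \<noteq> {}" using affine_frameD[OF V] by auto
  ultimately show ?thesis
    by (simp add: interior_rel_interior_gen rel_interior_eq_empty)
qed

section \<open>Hat functions of a simplicial complex\<close>

context
  fixes X :: "(real ^ 'n) set set"
  assumes X: "simplicial_complex X"
begin

lemma complex_finite: "finite X"
  and complex_simplex: "S \<in> X \<Longrightarrow> \<exists>n. n simplex S"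
  and complex_face: "S \<in> X \<Longrightarrow> F face_of S \<Longrightarrow> F \<in> X"
  and complex_Int: "S \<in> X \<Longrightarrow> S' \<in> X \<Longrightarrow> (S \<inter> S') face_of S"
  using X by (auto simp: simplicial_complex_def)

lemma complex_hull: "S \<in> X \<Longrightarrow> \<exists>V. \<not> affine_dependent V \<and> S = convex hull V"
  using complex_simplex[of S] by (auto simp: simplex_def)

lemma complex_subface:
  "\<not> affine_dependent V \<Longrightarrow> convex hull V \<in> X \<Longrightarrow> W \<subseteq> V \<Longrightarrow> convex hull W \<in> X"
  using complex_face face_of_convex_hull_affine_independent by metis

text \<open>The intersection of the two simplices is a face of both, hence the hull of a set of
  vertices of each. These sets coincide, being the extreme points of the intersection. By uniqueness
  both coordinate systems are the one of the common face, extended by zero. This makes the hat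
  functions well defined.\<close>

lemma convex_coords_consistent:
  assumes V: "\<not> affine_dependent V" "convex hull V \<in> X" "convex_coords V c x"
    and V': "\<not> affine_dependent V'" "convex hull V' \<in> X" "convex_coords V' c' x"
  shows "(if p \<in> V then c p else 0) = (if p \<in> V' then c' p else 0)"
proof -
  have fin: "finite V" "finite V'" using V V' aff_independent_finite by blast+
  let ?I = "convex hull V \<inter> convex hull V'"
  obtain K where K: "K \<subseteq> V" "?I = convex hull K"
    using complex_Int[OF V(2) V'(2)] face_of_convex_hull_affine_independent[OF V(1)] by metis
  obtain K' where K': "K' \<subseteq> V'" "?I = convex hull K'"
    using complex_Int[OF V'(2) V(2)] face_of_convex_hull_affine_independent[OF V'(1)]
    by (metis Int_commute)
  have "\<not> affine_dependent K" "\<not> affine_dependent K'"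
    using K K' V V' affine_independent_subset by blast+
  hence "K = K'"
    using K(2) K'(2) extreme_point_of_convex_hull_affine_independent
    by (metis subsetI subset_antisym)
  have "x \<in> convex hull V" "x \<in> convex hull V'"
    using V(3) V'(3) fin by (auto simp: convex_coords_exists)
  hence "x \<in> convex hull K" using K by blast
  moreover have finK: "finite K" using K fin finite_subset by blast
  ultimately obtain d where d: "convex_coords K d x"
    by (auto simp: convex_coords_exists)
  have key: "(if p \<in> W then e p else 0) = (if p \<in> K then d p else 0)"
    if W: "\<not> affine_dependent W" "convex_coords W e x" "K \<subseteq> W" for W e
  proof (cases "p \<in> W")
    case True
    let ?d = "\<lambda>q. if q \<in> K then d q else 0"
    have finW: "finite W" using W(1) aff_independent_finite by blast
    have "sum ?d W = sum d K" "(\<Sum>v\<in>W. ?d v *\<^sub>R v) = (\<Sum>v\<in>K. d v *\<^sub>R v)"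
      using sum.mono_neutral_right[OF finW W(3), of ?d]
        sum.mono_neutral_right[OF finW W(3), of "\<lambda>v. ?d v *\<^sub>R v"] by simp_all
    hence "sum e W = sum ?d W" "(\<Sum>v\<in>W. e v *\<^sub>R v) = (\<Sum>v\<in>W. ?d v *\<^sub>R v)"
      using W(2) d unfolding convex_coords_def by simp_all
    hence "e p = ?d p"
      using True by (rule affine_independent_unique_coefficients[OF W(1)])
    thus ?thesis using True by simp
  qed (use W in auto)
  show ?thesis using key[OF V(1,3) K(1)] key[OF V'(1,3)] K'(1) \<open>K = K'\<close> by simp
qed

text \<open>Consistency of the coordinates gives a function with the three defining properties;
  conversely, these determine the values at the vertices and then, by affinity, on every
  simplex.\<close>

lemma hat_convex_coords:
  assumes V: "\<not> affine_dependent V" "convex hull V \<in> X" "convex_coords V c x"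
  shows "hat X p x = (if p \<in> V then c p else 0)"
proof -
  define P where "P = (\<lambda>f :: real ^ 'n \<Rightarrow> real. (\<forall>q. {q} \<in> X \<longrightarrow> f q = (if q = p then 1 else 0)) \<and>
     (\<forall>S\<in>X. \<forall>x\<in>S. \<forall>y\<in>S. \<forall>t\<in>{0..1}.
        f ((1 - t) *\<^sub>R x + t *\<^sub>R y) = (1 - t) * f x + t * f y) \<and>
     (\<forall>x. x \<notin> \<Union>X \<longrightarrow> f x = 0))"
  define r where "r = (\<lambda>x y. \<exists>V c. \<not> affine_dependent V \<and> convex hull V \<in> X \<and> convex_coords V c x \<and>
    y = (if p \<in> V then c p else 0))"
  define f where "f x = (if x \<in> \<Union>X then SOME y. r x y else 0)" for x
  have fV: "f x = (if p \<in> V then c p else 0)"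
    if V: "\<not> affine_dependent V" "convex hull V \<in> X" "convex_coords V c x" for V c x
  proof -
    have "x \<in> \<Union>X" using V aff_independent_finite convex_coords_exists by blast
    moreover have "(SOME y. r x y) = (if p \<in> V then c p else 0)"
    proof (rule some_equality)
      show "r x (if p \<in> V then c p else 0)" using V unfolding r_def by blast
      fix y assume "r x y"
      thus "y = (if p \<in> V then c p else 0)"
        using convex_coords_consistent[OF _ _ _ V] unfolding r_def by blast
    qed
    ultimately show ?thesis by (simp add: f_def)
  qed
  have Pf: "P f"
    unfolding P_def
  proof (intro conjI allI impI ballI)
    fix q assume "{q} \<in> X"
    thus "f q = (if q = p then 1 else 0)"
      by (subst fV[of "{q}" "\<lambda>_. 1"]) (auto simp: convex_coords_def)
  next
    fix S x y and t :: real assume S: "S \<in> X" "x \<in> S" "y \<in> S" and t: "t \<in> {0..1}"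
    obtain V where V: "\<not> affine_dependent V" "S = convex hull V" using complex_hull[OF S(1)] by blast
    have VX: "convex hull V \<in> X" using S V by simp
    have fin: "finite V" using V(1) by (rule aff_independent_finite)
    obtain c d where cd: "convex_coords V c x" "convex_coords V d y"
      using S(2,3) unfolding V(2) convex_coords_exists[OF fin] by auto
    show "f ((1 - t) *\<^sub>R x + t *\<^sub>R y) = (1 - t) * f x + t * f y"
      using fV[OF V(1) VX cd(1)] fV[OF V(1) VX cd(2)] fV[OF V(1) VX convex_coords_combine[OF cd t]]
      by simp
  qed (simp add: f_def)
  have gV: "g x = (if p \<in> V then c p else 0)"
    if g: "P g" and V: "\<not> affine_dependent V" "convex hull V \<in> X" "convex_coords V c x" for g V c x
  proof -
    have fin: "finite V" using V aff_independent_finite by blast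
    have vert: "g v = (if v = p then 1 else 0)" if "v \<in> V" for v
      using complex_subface[OF V(1,2), of "{v}"] that g by (simp add: P_def)
    have "g x = (\<Sum>v\<in>V. c v * g v)"
      using g V fin hull_subset[of V convex]
      by (intro affine_on_segments_sum[of "convex hull V"]) (auto simp: P_def)
    also have "\<dots> = (\<Sum>v\<in>V. if v = p then c v else 0)"
      by (intro sum.cong) (auto simp: vert)
    finally show ?thesis using fin by simp
  qed
  have unique: "g = f" if g: "P g" for g
  proof
    fix x
    show "g x = f x"
    proof (cases "x \<in> \<Union>X")
      case True
      then obtain S where S: "S \<in> X" "x \<in> S" by blast
      obtain V where V: "\<not> affine_dependent V" "S = convex hull V" using complex_hull[OF S(1)] by blast
      have fin: "finite V" using V(1) by (rule aff_independent_finite)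
      obtain c where "convex_coords V c x"
        using S(2) unfolding V(2) convex_coords_exists[OF fin] by auto
      with V S have "\<not> affine_dependent V" "convex hull V \<in> X" "convex_coords V c x" by simp_all
      thus ?thesis using gV[OF g] fV by metis
    next
      case False
      thus ?thesis using g Pf by (simp add: P_def)
    qed
  qed
  have "hat X p = (THE f. P f)" by (simp add: hat_def P_def)
  also have "\<dots> = f" using Pf unique by blast
  finally show ?thesis using fV[OF V] by simp
qed

lemma cell_frame:
  assumes "T \<in> cells X"
  obtains V where "affine_frame V" "T = convex hull V" "convex hull V \<in> X"
proof -
  obtain V where V: "\<not> affine_dependent V" "int (card V) = int CARD('n) + 1" "T = convex hull V"
    using assms by (auto simp: cells_def simplex_def)
  have "affine_frame V" using V unfolding affine_frame_def by linarith
  thus thesis using that V assms by (simp add: cells_def)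
qed

text \<open>A vertex of the complex that lies in a cell meets it in a face, so it is an extreme
  point. Hence a simplex of the complex inside a cell is spanned by vertices of that cell.\<close>

lemma cell_vertex:
  assumes V: "affine_frame V" "convex hull V \<in> X" and q: "{q} \<in> X" "q \<in> convex hull V"
  shows "q \<in> V"
proof -
  have "convex hull V \<inter> {q} = {q}" using q by auto
  hence "{q} face_of (convex hull V)" using complex_Int[OF V(2) q(1)] by simp
  thus ?thesis
    using extreme_point_of_convex_hull_affine_independent[OF affine_frameD(2)[OF V(1)]]
    by (simp add: face_of_singleton)
qed

lemma oriented_vertex:
  assumes "\<sigma> \<in> oriented_simplices X k" "q \<in> set \<sigma>"
  shows "{q} \<in> X"
  using assms complex_subface[of "set \<sigma>" "{q}"] by (auto simp: oriented_simplices_def)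

lemma oriented_vertices_subset:
  assumes "affine_frame V" "convex hull V \<in> X" "\<sigma> \<in> oriented_simplices X k" "set \<sigma> \<subseteq> convex hull V"
  shows "set \<sigma> \<subseteq> V"
  using assms cell_vertex oriented_vertex by blast

lemma finite_oriented_simplices: "finite (oriented_simplices X k)"
proof (rule finite_subset)
  let ?V = "{q. {q} \<in> X}"
  have "finite ?V"
    using inj_on_finite[of "\<lambda>q. {q}" ?V X] complex_finite by auto
  thus "finite {xs. set xs \<subseteq> ?V \<and> length xs = Suc k}" by (rule finite_lists_length_eq)
  show "oriented_simplices X k \<subseteq> {xs. set xs \<subseteq> ?V \<and> length xs = Suc k}"
    using oriented_vertex by (auto simp: oriented_simplices_def)
qed

lemma hat_on_cell:
  assumes V: "affine_frame V" "convex hull V \<in> X" and x: "x \<in> convex hull V"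
  shows "hat X p x = bary V p (1, x)"
proof -
  have "convex_coords V (\<lambda>p. bary V p (1, x)) x"
    using x sum_bary[OF V(1), of 1 x] sum_bary_scaleR[OF V(1), of 1 x]
    unfolding convex_hull_iff_bary[OF V(1)] convex_coords_def by blast
  from hat_convex_coords[OF affine_frameD(2)[OF V(1)] V(2) this] show ?thesis
    by (simp add: bary_not_in[OF V(1)])
qed

lemma hat_derivative_on_cell:
  assumes V: "affine_frame V" "convex hull V \<in> X" and x: "x \<in> interior (convex hull V)"
  shows "frechet_derivative (hat X p) (at x) = (\<lambda>w. bary V p (0, w))"
proof -
  have "(hat X p has_derivative (\<lambda>w. bary V p (0, w))) (at x)"
    by (rule has_derivative_transform_within_open[OF has_derivative_bary[OF V(1)] open_interior x])
       (metis V hat_on_cell interior_subset subsetD)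
  thus ?thesis by (rule frechet_derivative_at[symmetric])
qed

end

section \<open>Whitney forms on a cell and their integrals over simplices\<close>

lemma omit_nth: "i < length xs \<Longrightarrow> r < length xs - 1 \<Longrightarrow> omit i xs ! r = xs ! skip i r"
  by (auto simp: omit_def skip_def nth_append min_def)

lemma length_omit: "i < length xs \<Longrightarrow> length (omit i xs) = length xs - 1"
  by (simp add: omit_def)

lemma wedge_eq_fdet: "wedge \<alpha>s v = fdet (length \<alpha>s) (\<lambda>i j. (\<alpha>s ! i) (v j))"
  by (simp add: wedge_def fdet_permutes)

text \<open>Defined on the whole space, and thus also the continuous extension of the Whitney form
  from the interior of the cell to its faces.\<close>

definition cell_whitney :: "(real ^ 'n) set \<Rightarrow> (real ^ 'n) list \<Rightarrow> 'n form" where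
  "cell_whitney V \<sigma> x v =
     fact (length \<sigma> - 1) * fdet (length \<sigma>) (\<lambda>i j. bary V (\<sigma> ! i) (hvec x v j))"

text \<open>The defining sum is the Laplace expansion along the column of the point: the hat
  functions are its entries and the wedge products its minors.\<close>

lemma whitney_form_on_cell:
  assumes X: "simplicial_complex X" and V: "affine_frame V" "convex hull V \<in> X"
    and x: "x \<in> interior (convex hull V)" and \<sigma>: "length \<sigma> = Suc k"
  shows "whitney_form X \<sigma> x v = cell_whitney V \<sigma> x v"
proof -
  have "x \<in> cell_interiors X"
    using V x simplex_convex_hull[of V "int CARD('a)"]
    by (auto simp: cell_interiors_def cells_def affine_frame_def)
  moreover have "x \<in> convex hull V" using x interior_subset by blast
  moreover have "(\<Sum>i<length \<sigma>. (- 1) ^ i * bary V (\<sigma> ! i) (1, x) *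
      wedge (map (\<lambda>p w. bary V p (0, w)) (omit i \<sigma>)) v) =
    fdet (length \<sigma>) (\<lambda>i j. bary V (\<sigma> ! i) (hvec x v j))"
    unfolding \<sigma> fdet_laplace_column lessThan_Suc_atMost
  proof (intro sum.cong refl)
    fix i assume "i \<in> {..k}"
    hence i: "i < length \<sigma>" using \<sigma> by simp
    have "wedge (map (\<lambda>p w. bary V p (0, w)) (omit i \<sigma>)) v =
        fdet k (\<lambda>r j. bary V (\<sigma> ! skip i r) (hvec x v (Suc j)))"
      using i \<sigma> unfolding wedge_eq_fdet
      by (auto simp: length_omit omit_nth intro!: fdet_cong)
    thus "(- 1) ^ i * bary V (\<sigma> ! i) (1, x) * wedge (map (\<lambda>p w. bary V p (0, w)) (omit i \<sigma>)) v =
        (- 1) ^ i * bary V (\<sigma> ! i) (hvec x v 0) * fdet k (\<lambda>r j. bary V (\<sigma> ! skip i r) (hvec x v (Suc j)))"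
      by simp
  qed
  ultimately show ?thesis
    unfolding whitney_form_def cell_whitney_def
    by (simp add: hat_on_cell[OF X V] hat_derivative_on_cell[OF X V x])
qed

lemma continuous_cell_whitney:
  assumes "affine_frame V"
  shows "continuous_on S (\<lambda>x. cell_whitney V \<sigma> x v)"
proof -
  have "continuous_on S (\<lambda>x. bary V p (hvec x v j))" for p j
    by (cases j) (simp_all add: continuous_bary[OF assms])
  thus ?thesis unfolding cell_whitney_def fdet_permutes by (intro continuous_intros)
qed

text \<open>A cell is the closure of its open nonempty interior, so the \<open>Lim\<close> is taken
  along a nontrivial filter and agrees with the value of the continuous function.\<close>

lemma cell_extension_eq:
  fixes F :: "real ^ 'n \<Rightarrow> real"
  assumes V: "affine_frame V" and u: "\<And>y. y \<in> interior (convex hull V) \<Longrightarrow> u y v = F y"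
    and F: "continuous_on UNIV F" and x: "x \<in> convex hull V"
  shows "cell_extension (convex hull V) u x v = F x"
proof -
  let ?I = "interior (convex hull V)"
  have "closure ?I = closure (convex hull V)"
    using interior_frame_nonempty[OF V] by (intro convex_closure_interior) auto
  hence "x \<in> closure ?I" using x closure_subset by blast
  hence "x islimpt ?I"
    by (metis closure_def interior_limit_point open_interior interior_open UnE mem_Collect_eq)
  hence nontriv: "\<not> trivial_limit (at x within ?I)" by (simp add: trivial_limit_within)
  have "(F \<longlongrightarrow> F x) (at x)"
    using F by (simp add: continuous_on_eq_continuous_at isCont_def)
  hence "(F \<longlongrightarrow> F x) (at x within ?I)"
    by (rule tendsto_within_subset) simp
  moreover have "\<forall>\<^sub>F y in at x within ?I. F y = u y v"
    unfolding eventually_at_topological using u by (intro exI[of _ UNIV]) auto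
  ultimately have "((\<lambda>y. u y v) \<longlongrightarrow> F x) (at x within ?I)"
    by (rule Lim_transform_eventually)
  thus ?thesis unfolding cell_extension_def using tendsto_Lim[OF nontriv] by blast
qed

text \<open>\<open>incidence \<rho> \<sigma>\<close> is the integral over \<open>\<sigma>\<close> of the Whitney form of \<open>\<rho>\<close>: the sign of the permutation
  taking \<open>\<rho>\<close> to \<open>\<sigma>\<close>, or \<open>0\<close> if the vertex sets differ.\<close>
definition incidence :: "'a list \<Rightarrow> 'a list \<Rightarrow> real" where
  "incidence \<rho> \<sigma> = fdet (length \<sigma>) (\<lambda>i j. of_bool (\<rho> ! i = \<sigma> ! j))"

lemma incidence_refl: "distinct \<sigma> \<Longrightarrow> incidence \<sigma> \<sigma> = 1"
  unfolding incidence_def by (subst fdet_upper_triangular) (auto simp: nth_eq_iff_index_eq)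

lemma incidence_eq_0:
  assumes "length \<rho> = length \<sigma>" "distinct \<rho>" "distinct \<sigma>" "set \<rho> \<noteq> set \<sigma>"
  shows "incidence \<rho> \<sigma> = 0"
proof -
  have "card (set \<rho>) = card (set \<sigma>)" using assms by (simp add: distinct_card)
  hence "\<not> set \<rho> \<subseteq> set \<sigma>" using assms(4) by (meson card_subset_eq finite_set)
  then obtain i where "i < length \<rho>" "\<rho> ! i \<notin> set \<sigma>" by (metis in_set_conv_nth subsetI)
  thus ?thesis unfolding incidence_def using assms(1) by (intro fdet_zero_row[of i]) auto
qed

lemma sum_nth_delta:
  fixes f :: "'a \<Rightarrow> real"
  assumes "distinct \<sigma>" "p \<in> set \<sigma>"
  shows "(\<Sum>k<length \<sigma>. of_bool (p = \<sigma> ! k) * f (\<sigma> ! k)) = f p"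
proof -
  have "(\<Sum>k<length \<sigma>. of_bool (p = \<sigma> ! k) * f (\<sigma> ! k)) = (\<Sum>q\<in>set \<sigma>. of_bool (p = q) * f q)"
    by (rule sum.reindex_bij_betw[OF bij_betw_nth]) (use assms in auto)
  also have "\<dots> = (\<Sum>q\<in>set \<sigma>. if q = p then f q else 0)"
    by (intro sum.cong) auto
  finally show ?thesis using assms(2) by simp
qed

lemma cell_whitney_reorder:
  assumes "length \<rho> = length \<sigma>" "distinct \<sigma>" "set \<rho> = set \<sigma>"
  shows "cell_whitney V \<rho> x v = incidence \<rho> \<sigma> * cell_whitney V \<sigma> x v"
proof -
  have "fdet (length \<sigma>) (\<lambda>i j. bary V (\<rho> ! i) (hvec x v j)) =
      fdet (length \<sigma>) (\<lambda>i j. \<Sum>k<length \<sigma>. of_bool (\<rho> ! i = \<sigma> ! k) * bary V (\<sigma> ! k) (hvec x v j))"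
  proof (rule fdet_cong)
    fix i j assume "i < length \<sigma>"
    hence "\<rho> ! i \<in> set \<sigma>" using assms by (metis nth_mem)
    from sum_nth_delta[OF assms(2) this, of "\<lambda>q. bary V q (hvec x v j)"]
    show "bary V (\<rho> ! i) (hvec x v j) =
        (\<Sum>k<length \<sigma>. of_bool (\<rho> ! i = \<sigma> ! k) * bary V (\<sigma> ! k) (hvec x v j))" by simp
  qed
  also have "\<dots> = incidence \<rho> \<sigma> * fdet (length \<sigma>) (\<lambda>i j. bary V (\<sigma> ! i) (hvec x v j))"
    unfolding incidence_def by (rule fdet_mult)
  finally show ?thesis unfolding cell_whitney_def using assms(1) by simp
qed

text \<open>At a point of the affine hull of \<sigma> the column of the point is an affine
  combination of the columns of the vertices, and the tangent columns are their differences. Undoing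
  these column operations leaves the incidence matrix, so the value does not depend on the
  point.\<close>

lemma cell_whitney_on_simplex:
  assumes V: "affine_frame V" and \<sigma>: "set \<sigma> \<subseteq> V" "length \<sigma> = Suc k" and \<rho>: "length \<rho> = Suc k"
  shows "cell_whitney V \<rho> (\<sigma> ! 0 + (\<Sum>i<k. t i *\<^sub>R (\<sigma> ! Suc i - \<sigma> ! 0))) (\<lambda>i. \<sigma> ! Suc i - \<sigma> ! 0) =
    fact k * incidence \<rho> \<sigma>"
proof -
  let ?x = "\<sigma> ! 0 + (\<Sum>i<k. t i *\<^sub>R (\<sigma> ! Suc i - \<sigma> ! 0))" and ?e = "\<lambda>i. \<sigma> ! Suc i - \<sigma> ! 0"
  \<comment> \<open>The barycentric coordinates within \<sigma> of the point with parameters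
    \<open>t\<close>; index 0 takes the remainder.\<close>
  define s where "s j = (if j = 0 then 1 - (\<Sum>i<k. t i) else t (j - 1))" for j
  have sum_s: "(\<Sum>j\<le>k. s j * f j) = f 0 + (\<Sum>i<k. t i * (f (Suc i) - f 0))" for f :: "nat \<Rightarrow> real"
    unfolding lessThan_Suc_atMost[symmetric] sum.lessThan_Suc_shift
    by (simp add: s_def right_diff_distrib sum_subtractf left_diff_distrib flip: sum_distrib_right)
  have "fdet (Suc k) (\<lambda>i j. bary V (\<rho> ! i) (hvec ?x ?e j)) =
      fdet (Suc k) (\<lambda>i j. if j = 0 then \<Sum>l\<le>k. s l * of_bool (\<rho> ! i = \<sigma> ! l)
        else of_bool (\<rho> ! i = \<sigma> ! j) - of_bool (\<rho> ! i = \<sigma> ! 0))"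
  proof (rule fdet_cong)
    fix i j assume j: "j < Suc k"
    let ?b = "bary V (\<rho> ! i)"
    have lin: "linear ?b" by (rule linear_bary[OF V])
    have vert: "?b (1, \<sigma> ! l) = of_bool (\<rho> ! i = \<sigma> ! l)" if "l \<le> k" for l
      using bary_vertex[OF V, of "\<sigma> ! l"] that \<sigma> by (metis less_Suc_eq_le nth_mem subsetD)
    have dir: "?b (0, ?e l) = of_bool (\<rho> ! i = \<sigma> ! Suc l) - of_bool (\<rho> ! i = \<sigma> ! 0)" if "l < k" for l
      using bary_diff[OF V, of "\<rho> ! i" 1 "\<sigma> ! Suc l" 1 "\<sigma> ! 0"] vert[of "Suc l"] vert[of 0] that by simp
    have "(1, ?x) = (1, \<sigma> ! 0) + (\<Sum>l<k. t l *\<^sub>R (0 :: real, ?e l))"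
      by (simp add: prod_eq_iff fst_sum snd_sum)
    hence "?b (1, ?x) = ?b (1, \<sigma> ! 0) + (\<Sum>l<k. t l * ?b (0, ?e l))"
      by (simp only: linear_add[OF lin] linear_sum[OF lin] linear_scale[OF lin] real_scaleR_def)
    also have "\<dots> = (\<Sum>l\<le>k. s l * of_bool (\<rho> ! i = \<sigma> ! l))"
      unfolding sum_s using vert[of 0] dir by simp
    finally show "?b (hvec ?x ?e j) = (if j = 0 then \<Sum>l\<le>k. s l * of_bool (\<rho> ! i = \<sigma> ! l)
        else of_bool (\<rho> ! i = \<sigma> ! j) - of_bool (\<rho> ! i = \<sigma> ! 0))"
      using j dir by (cases j) auto
  qed
  also have "\<dots> = incidence \<rho> \<sigma>"
    unfolding incidence_def \<sigma>(2) using sum_s[of "\<lambda>_. 1"] by (intro fdet_affine_columns) simp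
  finally show ?thesis unfolding cell_whitney_def by (simp add: \<rho>)
qed

text \<open>The integrand is constant on the simplex and involves incidences only, so the arbitrary
  choice of a cell in \<open>simplex_integral\<close> does not affect the result.\<close>

lemma simplex_integral_whitney:
  fixes X :: "(real ^ 'n) set set"
  assumes X: "simplicial_complex X" and \<sigma>: "\<sigma> \<in> oriented_simplices X k"
    and T: "\<exists>T\<in>cells X. set \<sigma> \<subseteq> T"
  shows "simplex_integral X (\<lambda>x v. \<Sum>\<rho>\<in>oriented_simplices X k. c \<rho> * whitney_form X \<rho> x v) \<sigma> =
    (\<Sum>\<rho>\<in>oriented_simplices X k. c \<rho> * incidence \<rho> \<sigma>)"
proof -
  let ?O = "oriented_simplices X k"
  let ?w = "\<lambda>x v. \<Sum>\<rho>\<in>?O. c \<rho> * whitney_form X \<rho> x v"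
  let ?e = "\<lambda>i. \<sigma> ! Suc i - \<sigma> ! 0"
  define T where "T = (SOME T. T \<in> cells X \<and> set \<sigma> \<subseteq> T)"
  have T': "T \<in> cells X" "set \<sigma> \<subseteq> T"
    using someI_ex[of "\<lambda>T. T \<in> cells X \<and> set \<sigma> \<subseteq> T"] T unfolding T_def by auto
  obtain V where V: "affine_frame V" "T = convex hull V" "convex hull V \<in> X"
    using cell_frame[OF X T'(1)] .
  have \<sigma>V: "set \<sigma> \<subseteq> V" using oriented_vertices_subset[OF X V(1,3) \<sigma>] T' V by simp
  have len: "length \<rho> = Suc k" if "\<rho> \<in> ?O" for \<rho> using that by (simp add: oriented_simplices_def)
  have "affine_integral k (std_simplex_pow k) (\<sigma> ! 0) ?e (cell_extension T ?w) =
    (\<Sum>\<rho>\<in>?O. c \<rho> * (fact k * incidence \<rho> \<sigma>)) / fact k"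
  proof (rule affine_integral_const_form)
    fix t assume t: "t \<in> std_simplex_pow k"
    let ?x = "\<sigma> ! 0 + (\<Sum>i<k. t i *\<^sub>R ?e i)"
    have "?x \<in> convex hull V"
    proof -
      define s where "s j = (if j = 0 then 1 - (\<Sum>i<k. t i) else t (j - 1))" for j
      have "?x = (\<Sum>j\<in>{..<Suc k}. s j *\<^sub>R \<sigma> ! j)"
        unfolding sum.lessThan_Suc_shift
        by (simp add: s_def scaleR_diff_right sum_subtractf scaleR_diff_left flip: scaleR_sum_left)
      also have "\<dots> \<in> convex hull V"
      proof (rule convex_sum)
        show "sum s {..<Suc k} = 1" unfolding sum.lessThan_Suc_shift by (simp add: s_def)
        show "0 \<le> s j" if "j \<in> {..<Suc k}" for j
          using t that by (auto simp: s_def std_simplex_pow_def orthant_def)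
        show "\<sigma> ! j \<in> convex hull V" if "j \<in> {..<Suc k}" for j
          using that T'(2) V(2) len[OF \<sigma>] by (metis lessThan_iff nth_mem subsetD)
      qed auto
      finally show ?thesis .
    qed
    have "cell_extension T ?w ?x ?e = (\<Sum>\<rho>\<in>?O. c \<rho> * cell_whitney V \<rho> ?x ?e)"
      unfolding V(2)
      by (rule cell_extension_eq[OF V(1) _ _ \<open>?x \<in> convex hull V\<close>])
         (auto simp: whitney_form_on_cell[OF X V(1,3) _ len] intro!: continuous_intros continuous_cell_whitney V)
    also have "\<dots> = (\<Sum>\<rho>\<in>?O. c \<rho> * (fact k * incidence \<rho> \<sigma>))"
      using cell_whitney_on_simplex[OF V(1) \<sigma>V len[OF \<sigma>] len] by (intro sum.cong) auto
    finally show "cell_extension T ?w ?x ?e = (\<Sum>\<rho>\<in>?O. c \<rho> * (fact k * incidence \<rho> \<sigma>))" .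
  qed
  also have "\<dots> = (\<Sum>\<rho>\<in>?O. c \<rho> * incidence \<rho> \<sigma>)"
    by (simp add: sum_divide_distrib mult.left_commute)
  finally show ?thesis
    using len[OF \<sigma>] by (simp add: simplex_integral_def T_def Let_def)
qed

section \<open>Unisolvence and the definition of the operator\<close>

lemma whitney_form_reorder:
  fixes X :: "(real ^ 'n) set set"
  assumes X: "simplicial_complex X" and "\<rho> \<in> oriented_simplices X k" "\<sigma> \<in> oriented_simplices X k"
    "set \<rho> = set \<sigma>"
  shows "whitney_form X \<rho> x v = incidence \<rho> \<sigma> * whitney_form X \<sigma> x v"
proof (cases "x \<in> cell_interiors X")
  case True
  then obtain T where T: "T \<in> cells X" "x \<in> interior T" by (auto simp: cell_interiors_def)
  obtain V where V: "affine_frame V" "T = convex hull V" "convex hull V \<in> X"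
    using cell_frame[OF X T(1)] .
  have x: "x \<in> interior (convex hull V)" using T V by simp
  have len: "length \<rho> = Suc k" "length \<sigma> = Suc k" "distinct \<sigma>"
    using assms by (auto simp: oriented_simplices_def)
  show ?thesis
    unfolding whitney_form_on_cell[OF X V(1,3) x len(1)] whitney_form_on_cell[OF X V(1,3) x len(2)]
    using len assms by (intro cell_whitney_reorder) auto
qed (simp add: whitney_form_def)

text \<open>All orderings of a simplex are oriented simplices, and their forms agree up to sign.
  Keeping one ordering per vertex set turns a redundant spanning family into one with unique
  coefficients.\<close>

definition orientation_rep :: "(real ^ 'n) set set \<Rightarrow> nat \<Rightarrow> (real ^ 'n) list \<Rightarrow> (real ^ 'n) list" where
  "orientation_rep X k \<sigma> = (SOME \<rho>. \<rho> \<in> oriented_simplices X k \<and> set \<rho> = set \<sigma>)"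

definition orientations :: "(real ^ 'n) set set \<Rightarrow> nat \<Rightarrow> (real ^ 'n) list set" where
  "orientations X k = orientation_rep X k ` oriented_simplices X k"

lemma orientation_rep:
  assumes "\<sigma> \<in> oriented_simplices X k"
  shows "orientation_rep X k \<sigma> \<in> oriented_simplices X k" "set (orientation_rep X k \<sigma>) = set \<sigma>"
  using someI[of "\<lambda>\<rho>. \<rho> \<in> oriented_simplices X k \<and> set \<rho> = set \<sigma>" \<sigma>] assms
  unfolding orientation_rep_def by auto

lemma orientation_rep_cong: "set \<rho> = set \<sigma> \<Longrightarrow> orientation_rep X k \<rho> = orientation_rep X k \<sigma>"
  by (simp add: orientation_rep_def)

lemma orientation_rep_of_rep:
  "\<sigma> \<in> orientations X k \<Longrightarrow> orientation_rep X k \<sigma> = \<sigma>"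
  unfolding orientations_def by (auto intro!: orientation_rep_cong simp: orientation_rep)

lemma orientations_subset: "orientations X k \<subseteq> oriented_simplices X k"
  unfolding orientations_def using orientation_rep by blast

text \<open>The compatibility condition for prescribed integrals: for equal vertex sets the
  incidence is the sign of the reordering.\<close>

definition orientation_alternating :: "(real ^ 'n) set set \<Rightarrow> nat \<Rightarrow> ((real ^ 'n) list \<Rightarrow> real) \<Rightarrow> bool" where
  "orientation_alternating X k f \<longleftrightarrow> (\<forall>\<rho>\<in>oriented_simplices X k. \<forall>\<sigma>\<in>oriented_simplices X k.
     set \<rho> = set \<sigma> \<longrightarrow> f \<rho> = incidence \<sigma> \<rho> * f \<sigma>)"

definition whitney_interpolant :: "(real ^ 'n) set set \<Rightarrow> nat \<Rightarrow> ((real ^ 'n) list \<Rightarrow> real) \<Rightarrow> 'n form" where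
  "whitney_interpolant X k f x v = (\<Sum>\<sigma>\<in>orientations X k. f \<sigma> * whitney_form X \<sigma> x v)"

text \<open>The terms of any representation are collected by vertex set. Since forms and integrals
  of reorderings change by the same incidences, and different vertex sets do not interact, the
  collected coefficient is the integral. This is the uniqueness half of unisolvence.\<close>

lemma whitney_space_eq_interpolant:
  fixes X :: "(real ^ 'n) set set"
  assumes X: "simplicial_complex X" and T: "\<And>\<sigma>. \<sigma> \<in> oriented_simplices X k \<Longrightarrow> \<exists>T\<in>cells X. set \<sigma> \<subseteq> T"
    and w: "w \<in> whitney_space X k"
  shows "w = whitney_interpolant X k (simplex_integral X w)"
proof (intro ext)
  fix x v
  let ?O = "oriented_simplices X k" and ?R = "orientations X k" and ?r = "orientation_rep X k"
  obtain c where c: "w = (\<lambda>x v. \<Sum>\<rho>\<in>?O. c \<rho> * whitney_form X \<rho> x v)"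
    using w by (auto simp: whitney_space_def)
  have finO: "finite ?O" by (rule finite_oriented_simplices[OF X])
  have "w x v = (\<Sum>\<sigma>\<in>?R. \<Sum>\<rho>\<in>{\<rho>\<in>?O. ?r \<rho> = \<sigma>}. c \<rho> * whitney_form X \<rho> x v)"
    unfolding c orientations_def by (rule sum.image_gen[OF finO])
  also have "\<dots> = (\<Sum>\<sigma>\<in>?R. simplex_integral X w \<sigma> * whitney_form X \<sigma> x v)"
  proof (intro sum.cong refl)
    fix \<sigma> assume "\<sigma> \<in> ?R"
    hence \<sigma>: "\<sigma> \<in> ?O" "?r \<sigma> = \<sigma>" using orientations_subset orientation_rep_of_rep by auto
    have fibre: "?r \<rho> = \<sigma> \<longleftrightarrow> set \<rho> = set \<sigma>" if "\<rho> \<in> ?O" for \<rho>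
      using orientation_rep[OF that] orientation_rep_cong[of \<rho> \<sigma>] \<sigma> by metis
    have "simplex_integral X w \<sigma> = (\<Sum>\<rho>\<in>?O. c \<rho> * incidence \<rho> \<sigma>)"
      unfolding c by (rule simplex_integral_whitney[OF X \<sigma>(1) T[OF \<sigma>(1)]])
    also have "\<dots> = (\<Sum>\<rho>\<in>{\<rho>\<in>?O. ?r \<rho> = \<sigma>}. c \<rho> * incidence \<rho> \<sigma>)"
    proof (rule sum.mono_neutral_right[OF finO])
      show "\<forall>\<rho>\<in>?O - {\<rho>\<in>?O. ?r \<rho> = \<sigma>}. c \<rho> * incidence \<rho> \<sigma> = 0"
        using fibre \<sigma> by (auto simp: oriented_simplices_def intro!: incidence_eq_0)
    qed auto
    finally have w: "simplex_integral X w \<sigma> = (\<Sum>\<rho>\<in>{\<rho>\<in>?O. ?r \<rho> = \<sigma>}. c \<rho> * incidence \<rho> \<sigma>)" .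
    show "(\<Sum>\<rho>\<in>{\<rho>\<in>?O. ?r \<rho> = \<sigma>}. c \<rho> * whitney_form X \<rho> x v) =
        simplex_integral X w \<sigma> * whitney_form X \<sigma> x v"
      unfolding w sum_distrib_right
    proof (intro sum.cong refl)
      fix \<rho> assume "\<rho> \<in> {\<rho>\<in>?O. ?r \<rho> = \<sigma>}"
      hence "\<rho> \<in> ?O" "set \<rho> = set \<sigma>" using fibre by auto
      from whitney_form_reorder[OF X this(1) \<sigma>(1) this(2)]
      show "c \<rho> * whitney_form X \<rho> x v = c \<rho> * incidence \<rho> \<sigma> * whitney_form X \<sigma> x v" by simp
    qed
  qed
  finally show "w x v = whitney_interpolant X k (simplex_integral X w) x v"
    by (simp add: whitney_interpolant_def)
qed

lemma whitney_interpolant_in_space: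
  assumes X: "simplicial_complex X"
  shows "whitney_interpolant X k f \<in> whitney_space X k"
proof -
  have "whitney_interpolant X k f = (\<lambda>x v. \<Sum>\<sigma>\<in>oriented_simplices X k.
      (if \<sigma> \<in> orientations X k then f \<sigma> else 0) * whitney_form X \<sigma> x v)"
    unfolding whitney_interpolant_def
    by (intro ext sum.mono_neutral_cong_left finite_oriented_simplices[OF X] orientations_subset) auto
  thus ?thesis
    unfolding whitney_space_def
    by (intro CollectI exI[of _ "\<lambda>\<sigma>. if \<sigma> \<in> orientations X k then f \<sigma> else 0"])
qed

text \<open>Among the chosen orderings only the one with the vertices of \<sigma> has nonzero
  incidence with \<sigma>; the alternating condition then turns its value into that of
  \<sigma>.\<close>

lemma simplex_integral_interpolant:
  fixes X :: "(real ^ 'n) set set"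
  assumes X: "simplicial_complex X" and T: "\<exists>T\<in>cells X. set \<sigma> \<subseteq> T"
    and f: "orientation_alternating X k f" and \<sigma>: "\<sigma> \<in> oriented_simplices X k"
  shows "simplex_integral X (whitney_interpolant X k f) \<sigma> = f \<sigma>"
proof -
  let ?O = "oriented_simplices X k" and ?R = "orientations X k" and ?r = "orientation_rep X k"
  have finR: "finite ?R"
    using finite_subset[OF orientations_subset finite_oriented_simplices[OF X]] .
  let ?c = "\<lambda>\<rho>. if \<rho> \<in> ?R then f \<rho> else 0"
  have "whitney_interpolant X k f = (\<lambda>x v. \<Sum>\<rho>\<in>?O. ?c \<rho> * whitney_form X \<rho> x v)"
    unfolding whitney_interpolant_def
    by (intro ext sum.mono_neutral_cong_left finite_oriented_simplices[OF X] orientations_subset) auto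
  hence "simplex_integral X (whitney_interpolant X k f) \<sigma> = (\<Sum>\<rho>\<in>?O. ?c \<rho> * incidence \<rho> \<sigma>)"
    using simplex_integral_whitney[OF X \<sigma> T, of ?c] by simp
  also have "\<dots> = (\<Sum>\<rho>\<in>?R. f \<rho> * incidence \<rho> \<sigma>)"
    by (rule sum.mono_neutral_cong_right[OF finite_oriented_simplices[OF X] orientations_subset]) auto
  also have "\<dots> = (\<Sum>\<rho>\<in>?R. if \<rho> = ?r \<sigma> then f (?r \<sigma>) * incidence (?r \<sigma>) \<sigma> else 0)"
  proof (intro sum.cong refl)
    fix \<rho> assume \<rho>: "\<rho> \<in> ?R"
    have "\<rho> = ?r \<sigma> \<longleftrightarrow> set \<rho> = set \<sigma>"
      using orientation_rep_of_rep[OF \<rho>] orientation_rep_cong[of \<rho> \<sigma>] orientation_rep(2)[OF \<sigma>]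
      by metis
    moreover have "incidence \<rho> \<sigma> = 0" if "set \<rho> \<noteq> set \<sigma>"
    proof (rule incidence_eq_0)
      have "\<rho> \<in> ?O" using \<rho> orientations_subset by blast
      thus "length \<rho> = length \<sigma>" "distinct \<rho>" "distinct \<sigma>" using \<sigma> by (auto simp: oriented_simplices_def)
    qed (rule that)
    ultimately show "f \<rho> * incidence \<rho> \<sigma> = (if \<rho> = ?r \<sigma> then f (?r \<sigma>) * incidence (?r \<sigma>) \<sigma> else 0)"
      by (cases "\<rho> = ?r \<sigma>") simp_all
  qed
  also have "\<dots> = f (?r \<sigma>) * incidence (?r \<sigma>) \<sigma>"
    using finR \<sigma> by (simp add: orientations_def)
  also have "f (?r \<sigma>) * incidence (?r \<sigma>) \<sigma> = f \<sigma>"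
    using f[unfolded orientation_alternating_def, rule_format, OF \<sigma> orientation_rep(1)[OF \<sigma>]]
      orientation_rep(2)[OF \<sigma>] by (simp only: mult.commute)
  finally show ?thesis .
qed

lemma B_op_eq_interpolant:
  fixes X :: "(real ^ 'n) set set"
  assumes X: "simplicial_complex X" and T: "\<And>\<sigma>. \<sigma> \<in> oriented_simplices X k \<Longrightarrow> \<exists>T\<in>cells X. set \<sigma> \<subseteq> T"
    and f: "orientation_alternating X k f"
    and fu: "\<And>\<sigma>. \<sigma> \<in> oriented_simplices X k \<Longrightarrow> f \<sigma> = cone_integral a \<sigma> u - dual_cone_integral a \<sigma> u"
  shows "B_op X a k u = whitney_interpolant X k f"
  unfolding B_op_def
proof (rule the_equality)
  show "whitney_interpolant X k f \<in> whitney_space X k \<and> (\<forall>\<sigma>\<in>oriented_simplices X k.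
      simplex_integral X (whitney_interpolant X k f) \<sigma> = cone_integral a \<sigma> u - dual_cone_integral a \<sigma> u)"
    using whitney_interpolant_in_space[OF X] simplex_integral_interpolant[OF X T f] fu by auto
  fix w assume "w \<in> whitney_space X k \<and> (\<forall>\<sigma>\<in>oriented_simplices X k.
      simplex_integral X w \<sigma> = cone_integral a \<sigma> u - dual_cone_integral a \<sigma> u)"
  hence w: "w \<in> whitney_space X k" "\<And>\<sigma>. \<sigma> \<in> oriented_simplices X k \<Longrightarrow> simplex_integral X w \<sigma> = f \<sigma>"
    by (simp_all add: fu)
  have "w = whitney_interpolant X k (simplex_integral X w)"
    by (rule whitney_space_eq_interpolant[OF X T w(1)])
  also have "\<dots> = whitney_interpolant X k f"
    unfolding whitney_interpolant_def using w(2) orientations_subset[of X k]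
    by (intro ext sum.cong) (auto dest: subsetD)
  finally show "w = whitney_interpolant X k f" .
qed

text \<open>Simplices that are not cells have measure zero. If a relative interior point of
  \<open>S\<close> avoided the closed union of the cells, some nonempty open part of the domain
  would be covered by them. So the point lies in a cell \<open>T\<close>, and the face
  \<open>S \<inter> T\<close> of \<open>S\<close> meets the relative interior of \<open>S\<close>,
  hence is \<open>S\<close>.\<close>

lemma cell_contains_simplex:
  fixes X :: "(real ^ 'n) set set"
  assumes X: "simplicial_complex X" and reg: "closure (interior (\<Union>X)) = \<Union>X"
    and S: "S \<in> X" "S \<noteq> {}"
  shows "\<exists>T\<in>cells X. S \<subseteq> T"
proof -
  have conv: "convex S'" "compact S'" if "S' \<in> X" for S'
    using complex_simplex[OF X that] convex_simplex compact_simplex by blast+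
  have "rel_interior S \<noteq> {}" using S conv rel_interior_eq_empty by blast
  then obtain x where x: "x \<in> rel_interior S" by blast
  have "x \<in> \<Union>(cells X)"
  proof (rule ccontr)
    assume nx: "x \<notin> \<Union>(cells X)"
    have "finite (cells X)" using complex_finite[OF X] by (simp add: cells_def)
    hence "closed (\<Union>(cells X))"
      using conv by (intro closed_Union) (auto simp: cells_def compact_imp_closed)
    hence op: "open (- \<Union>(cells X) \<inter> interior (\<Union>X))" by (intro open_Int) auto
    have "x \<in> closure (interior (\<Union>X))"
      using x S(1) rel_interior_subset reg by blast
    hence ne: "- \<Union>(cells X) \<inter> interior (\<Union>X) \<noteq> {}"
      using nx \<open>closed (\<Union>(cells X))\<close> open_Int_closure_eq_empty[of "- \<Union>(cells X)" "interior (\<Union>X)"]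
      by auto
    have "negligible S'" if S': "S' \<in> X - cells X" for S'
    proof -
      obtain m where m: "m simplex S'" using S' complex_simplex[OF X] by blast
      hence "m \<noteq> int CARD('n)" using S' by (auto simp: cells_def)
      hence "interior S' = {}" using aff_dim_simplex[OF m] by (intro low_dim_interior) simp
      hence "S' \<subseteq> frontier S'" using closure_subset[of S'] by (auto simp: frontier_def)
      thus ?thesis using negligible_convex_frontier conv S' negligible_subset by blast
    qed
    hence "negligible (\<Union>(X - cells X))"
      using complex_finite[OF X] by (intro negligible_Union) auto
    moreover have "- \<Union>(cells X) \<inter> interior (\<Union>X) \<subseteq> \<Union>(X - cells X)"
      using interior_subset by blast
    ultimately have "negligible (- \<Union>(cells X) \<inter> interior (\<Union>X))"
      using negligible_subset by blast
    thus False using open_not_negligible[OF op ne] by blast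
  qed
  then obtain T where T: "T \<in> cells X" "x \<in> T" by blast
  hence "(S \<inter> T) face_of S" using complex_Int[OF X S(1)] by (simp add: cells_def)
  hence "S \<inter> T = S" using face_of_disjoint_rel_interior x T rel_interior_subset by blast
  thus ?thesis using T by blast
qed

lemma cell_interiors_disjoint:
  fixes X :: "(real ^ 'n) set set"
  assumes X: "simplicial_complex X" and T: "T \<in> cells X" "T' \<in> cells X"
    and x: "x \<in> interior T" "x \<in> interior T'"
  shows "T = T'"
proof -
  have "x \<in> rel_interior T" "x \<in> rel_interior T'" using x interior_subset_rel_interior by blast+
  moreover have "x \<in> T \<inter> T'" using x interior_subset by blast
  moreover have "(T \<inter> T') face_of T" "(T \<inter> T') face_of T'"
    using complex_Int[OF X, of T T'] complex_Int[OF X, of T' T] T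
    by (simp_all add: cells_def Int_commute)
  ultimately show ?thesis using face_of_disjoint_rel_interior by blast
qed

lemma AE_linear_neq:
  fixes L :: "real ^ 'n \<Rightarrow> real"
  assumes "linear L" "L w \<noteq> 0"
  shows "AE y in lborel. L y \<noteq> c"
proof -
  define r where "r = (\<Sum>b\<in>Basis. L b *\<^sub>R b)"
  have L: "L y = r \<bullet> y" for y
  proof -
    have "L y = L (\<Sum>b\<in>Basis. (y \<bullet> b) *\<^sub>R b)" by (simp add: euclidean_representation)
    also have "\<dots> = (\<Sum>b\<in>Basis. (y \<bullet> b) * L b)"
      by (simp only: linear_sum[OF assms(1)] linear_scale[OF assms(1)] real_scaleR_def)
    finally show ?thesis by (simp add: r_def inner_sum_left inner_commute[of y] mult.commute)
  qed
  hence "r \<noteq> 0" using assms(2) by auto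
  hence "negligible {y. r \<bullet> y = c}" by (intro negligible_hyperplane) simp
  moreover have "{y. r \<bullet> y = c} \<in> sets lborel" by (simp add: borel_closed closed_hyperplane)
  ultimately have "{y. r \<bullet> y = c} \<in> null_sets lborel"
    by (simp add: negligible_iff_null_sets null_sets_completion_iff)
  thus ?thesis using AE_not_in by (fastforce simp: L)
qed

section \<open>Cones over facets\<close>

text \<open>For a facet of the simplex \<open>V\<close> with opposite vertex \<open>p\<close>, a point \<open>y\<close> lies on the ray from \<open>a\<close>
  through the point \<open>a + (y - a) / s\<close> of the hyperplane of that facet, where \<open>s = facet_ratio V p a y\<close>.\<close>
definition facet_ratio :: "(real ^ 'n) set \<Rightarrow> real ^ 'n \<Rightarrow> real ^ 'n \<Rightarrow> real ^ 'n \<Rightarrow> real" where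
  "facet_ratio V p a y = - bary V p (0, y - a) / bary V p (1, a)"

text \<open>The image of the orthant under the cone parametrisation if the coordinate of
  \<open>a\<close> at \<open>p\<close> is nonzero. Otherwise the ratio has the default value 0 and
  the set has no such meaning; its integrals then occur with a vanishing sign factor.\<close>

definition facet_cone :: "(real ^ 'n) set \<Rightarrow> real ^ 'n \<Rightarrow> real ^ 'n \<Rightarrow> (real ^ 'n) set" where
  "facet_cone V p a = {y. \<forall>q\<in>V. 0 \<le> bary V q (0, y - a) + facet_ratio V p a y * bary V q (1, a)}"

definition facet_join :: "(real ^ 'n) set \<Rightarrow> real ^ 'n \<Rightarrow> real ^ 'n \<Rightarrow> (real ^ 'n) set" where
  "facet_join V p a = {y \<in> facet_cone V p a. facet_ratio V p a y \<le> 1}"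

lemma continuous_facet_ratio:
  assumes "affine_frame V"
  shows "continuous_on S (facet_ratio V p a)"
proof -
  have "continuous_on S (\<lambda>y. bary V p (0, y - a))"
    by (rule continuous_on_compose2[OF continuous_bary[OF assms, of UNIV]]) (auto intro!: continuous_intros)
  thus ?thesis unfolding facet_ratio_def divide_inverse by (intro continuous_intros)
qed

lemma closed_facet_cone:
  assumes "affine_frame V"
  shows "closed (facet_cone V p a)"
proof -
  have "continuous_on UNIV (\<lambda>y. bary V q (0, y - a))" for q
    by (rule continuous_on_compose2[OF continuous_bary[OF assms, of UNIV]]) (auto intro!: continuous_intros)
  hence "closed {y. 0 \<le> bary V q (0, y - a) + facet_ratio V p a y * bary V q (1, a)}" for q
    by (intro closed_Collect_le continuous_intros continuous_facet_ratio assms) auto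
  hence "closed (\<Inter>q\<in>V. {y. 0 \<le> bary V q (0, y - a) + facet_ratio V p a y * bary V q (1, a)})"
    by blast
  also have "(\<Inter>q\<in>V. {y. 0 \<le> bary V q (0, y - a) + facet_ratio V p a y * bary V q (1, a)}) = facet_cone V p a"
    by (auto simp: facet_cone_def)
  finally show ?thesis .
qed

lemma closed_facet_join:
  assumes "affine_frame V"
  shows "closed (facet_join V p a)"
proof -
  have "facet_join V p a = facet_cone V p a \<inter> {y. facet_ratio V p a y \<le> 1}"
    by (auto simp: facet_join_def)
  thus ?thesis
    using closed_facet_cone[OF assms]
    by (auto intro!: closed_Int closed_Collect_le continuous_facet_ratio assms continuous_intros)
qed

text \<open>If \<rho> lists \<open>V\<close>, this is the inverse of the determinant of the
  homogenised vertices in this order; its sign records the orientation of the order.\<close>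

definition frame_det :: "(real ^ 'n) set \<Rightarrow> (real ^ 'n) list \<Rightarrow> real" where
  "frame_det V \<rho> = fdet (Suc CARD('n)) (\<lambda>i j. bary V (\<rho> ! i) (hframe j))"

lemma fdet_bary:
  fixes V :: "(real ^ 'n) set"
  assumes "affine_frame V"
  shows "fdet (Suc CARD('n)) (\<lambda>i j. bary V (\<rho> ! i) (q j)) = frame_det V \<rho> * hdet q"
  unfolding frame_det_def by (rule fdet_linear_functionals) (rule linear_bary[OF assms])

text \<open>Cramer's rule: evaluated at \<open>a\<close> and the vertices in \<sigma>, the
  functionals give a triangular matrix whose diagonal is the coordinate of \<open>a\<close> at
  \<open>p\<close> followed by ones.\<close>

lemma frame_det_facet:
  fixes V :: "(real ^ 'n) set"
  assumes V: "affine_frame V" and p: "p \<in> V" and \<sigma>: "distinct \<sigma>" "set \<sigma> = V - {p}"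
  shows "frame_det V (p # \<sigma>) * vdet (\<lambda>i. \<sigma> ! i - a) = bary V p (1, a)"
proof -
  have len: "length \<sigma> = CARD('n)"
    using \<sigma> p affine_frameD[OF V] by (metis card_Diff_singleton diff_Suc_1 distinct_card)
  let ?q = "\<lambda>j. (a # \<sigma>) ! j"
  let ?A = "\<lambda>i j. bary V ((p # \<sigma>) ! i) (1, ?q j)"
  have entry: "?A i (Suc j) = of_bool (i = Suc j)" if "i \<le> CARD('n)" "j < CARD('n)" for i j
  proof -
    have "\<sigma> ! j \<in> set \<sigma>" using that len by simp
    hence "\<sigma> ! j \<in> V" "\<sigma> ! j \<noteq> p" using \<sigma> by auto
    thus ?thesis
      using that len \<sigma>(1) by (cases i) (auto simp: bary_vertex[OF V] nth_eq_iff_index_eq)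
  qed
  have "fdet (Suc CARD('n)) ?A = (\<Prod>i<Suc CARD('n). ?A i i)"
  proof (rule fdet_lower_triangular)
    fix i j assume "j < Suc CARD('n)" "i < j"
    thus "?A i j = 0" using entry[of i "j - 1"] by (cases j) auto
  qed
  also have "\<dots> = bary V p (1, a)"
  proof -
    have "?A (Suc i) (Suc i) = 1" if "i < CARD('n)" for i using entry[of "Suc i" i] that by simp
    hence "(\<Prod>i<CARD('n). ?A (Suc i) (Suc i)) = 1" by (intro prod.neutral) auto
    thus ?thesis unfolding prod.lessThan_Suc_shift by simp
  qed
  finally have "frame_det V (p # \<sigma>) * hdet (\<lambda>j. (1, ?q j)) = bary V p (1, a)"
    using fdet_bary[OF V, of "p # \<sigma>" "\<lambda>j. (1, ?q j)"] by simp
  thus ?thesis by (simp add: hdet_points)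
qed

lemma vdet_facet:
  fixes V :: "(real ^ 'n) set"
  assumes V: "affine_frame V" and p: "p \<in> V" and \<sigma>: "distinct \<sigma>" "set \<sigma> = V - {p}"
  shows "frame_det V (p # \<sigma>) \<noteq> 0" "vdet (\<lambda>i. \<sigma> ! i - a) = bary V p (1, a) / frame_det V (p # \<sigma>)"
proof -
  show "frame_det V (p # \<sigma>) \<noteq> 0"
    using frame_det_facet[OF assms, of p] bary_vertex[OF V p] by auto
  thus "vdet (\<lambda>i. \<sigma> ! i - a) = bary V p (1, a) / frame_det V (p # \<sigma>)"
    using frame_det_facet[OF assms, of a] by (simp add: field_simps)
qed

text \<open>Let \<open>s\<close> be the sum of the \<open>x i\<close>. Expanding
  \<open>y - a\<close> shows that its \<open>q\<close>-th coordinate plus \<open>s\<close> times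
  that of \<open>a\<close> is \<open>x i\<close> for \<open>q = \<sigma> ! i\<close>, and 0 for
  \<open>q = p\<close>. So \<open>s\<close> is where the line meets the hyperplane of the facet, and
  the parameters are its remaining coordinates there.\<close>

lemma facet_coordinates:
  fixes V :: "(real ^ 'n) set"
  assumes V: "affine_frame V" and p: "p \<in> V" and \<sigma>: "distinct \<sigma>" "set \<sigma> = V - {p}"
    and a: "bary V p (1, a) \<noteq> 0"
  fixes x :: "nat \<Rightarrow> real"
  defines "y \<equiv> a + (\<Sum>i<CARD('n). x i *\<^sub>R (\<sigma> ! i - a))"
  shows "facet_ratio V p a y = (\<Sum>i<CARD('n). x i)"
    and "y \<in> facet_cone V p a \<longleftrightarrow> (\<forall>i<CARD('n). 0 \<le> x i)"
proof -
  have len: "length \<sigma> = CARD('n)"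
    using \<sigma> p affine_frameD[OF V] by (metis card_Diff_singleton diff_Suc_1 distinct_card)
  let ?s = "\<Sum>i<CARD('n). x i"
  have d: "bary V q (0, y - a) = (\<Sum>i<CARD('n). x i * of_bool (q = \<sigma> ! i)) - ?s * bary V q (1, a)" for q
  proof -
    note lin = linear_bary[OF V, of q]
    have "(0, y - a) = (\<Sum>i<CARD('n). x i *\<^sub>R (0 :: real, \<sigma> ! i - a))"
      by (simp add: y_def prod_eq_iff fst_sum snd_sum)
    hence "bary V q (0, y - a) = (\<Sum>i<CARD('n). x i * bary V q (0, \<sigma> ! i - a))"
      by (simp only: linear_sum[OF lin] linear_scale[OF lin] real_scaleR_def)
    also have "\<dots> = (\<Sum>i<CARD('n). x i * (of_bool (q = \<sigma> ! i) - bary V q (1, a)))"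
    proof (intro sum.cong refl)
      fix i assume "i \<in> {..<CARD('n)}"
      hence "\<sigma> ! i \<in> V" using \<sigma> len nth_mem by fastforce
      thus "x i * bary V q (0, \<sigma> ! i - a) = x i * (of_bool (q = \<sigma> ! i) - bary V q (1, a))"
        using bary_diff[OF V, of q 1 "\<sigma> ! i" 1 a] bary_vertex[OF V, of "\<sigma> ! i" q] by simp
    qed
    finally show ?thesis by (simp add: right_diff_distrib sum_subtractf sum_distrib_right)
  qed
  have "p \<noteq> \<sigma> ! i" if "i < CARD('n)" for i using that \<sigma> len nth_mem by fastforce
  hence dp: "bary V p (0, y - a) = - ?s * bary V p (1, a)"
    unfolding d by (simp add: sum.neutral)
  thus ratio: "facet_ratio V p a y = ?s" using a by (simp add: facet_ratio_def)
  have q: "bary V (\<sigma> ! j) (0, y - a) + ?s * bary V (\<sigma> ! j) (1, a) = x j" if j: "j < CARD('n)" for j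
  proof -
    have "(\<Sum>i<CARD('n). x i * of_bool (\<sigma> ! j = \<sigma> ! i)) = (\<Sum>i<CARD('n). if i = j then x i else 0)"
      using j \<sigma>(1) len by (intro sum.cong) (auto simp: nth_eq_iff_index_eq)
    thus ?thesis unfolding d using j by simp
  qed
  have "V = insert p (set \<sigma>)" using p \<sigma> by auto
  hence "y \<in> facet_cone V p a \<longleftrightarrow> (\<forall>q\<in>set \<sigma>. 0 \<le> bary V q (0, y - a) + ?s * bary V q (1, a))"
    unfolding facet_cone_def ratio mem_Collect_eq using dp by auto
  also have "\<dots> \<longleftrightarrow> (\<forall>i<CARD('n). 0 \<le> x i)"
    using q len by (metis in_set_conv_nth)
  finally show "y \<in> facet_cone V p a \<longleftrightarrow> (\<forall>i<CARD('n). 0 \<le> x i)" .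
qed

lemma cone_integrals_facet:
  fixes V :: "(real ^ 'n) set"
  assumes V: "affine_frame V" and p: "p \<in> V" and \<sigma>: "distinct \<sigma>" "set \<sigma> = V - {p}"
    and u: "\<And>x v. u x v = g x * vdet v" and g: "g \<in> borel_measurable borel"
  shows "cone_integral a \<sigma> u = sgn (vdet (\<lambda>i. \<sigma> ! i - a)) * (LINT y:facet_join V p a|lborel. g y)"
    and "dual_cone_integral a \<sigma> u = sgn (vdet (\<lambda>i. \<sigma> ! i - a)) * (LINT y:facet_cone V p a|lborel. g y)"
proof -
  have len: "length \<sigma> = CARD('n)"
    using \<sigma> p affine_frameD[OF V] by (metis card_Diff_singleton diff_Suc_1 distinct_card)
  let ?e = "\<lambda>i. \<sigma> ! i - a"
  have "cone_integral a \<sigma> u = sgn (vdet ?e) * (LINT y:facet_join V p a|lborel. g y) \<and>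
    dual_cone_integral a \<sigma> u = sgn (vdet ?e) * (LINT y:facet_cone V p a|lborel. g y)"
  proof (cases "vdet ?e = 0")
    \<comment> \<open>In the degenerate case the form vanishes on the tangent vectors, and
      \<open>sgn 0 = 0\<close> on the right.\<close>
    case True
    thus ?thesis
      by (simp add: cone_integral_def dual_cone_integral_def affine_integral_def u
          set_lebesgue_integral_def)
  next
    case False
    hence a: "bary V p (1, a) \<noteq> 0" using vdet_facet(2)[OF V p \<sigma>, of a] by auto
    note coords = facet_coordinates[OF V p \<sigma> a]
    have "facet_join V p a \<in> sets borel" "facet_cone V p a \<in> sets borel"
      using closed_facet_join[OF V] closed_facet_cone[OF V] by (simp_all add: borel_closed)
    thus ?thesis
      unfolding cone_integral_def dual_cone_integral_def len
      using False g
      by (intro conjI affine_integral_eq_lborel u)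
         (auto simp: coords facet_join_def std_simplex_pow_def orthant_def)
  qed
  thus "cone_integral a \<sigma> u = sgn (vdet ?e) * (LINT y:facet_join V p a|lborel. g y)"
    "dual_cone_integral a \<sigma> u = sgn (vdet ?e) * (LINT y:facet_cone V p a|lborel. g y)" by auto
qed

section \<open>Orientation signs and the volume of a cell\<close>

lemma incidence_inverse:
  assumes "length \<rho> = length \<sigma>" "distinct \<rho>" "distinct \<sigma>" "set \<rho> = set \<sigma>"
  shows "incidence \<sigma> \<rho> * incidence \<sigma> \<rho> = 1"
proof -
  have "incidence \<sigma> \<rho> = incidence \<rho> \<sigma>"
    unfolding incidence_def using fdet_transpose[of "length \<rho>" "\<lambda>i j. of_bool (\<rho> ! i = \<sigma> ! j)"] assms(1)
    by (simp add: eq_commute)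
  hence "incidence \<sigma> \<rho> * incidence \<sigma> \<rho> = incidence \<sigma> \<rho> * incidence \<rho> \<sigma>" by simp
  also have "\<dots> = fdet (length \<sigma>) (\<lambda>i j. \<Sum>k<length \<sigma>. of_bool (\<sigma> ! i = \<rho> ! k) * of_bool (\<rho> ! k = \<sigma> ! j))"
    unfolding incidence_def assms(1) by (rule fdet_mult[symmetric])
  also have "\<dots> = incidence \<sigma> \<sigma>"
    unfolding incidence_def
  proof (rule fdet_cong)
    fix i j assume "i < length \<sigma>"
    hence "\<sigma> ! i \<in> set \<rho>" using assms by simp
    from sum_nth_delta[OF assms(2) this, of "\<lambda>q. of_bool (q = \<sigma> ! j)"]
    show "(\<Sum>k<length \<sigma>. of_bool (\<sigma> ! i = \<rho> ! k) * of_bool (\<rho> ! k = \<sigma> ! j)) = (of_bool (\<sigma> ! i = \<sigma> ! j) :: real)"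
      using assms(1) by simp
  qed
  finally show ?thesis using incidence_refl[OF assms(3)] by simp
qed

lemma vdet_reorder:
  fixes \<sigma> :: "(real ^ 'n) list"
  assumes "length \<rho> = CARD('n)" "length \<sigma> = CARD('n)" "distinct \<sigma>" "set \<rho> = set \<sigma>"
  shows "vdet (\<lambda>i. \<rho> ! i - a) = incidence \<sigma> \<rho> * vdet (\<lambda>i. \<sigma> ! i - a)"
proof -
  have "vdet (\<lambda>i. \<rho> ! i - a) =
      fdet CARD('n) (\<lambda>i j. \<Sum>k<CARD('n). (\<sigma> ! k - a) $ idx i * of_bool (\<sigma> ! k = \<rho> ! j))"
    unfolding vdet_def
  proof (rule fdet_cong)
    fix i j assume "j < CARD('n)"
    hence "\<rho> ! j \<in> set \<sigma>" using assms by (metis nth_mem)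
    from sum_nth_delta[OF assms(3) this, of "\<lambda>q. (q - a) $ idx i"] assms(2)
    show "(\<rho> ! j - a) $ idx i = (\<Sum>k<CARD('n). (\<sigma> ! k - a) $ idx i * of_bool (\<sigma> ! k = \<rho> ! j))"
      by (simp add: mult.commute eq_commute)
  qed
  also have "\<dots> = vdet (\<lambda>i. \<sigma> ! i - a) * incidence \<sigma> \<rho>"
    unfolding vdet_def incidence_def assms(1) by (rule fdet_mult)
  finally show ?thesis by simp
qed

text \<open>The cell is the join of its vertex \<open>p\<close> with the opposite facet, so the
  facet parametrisation with \<open>a = p\<close> computes its volume as the integral of the volume
  form.\<close>

lemma integral_cell_const:
  fixes V :: "(real ^ 'n) set"
  assumes V: "affine_frame V" and p: "p \<in> V" and \<sigma>: "distinct \<sigma>" "set \<sigma> = V - {p}"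
  shows "measure lborel (convex hull V) = 1 / (fact CARD('n) * \<bar>frame_det V (p # \<sigma>)\<bar>)"
proof -
  have len: "length \<sigma> = CARD('n)"
    using \<sigma> p affine_frameD[OF V] by (metis card_Diff_singleton diff_Suc_1 distinct_card)
  let ?e = "\<lambda>i. \<sigma> ! i - p"
  let ?D = "frame_det V (p # \<sigma>)"
  have bp: "bary V q (1, p) = of_bool (q = p)" for q by (rule bary_vertex[OF V p])
  have vd: "vdet ?e = 1 / ?D" and D: "?D \<noteq> 0"
    using vdet_facet(1)[OF V p \<sigma>] vdet_facet(2)[OF V p \<sigma>, of p] bp by simp_all
  let ?u = "\<lambda>(x :: real ^ 'n) v. 1 * vdet v"
  have "affine_integral CARD('n) (std_simplex_pow CARD('n)) p ?e ?u = (1 * vdet ?e) / fact CARD('n)"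
    by (rule affine_integral_const_form) simp
  moreover have "affine_integral CARD('n) (std_simplex_pow CARD('n)) p ?e ?u =
      sgn (vdet ?e) * (LINT x:convex hull V|lborel. 1)"
  proof (rule affine_integral_eq_lborel)
    show "vdet ?e \<noteq> 0" using vd D by simp
    show "convex hull V \<in> sets borel"
      using affine_frameD(1)[OF V] by (intro borel_compact finite_imp_compact_convex_hull)
    fix x assume x: "x \<in> space (lborel_pow CARD('n))"
    let ?y = "p + (\<Sum>i<CARD('n). x i *\<^sub>R ?e i)"
    have a: "bary V p (1, p) \<noteq> 0" by (simp add: bp)
    note coords = facet_coordinates[OF V p \<sigma> a, of x]
    have y: "bary V q (1, ?y) = bary V q (0, ?y - p) + of_bool (q = p)" for q
      using bary_diff[OF V, of q 1 ?y 1 p] bp by simp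
    have ratio: "facet_ratio V p p ?y = - bary V p (0, ?y - p)"
      by (simp add: facet_ratio_def bp)
    have "?y \<in> convex hull V \<longleftrightarrow> ?y \<in> facet_cone V p p \<and> facet_ratio V p p ?y \<le> 1"
      unfolding convex_hull_iff_bary[OF V] y facet_cone_def bp mem_Collect_eq
      using p ratio by (auto simp: of_bool_def split: if_splits)
    thus "?y \<in> convex hull V \<longleftrightarrow> x \<in> std_simplex_pow CARD('n)"
      unfolding coords using x by (auto simp: std_simplex_pow_def orthant_def)
  qed auto
  moreover have "(LINT x:convex hull V|lborel. 1) = measure lborel (convex hull V)"
  proof -
    have "compact (convex hull V)" using affine_frameD(1)[OF V] by (rule finite_imp_compact_convex_hull)
    hence "emeasure lborel (convex hull V) < \<infinity>" "convex hull V \<in> sets lborel"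
      using emeasure_bounded_finite[OF compact_imp_bounded] by (auto simp: borel_compact)
    thus ?thesis by (simp add: set_lebesgue_integral_def)
  qed
  ultimately have "sgn (1 / ?D) * measure lborel (convex hull V) = 1 / ?D / fact CARD('n)"
    by (simp add: vd)
  hence "sgn (1 / ?D) * (sgn (1 / ?D) * measure lborel (convex hull V)) = sgn (1 / ?D) * (1 / ?D / fact CARD('n))"
    by simp
  thus ?thesis using D by (auto simp: sgn_if split: if_splits)
qed

text \<open>For fixed \<open>y\<close> outside finitely many hyperplanes,
  \<open>sum_sgn_first_exit\<close> is applied twice: with the coordinates in \<open>V\<close> for
  the cones, and with the additional constraint \<open>s \<le> 1\<close> for the joins.\<close>

lemma AE_sum_facet_cones:
  fixes V :: "(real ^ 'n) set"
  assumes V: "affine_frame V" and a: "\<And>p. p \<in> V \<Longrightarrow> a \<notin> convex hull (V - {p})"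
  shows "AE y in lborel.
    (\<Sum>p\<in>V. sgn (bary V p (1, a)) * (indicator (facet_join V p a) y - indicator (facet_cone V p a) y)) =
    (indicator (convex hull V) y - of_bool (a \<in> convex hull V) :: real)"
proof -
  note fin = affine_frameD(1)[OF V]
  let ?\<mu> = "\<lambda>q. bary V q (1, a)" and ?d = "\<lambda>y q. bary V q (0, y - a)"
  have add: "bary V q (1, y) = ?d y q + ?\<mu> q" for q y
    using bary_diff[OF V, of q 1 y 1 a] by simp
  have lin0: "linear (\<lambda>w. bary V q (0, w))" for q
    using linear_compose[of "\<lambda>w. (0 :: real, w)" "bary V q"] linear_bary[OF V, of q]
    by (simp add: o_def linear_iff)
  have d0: "?d y q = bary V q (0, y) - bary V q (0, a)" for y q
    using bary_diff[OF V, of q 0 y 0 a] by simp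
  have gen1: "AE y in lborel. ?d y q * ?\<mu> r \<noteq> ?d y r * ?\<mu> q"
    if qr: "q \<in> V" "r \<in> V" "q \<noteq> r" "?\<mu> q \<noteq> 0" "?\<mu> r \<noteq> 0" for q r
  proof -
    let ?L = "\<lambda>w. bary V q (0, w) * ?\<mu> r - bary V r (0, w) * ?\<mu> q"
    have "linear ?L"
      using lin0[of q] lin0[of r] by (auto simp: linear_iff algebra_simps)
    \<comment> \<open>A direction in which the difference of the two products does not vanish, so
      that equality only holds on a hyperplane.\<close>
    moreover have "bary V q (0, q - a) = 1 - ?\<mu> q" "bary V r (0, q - a) = - ?\<mu> r"
      using add[of q q] add[of r q] bary_vertex[OF V qr(1)] qr by simp_all
    hence "?L (q - a) = ?\<mu> r" by (simp only:) (simp add: algebra_simps)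
    hence "?L (q - a) \<noteq> 0" using qr by simp
    ultimately have "AE y in lborel. ?L y \<noteq> bary V q (0, a) * ?\<mu> r - bary V r (0, a) * ?\<mu> q"
      by (rule AE_linear_neq)
    thus ?thesis by eventually_elim (simp add: d0 algebra_simps)
  qed
  have gen2: "AE y in lborel. bary V q (1, y) \<noteq> 0" if q: "q \<in> V" "?\<mu> q \<noteq> 0" for q
  proof -
    have "card V \<noteq> 1" using affine_frameD(3)[OF V] by simp
    hence "V \<noteq> {q}" by auto
    \<comment> \<open>The direction from \<open>a\<close> to another vertex \<open>r\<close> changes
      the coordinate at \<open>q\<close> by minus that of \<open>a\<close>, so the functional is not
      zero.\<close>
    then obtain r where r: "r \<in> V" "r \<noteq> q" using q by blast
    have "bary V q (0, r - a) \<noteq> 0" using add[of q r] bary_vertex[OF V r(1)] r q by simp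
    hence "AE y in lborel. bary V q (0, y) \<noteq> bary V q (0, a) - ?\<mu> q"
      using lin0 by (intro AE_linear_neq)
    thus ?thesis
    proof eventually_elim
      case (elim y)
      thus ?case using add[of q y] d0[of q y] by simp
    qed
  qed
  have pos: "\<exists>q\<in>V. 0 < ?\<mu> q"
  proof (rule ccontr)
    assume "\<not> (\<exists>q\<in>V. 0 < ?\<mu> q)"
    hence "(\<Sum>q\<in>V. ?\<mu> q) \<le> 0" by (intro sum_nonpos) (auto simp: not_less)
    thus False using sum_bary[OF V, of 1 a] by simp
  qed
  \<comment> \<open>Since \<open>a\<close> lies on no facet, its coordinates are nonzero if it is in
    the cell. The condition on vanishing coordinates, which would depend on \<open>y\<close>, is
    thus void.\<close>
  have a_in: "(\<forall>q\<in>V. 0 \<le> ?\<mu> q \<and> (?\<mu> q = 0 \<longrightarrow> P q)) \<longleftrightarrow> a \<in> convex hull V" for P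
  proof -
    have "?\<mu> q \<noteq> 0" if "q \<in> V" "a \<in> convex hull V" for q
      using a[OF that(1)] that convex_hull_subset_iff_bary[OF V, of "V - {q}" a] by auto
    thus ?thesis unfolding convex_hull_iff_bary[OF V] by blast
  qed
  have "AE y in lborel. (\<forall>q\<in>V. \<forall>r\<in>V. q \<noteq> r \<longrightarrow> ?\<mu> q \<noteq> 0 \<longrightarrow> ?\<mu> r \<noteq> 0 \<longrightarrow> ?d y q * ?\<mu> r \<noteq> ?d y r * ?\<mu> q)"
    using gen1 fin by (intro AE_finite_allI AE_impI) auto
  moreover have "AE y in lborel. \<forall>q\<in>V. ?\<mu> q \<noteq> 0 \<longrightarrow> bary V q (1, y) \<noteq> 0"
    using gen2 fin by (intro AE_finite_allI AE_impI) auto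
  ultimately show ?thesis
  proof eventually_elim
    fix y
    assume g1: "\<forall>q\<in>V. \<forall>r\<in>V. q \<noteq> r \<longrightarrow> ?\<mu> q \<noteq> 0 \<longrightarrow> ?\<mu> r \<noteq> 0 \<longrightarrow> ?d y q * ?\<mu> r \<noteq> ?d y r * ?\<mu> q"
      and g2: "\<forall>q\<in>V. ?\<mu> q \<noteq> 0 \<longrightarrow> bary V q (1, y) \<noteq> 0"
    have "(\<Sum>q\<in>V. sgn (?\<mu> q) * of_bool (\<forall>r\<in>V. 0 \<le> ?d y r + (- ?d y q / ?\<mu> q) * ?\<mu> r)) =
        of_bool (\<forall>q\<in>V. 0 \<le> ?\<mu> q \<and> (?\<mu> q = 0 \<longrightarrow> 0 \<le> ?d y q))"
      using g1 pos by (intro sum_sgn_first_exit fin) auto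
    hence cones: "(\<Sum>q\<in>V. sgn (?\<mu> q) * indicator (facet_cone V q a) y) = (of_bool (a \<in> convex hull V) :: real)"
      unfolding a_in by (simp add: facet_cone_def facet_ratio_def indicator_def of_bool_def)
    \<comment> \<open>The join with \<open>a\<close> is cut off at the parameter value \<open>1\<close>; the index \<open>None\<close> stands for that constraint.\<close>
    define \<mu>' where "\<mu>' = case_option (-1) ?\<mu>"
    define d' where "d' = case_option 1 (?d y)"
    let ?J = "insert None (Some ` V)"
    have split: "(\<Sum>i\<in>?J. F i) = F None + (\<Sum>q\<in>V. F (Some q))" for F :: "_ \<Rightarrow> real"
      using fin by (simp add: sum.reindex)
    have "(\<Sum>i\<in>?J. sgn (\<mu>' i) * of_bool (\<forall>j\<in>?J. 0 \<le> d' j + (- d' i / \<mu>' i) * \<mu>' j)) =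
        of_bool (\<forall>j\<in>?J. 0 \<le> \<mu>' j \<and> (\<mu>' j = 0 \<longrightarrow> 0 \<le> d' j))"
    proof (rule sum_sgn_first_exit)
      fix i j assume ij: "i \<in> ?J" "j \<in> ?J" "i \<noteq> j" "\<mu>' i \<noteq> 0" "\<mu>' j \<noteq> 0"
      have g2': "- ?d y q \<noteq> ?\<mu> q" "?\<mu> q \<noteq> - ?d y q" if "q \<in> V" "?\<mu> q \<noteq> 0" for q
        using g2 that add[of q y] by auto
      show "d' i * \<mu>' j \<noteq> d' j * \<mu>' i"
      proof (cases "i = None \<or> j = None")
        case True
        thus ?thesis using ij g2' by (auto simp: \<mu>'_def d'_def)
      next
        case False
        then obtain q r where "i = Some q" "j = Some r" by auto
        thus ?thesis using ij g1 by (simp add: \<mu>'_def d'_def image_iff)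
      qed
    next
      show "\<exists>i\<in>?J. 0 < \<mu>' i" using pos by (auto simp: \<mu>'_def)
    qed (use fin in simp)
    \<comment> \<open>The constraint \<open>None\<close> has slope -1, so the interval is bounded
      above and entries and exits balance. The term of \<open>None\<close> belongs to
      \<open>s = 1\<close>, where the line passes through the coordinates of \<open>y\<close>
      itself: it is minus the indicator of the cell.\<close>
    also have "\<dots> = 0" by (simp add: \<mu>'_def)
    also have "(\<Sum>i\<in>?J. sgn (\<mu>' i) * of_bool (\<forall>j\<in>?J. 0 \<le> d' j + (- d' i / \<mu>' i) * \<mu>' j)) =
        - of_bool (\<forall>r\<in>V. 0 \<le> ?d y r + ?\<mu> r) +
        (\<Sum>q\<in>V. sgn (?\<mu> q) * of_bool (- ?d y q / ?\<mu> q \<le> 1 \<and> (\<forall>r\<in>V. 0 \<le> ?d y r + (- ?d y q / ?\<mu> q) * ?\<mu> r)))"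
      unfolding split by (intro arg_cong2[where f = "(+)"] sum.cong refl) (simp_all add: \<mu>'_def d'_def)
    finally have "(\<Sum>q\<in>V. sgn (?\<mu> q) * indicator (facet_join V q a) y) = (indicator (convex hull V) y :: real)"
      unfolding facet_join_def facet_cone_def facet_ratio_def indicator_def
        convex_hull_iff_bary[OF V] add[of _ y]
      by (simp add: of_bool_def conj_commute)
    thus "(\<Sum>p\<in>V. sgn (?\<mu> p) * (indicator (facet_join V p a) y - indicator (facet_cone V p a) y)) =
        (indicator (convex hull V) y - of_bool (a \<in> convex hull V) :: real)"
      using cones by (simp add: right_diff_distrib sum_subtractf)
  qed
qed

lemma sum_facet_cone_integrals:
  fixes V :: "(real ^ 'n) set"
  assumes V: "affine_frame V" and a: "\<And>p. p \<in> V \<Longrightarrow> a \<notin> convex hull (V - {p})"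
    and g: "integrable lborel g" "(LINT y|lborel. g y) = 0"
  shows "(\<Sum>p\<in>V. sgn (bary V p (1, a)) *
      ((LINT y:facet_join V p a|lborel. g y) - (LINT y:facet_cone V p a|lborel. g y))) =
    (LINT y:convex hull V|lborel. g y)"
proof -
  have [measurable]: "facet_join V p a \<in> sets borel" "facet_cone V p a \<in> sets borel" for p
    using closed_facet_join[OF V] closed_facet_cone[OF V] by (simp_all add: borel_closed)
  have [measurable]: "convex hull V \<in> sets borel"
    using affine_frameD(1)[OF V] by (intro borel_compact finite_imp_compact_convex_hull)
  have int: "integrable lborel (\<lambda>y. indicator A y * g y)" if "A \<in> sets borel" for A
    using integrable_mult_indicator[OF _ g(1), of A] that by simp
  from a have ae: "AE y in lborel.
    (\<Sum>p\<in>V. sgn (bary V p (1, a)) * (indicator (facet_join V p a) y - indicator (facet_cone V p a) y)) =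
    (indicator (convex hull V) y - of_bool (a \<in> convex hull V) :: real)"
    by (rule AE_sum_facet_cones[OF V])
  have "(\<Sum>p\<in>V. sgn (bary V p (1, a)) *
      ((LINT y:facet_join V p a|lborel. g y) - (LINT y:facet_cone V p a|lborel. g y))) =
    (LINT y|lborel. (\<Sum>p\<in>V. sgn (bary V p (1, a)) *
      (indicator (facet_join V p a) y * g y - indicator (facet_cone V p a) y * g y)))"
    unfolding set_lebesgue_integral_def by (subst Bochner_Integration.integral_sum) (auto simp: int)
  also have "\<dots> = (LINT y|lborel. indicator (convex hull V) y * g y - of_bool (a \<in> convex hull V) * g y)"
  proof (rule integral_cong_AE)
    show "AE y in lborel. (\<Sum>p\<in>V. sgn (bary V p (1, a)) *
        (indicator (facet_join V p a) y * g y - indicator (facet_cone V p a) y * g y)) =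
      indicator (convex hull V) y * g y - of_bool (a \<in> convex hull V) * g y"
      using ae
    proof eventually_elim
      case (elim y)
      have "(\<Sum>p\<in>V. sgn (bary V p (1, a)) *
          (indicator (facet_join V p a) y * g y - indicator (facet_cone V p a) y * g y)) =
        (\<Sum>p\<in>V. sgn (bary V p (1, a)) * (indicator (facet_join V p a) y - indicator (facet_cone V p a) y)) * g y"
        unfolding sum_distrib_right by (intro sum.cong refl) (simp add: algebra_simps)
      thus ?case unfolding elim by (simp add: algebra_simps)
    qed
  qed (use borel_measurable_integrable[OF g(1)] in measurable)
  \<comment> \<open>The vanishing mean of \<open>g\<close> removes the constant left by the
    cones.\<close>
  also have "\<dots> = (LINT y:convex hull V|lborel. g y)"
    using g int by (subst Bochner_Integration.integral_diff) (auto simp: set_lebesgue_integral_def)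
  finally show ?thesis .
qed

section \<open>Whitney forms of degree \<open>n - 1\<close> and their exterior derivative on a
  cell\<close>

lemma set_omit: "distinct \<tau> \<Longrightarrow> i < length \<tau> \<Longrightarrow> set (omit i \<tau>) = set \<tau> - {\<tau> ! i}"
  and distinct_omit: "distinct \<tau> \<Longrightarrow> i < length \<tau> \<Longrightarrow> distinct (omit i \<tau>)"
proof -
  assume \<tau>: "distinct \<tau>" "i < length \<tau>"
  have "\<tau> = take i \<tau> @ \<tau> ! i # drop (Suc i) \<tau>" using \<tau>(2) by (rule id_take_nth_drop)
  hence "distinct (take i \<tau> @ \<tau> ! i # drop (Suc i) \<tau>)"
    "set \<tau> = set (take i \<tau> @ \<tau> ! i # drop (Suc i) \<tau>)" using \<tau>(1) by metis+
  thus "set (omit i \<tau>) = set \<tau> - {\<tau> ! i}" "distinct (omit i \<tau>)" by (auto simp: omit_def)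
qed

lemma affine_frame_list:
  fixes V :: "(real ^ 'n) set"
  assumes "affine_frame V"
  obtains \<tau> where "distinct \<tau>" "set \<tau> = V" "length \<tau> = Suc CARD('n)"
  using finite_distinct_list[OF affine_frameD(1)[OF assms]] affine_frameD(3)[OF assms]
  by (metis distinct_card)

lemma frame_det_move_to_front:
  fixes V :: "(real ^ 'n) set"
  assumes \<tau>: "length \<tau> = Suc CARD('n)" and i: "i \<le> CARD('n)"
  shows "frame_det V (\<tau> ! i # omit i \<tau>) = (- 1) ^ i * frame_det V \<tau>"
proof -
  let ?A = "\<lambda>j r. bary V (\<tau> ! r) (hframe j)"
  have "frame_det V (\<tau> ! i # omit i \<tau>) =
      fdet (Suc CARD('n)) (\<lambda>r j. ?A j (if r = 0 then i else skip i (r - 1)))"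
    unfolding frame_det_def
  proof (rule fdet_cong)
    fix r j assume "r < Suc CARD('n)"
    thus "bary V ((\<tau> ! i # omit i \<tau>) ! r) (hframe j) = ?A j (if r = 0 then i else skip i (r - 1))"
      using assms by (cases r) (simp_all add: omit_nth)
  qed
  also have "\<dots> = fdet (Suc CARD('n)) (\<lambda>j r. ?A j (if r = 0 then i else skip i (r - 1)))"
    by (rule fdet_transpose)
  also have "\<dots> = (- 1) ^ i * fdet (Suc CARD('n)) ?A"
    using i by (intro fdet_column_to_front) simp
  also have "fdet (Suc CARD('n)) ?A = frame_det V \<tau>"
    unfolding frame_det_def by (rule fdet_transpose)
  finally show ?thesis .
qed

text \<open>The full determinant is independent of the base point, which may therefore be the vertex
  \<open>\<tau> ! i\<close>. There all coordinates but the \<open>i\<close>-th vanish, and the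
  Laplace expansion reduces to the wanted minor.\<close>

lemma fdet_bary_omit:
  fixes V :: "(real ^ 'n) set"
  assumes V: "affine_frame V" and \<tau>: "length \<tau> = Suc CARD('n)" "distinct \<tau>" "set \<tau> = V" and i: "i \<le> CARD('n)"
  shows "fdet CARD('n) (\<lambda>r j. bary V (omit i \<tau> ! r) (0, v j)) = (- 1) ^ i * frame_det V \<tau> * vdet v"
proof -
  let ?B = "fdet CARD('n) (\<lambda>r j. bary V (omit i \<tau> ! r) (0, v j))"
  have "frame_det V \<tau> * vdet v = fdet (Suc CARD('n)) (\<lambda>r j. bary V (\<tau> ! r) (hvec (\<tau> ! i) v j))"
    using fdet_bary[OF V, of \<tau> "hvec (\<tau> ! i) v"] by (simp add: hdet_hvec)
  also have "\<dots> = (\<Sum>r\<le>CARD('n). if r = i then (- 1) ^ i * ?B else 0)"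
    unfolding fdet_laplace_column
  proof (intro sum.cong refl)
    fix r assume r: "r \<in> {..CARD('n)}"
    have "fdet CARD('n) (\<lambda>s j. bary V (\<tau> ! skip i s) (hvec (\<tau> ! i) v (Suc j))) = ?B"
      using \<tau> i by (intro fdet_cong) (simp add: omit_nth)
    moreover have "bary V (\<tau> ! r) (hvec (\<tau> ! i) v 0) = of_bool (r = i)"
      using bary_vertex[OF V, of "\<tau> ! i" "\<tau> ! r"] \<tau> r i by (auto simp: nth_eq_iff_index_eq)
    ultimately show "(- 1) ^ r * bary V (\<tau> ! r) (hvec (\<tau> ! i) v 0) *
        fdet CARD('n) (\<lambda>s j. bary V (\<tau> ! skip r s) (hvec (\<tau> ! i) v (Suc j))) =
      (if r = i then (- 1) ^ i * ?B else 0)" by simp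
  qed
  also have "\<dots> = (- 1) ^ i * ?B" using i by simp
  finally have "(- 1) ^ i * (frame_det V \<tau> * vdet v) = (- 1) ^ i * ((- 1) ^ i * ?B)" by simp
  thus ?thesis by (simp add: power_add[symmetric] mult.assoc[symmetric])
qed

lemma oriented_facet:
  fixes X :: "(real ^ 'n) set set"
  assumes X: "simplicial_complex X" and V: "affine_frame V" "convex hull V \<in> X"
    and \<sigma>: "distinct \<sigma>" "set \<sigma> = V - {p}" "p \<in> V"
  shows "\<sigma> \<in> oriented_simplices X (CARD('n) - 1)"
proof -
  have "length \<sigma> = CARD('n)"
    using \<sigma> affine_frameD[OF V(1)] by (metis card_Diff_singleton diff_Suc_1 distinct_card)
  moreover have "\<not> affine_dependent (set \<sigma>)"
    using affine_frameD(2)[OF V(1)] affine_independent_subset[of V "set \<sigma>"] \<sigma> by auto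
  moreover have "convex hull (set \<sigma>) \<in> X"
    using complex_subface[OF X affine_frameD(2)[OF V(1)] V(2), of "set \<sigma>"] \<sigma> by auto
  ultimately show ?thesis using \<sigma>(1) by (simp add: oriented_simplices_def)
qed

lemma oriented_facet_opposite:
  fixes X :: "(real ^ 'n) set set"
  assumes V: "affine_frame V" and \<sigma>: "\<sigma> \<in> oriented_simplices X (CARD('n) - 1)" "set \<sigma> \<subseteq> V"
  obtains p where "p \<in> V" "set \<sigma> = V - {p}"
proof -
  have "card (set \<sigma>) = CARD('n)" using \<sigma> by (simp add: oriented_simplices_def distinct_card)
  hence "card (V - set \<sigma>) = 1"
    using affine_frameD[OF V] \<sigma>(2) by (simp add: card_Diff_subset)
  then obtain p where "V - set \<sigma> = {p}" by (auto simp: card_1_singleton_iff)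
  thus thesis using that[of p] \<sigma>(2) by blast
qed

lemma cell_whitney_zero_row:
  assumes "r < length \<sigma>" "bary V (\<sigma> ! r) (1, x) = 0"
    "\<And>j. Suc j < length \<sigma> \<Longrightarrow> bary V (\<sigma> ! r) (0, v j) = 0"
  shows "cell_whitney V \<sigma> x v = 0"
proof -
  have "bary V (\<sigma> ! r) (hvec x v j) = 0" if "j < length \<sigma>" for j
    using assms that by (cases j) auto
  thus ?thesis unfolding cell_whitney_def using fdet_zero_row[OF assms(1)] by simp
qed

text \<open>Forms of simplices with a vertex outside the cell have a zero row. The remaining
  simplices are the facets, indexed by their opposite vertices.\<close>

lemma whitney_interpolant_on_cell:
  fixes X :: "(real ^ 'n) set set"
  assumes X: "simplicial_complex X" and V: "affine_frame V" "convex hull V \<in> X"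
    and \<tau>: "length \<tau> = Suc CARD('n)" "distinct \<tau>" "set \<tau> = V"
    and f: "orientation_alternating X (CARD('n) - 1) f" and x: "x \<in> interior (convex hull V)"
  shows "whitney_interpolant X (CARD('n) - 1) f x v =
    (\<Sum>i\<le>CARD('n). f (omit i \<tau>) * cell_whitney V (omit i \<tau>) x v)"
proof -
  let ?k = "CARD('n) - 1"
  let ?O = "oriented_simplices X ?k" and ?R = "orientations X ?k" and ?r = "orientation_rep X ?k"
  have finR: "finite ?R"
    using finite_subset[OF orientations_subset finite_oriented_simplices[OF X]] .
  have len: "length \<sigma> = Suc ?k" if "\<sigma> \<in> ?O" for \<sigma> using that by (simp add: oriented_simplices_def)
  have omit: "omit i \<tau> \<in> ?O" "set (omit i \<tau>) = V - {\<tau> ! i}" if "i \<le> CARD('n)" for i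
  proof -
    show "set (omit i \<tau>) = V - {\<tau> ! i}" using set_omit[of \<tau> i] \<tau> that by simp
    thus "omit i \<tau> \<in> ?O"
    proof (rule oriented_facet[OF X V, rotated])
      show "distinct (omit i \<tau>)" using \<tau> that by (intro distinct_omit) simp_all
      show "\<tau> ! i \<in> V" using \<tau> that nth_mem[of i \<tau>] by simp
    qed
  qed
  have bij: "bij_betw (\<lambda>i. ?r (omit i \<tau>)) {..CARD('n)} {\<sigma> \<in> ?R. set \<sigma> \<subseteq> V}"
    unfolding bij_betw_def
  proof
    show "inj_on (\<lambda>i. ?r (omit i \<tau>)) {..CARD('n)}"
    proof (rule inj_onI)
      fix i j assume ij: "i \<in> {..CARD('n)}" "j \<in> {..CARD('n)}" "?r (omit i \<tau>) = ?r (omit j \<tau>)"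
      hence "V - {\<tau> ! i} = V - {\<tau> ! j}"
        using orientation_rep(2)[OF omit(1)] omit(2) by (metis atMost_iff)
      moreover have "\<tau> ! i \<in> V" "\<tau> ! j \<in> V" using ij \<tau> by auto
      ultimately have "\<tau> ! i = \<tau> ! j" by blast
      thus "i = j" using ij \<tau> by (simp add: nth_eq_iff_index_eq)
    qed
    show "(\<lambda>i. ?r (omit i \<tau>)) ` {..CARD('n)} = {\<sigma> \<in> ?R. set \<sigma> \<subseteq> V}"
    proof (intro equalityI subsetI)
      fix \<sigma> assume "\<sigma> \<in> (\<lambda>i. ?r (omit i \<tau>)) ` {..CARD('n)}"
      then obtain i where i: "i \<le> CARD('n)" "\<sigma> = ?r (omit i \<tau>)" by auto
      thus "\<sigma> \<in> {\<sigma> \<in> ?R. set \<sigma> \<subseteq> V}"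
        using omit[OF i(1)] orientation_rep(2)[OF omit(1)[OF i(1)]] by (auto simp: orientations_def)
    next
      fix \<sigma> assume "\<sigma> \<in> {\<sigma> \<in> ?R. set \<sigma> \<subseteq> V}"
      hence \<sigma>: "\<sigma> \<in> ?R" "\<sigma> \<in> ?O" "set \<sigma> \<subseteq> V" using orientations_subset by auto
      obtain p where p: "p \<in> V" "set \<sigma> = V - {p}" using oriented_facet_opposite[OF V(1) \<sigma>(2,3)] .
      then obtain i where i: "i \<le> CARD('n)" "p = \<tau> ! i"
        using \<tau> by (metis in_set_conv_nth less_Suc_eq_le)
      have "?r (omit i \<tau>) = ?r \<sigma>"
        using omit(2)[OF i(1)] p i by (intro orientation_rep_cong) simp
      thus "\<sigma> \<in> (\<lambda>i. ?r (omit i \<tau>)) ` {..CARD('n)}"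
        using i orientation_rep_of_rep[OF \<sigma>(1)] by (intro image_eqI[of _ _ i]) auto
    qed
  qed
  have "whitney_interpolant X ?k f x v = (\<Sum>\<sigma>\<in>?R. f \<sigma> * cell_whitney V \<sigma> x v)"
    unfolding whitney_interpolant_def
    using whitney_form_on_cell[OF X V x len] subsetD[OF orientations_subset[of X ?k]]
    by (intro sum.cong) auto
  also have "\<dots> = (\<Sum>\<sigma>\<in>{\<sigma> \<in> ?R. set \<sigma> \<subseteq> V}. f \<sigma> * cell_whitney V \<sigma> x v)"
  proof (rule sum.mono_neutral_right[OF finR])
    show "\<forall>\<sigma>\<in>?R - {\<sigma> \<in> ?R. set \<sigma> \<subseteq> V}. f \<sigma> * cell_whitney V \<sigma> x v = 0"
    proof
      fix \<sigma> assume "\<sigma> \<in> ?R - {\<sigma> \<in> ?R. set \<sigma> \<subseteq> V}"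
      then obtain r where "r < length \<sigma>" "\<sigma> ! r \<notin> V" by (auto simp: subset_iff in_set_conv_nth)
      thus "f \<sigma> * cell_whitney V \<sigma> x v = 0"
        using cell_whitney_zero_row[of r \<sigma> V] bary_not_in[OF V(1)] by simp
    qed
  qed auto
  also have "\<dots> = (\<Sum>i\<le>CARD('n). f (?r (omit i \<tau>)) * cell_whitney V (?r (omit i \<tau>)) x v)"
    by (rule sum.reindex_bij_betw[OF bij, symmetric])
  also have "\<dots> = (\<Sum>i\<le>CARD('n). f (omit i \<tau>) * cell_whitney V (omit i \<tau>) x v)"
  proof (intro sum.cong refl)
    fix i assume "i \<in> {..CARD('n)}"
    hence o: "omit i \<tau> \<in> ?O" using omit by simp
    note r = orientation_rep[OF o]
    \<comment> \<open>Value and form change by the same sign, so the product does not depend on the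
      chosen ordering of the facet.\<close>
    have "f (omit i \<tau>) = incidence (?r (omit i \<tau>)) (omit i \<tau>) * f (?r (omit i \<tau>))"
      using f[unfolded orientation_alternating_def, rule_format, OF o r(1)] r(2) by simp
    moreover have "cell_whitney V (?r (omit i \<tau>)) x v =
        incidence (?r (omit i \<tau>)) (omit i \<tau>) * cell_whitney V (omit i \<tau>) x v"
      using r o by (intro cell_whitney_reorder) (auto simp: oriented_simplices_def)
    ultimately show "f (?r (omit i \<tau>)) * cell_whitney V (?r (omit i \<tau>)) x v =
        f (omit i \<tau>) * cell_whitney V (omit i \<tau>) x v" by simp
  qed
  finally show ?thesis .
qed

text \<open>Only the column of the point depends on \<open>y\<close>, and affinely; differentiation
  replaces it by the column of the direction.\<close>

lemma has_derivative_cell_whitney: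
  assumes V: "affine_frame V" and \<sigma>: "length \<sigma> = Suc k"
  shows "((\<lambda>y. cell_whitney V \<sigma> y v) has_derivative (\<lambda>w. fact k *
    fdet (Suc k) (\<lambda>i j. bary V (\<sigma> ! i) (0, if j = 0 then w else v (j - 1))))) (at y)"
proof -
  have "((\<lambda>y. fact k * (\<Sum>i\<le>k. (- 1) ^ i * bary V (\<sigma> ! i) (1, y) *
        fdet k (\<lambda>r j. bary V (\<sigma> ! skip i r) (0, v j)))) has_derivative
      (\<lambda>w. fact k * (\<Sum>i\<le>k. (- 1) ^ i * bary V (\<sigma> ! i) (0, w) *
        fdet k (\<lambda>r j. bary V (\<sigma> ! skip i r) (0, v j))))) (at y)"
    by (intro has_derivative_mult_right has_derivative_sum has_derivative_mult_left has_derivative_bary V)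
  thus ?thesis
    unfolding cell_whitney_def \<sigma> fdet_laplace_column by simp
qed

text \<open>In the \<open>m\<close>-th term the vector \<open>v m\<close> has moved to the front.
  Moving it back costs a sign that cancels the one in the exterior derivative, so all
  \<open>n\<close> terms agree and the factorial of \<open>n - 1\<close> becomes that of
  \<open>n\<close>.\<close>

lemma ext_deriv_on_cell:
  fixes X :: "(real ^ 'n) set set"
  assumes V: "affine_frame V" "convex hull V \<in> X"
    and \<tau>: "length \<tau> = Suc CARD('n)" "distinct \<tau>" "set \<tau> = V"
    and x: "x \<in> interior (convex hull V)"
    and w: "\<And>y v. y \<in> interior (convex hull V) \<Longrightarrow>
      w y v = (\<Sum>i\<le>CARD('n). F i * cell_whitney V (omit i \<tau>) y v)"
  shows "ext_deriv X (CARD('n) - 1) w x v =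
    fact CARD('n) * frame_det V \<tau> * vdet v * (\<Sum>i\<le>CARD('n). (- 1) ^ i * F i)"
proof -
  obtain k where k: "CARD('n) = Suc k" using zero_less_card_finite gr0_implies_Suc by blast
  let ?D = "frame_det V \<tau> * vdet v"
  have len: "length (omit i \<tau>) = Suc k" if "i \<le> CARD('n)" for i
    using that \<tau> k by (simp add: length_omit)
  have "frechet_derivative (\<lambda>y. w y (\<lambda>j. if j < m then v j else v (Suc j))) (at x) (v m) =
      (- 1) ^ m * (fact k * ?D * (\<Sum>i\<le>CARD('n). (- 1) ^ i * F i))" if m: "m \<le> k" for m
  proof -
    let ?v = "\<lambda>j. if j < m then v j else v (Suc j)"
    let ?d = "\<lambda>u. \<Sum>i\<le>CARD('n). F i * (fact k *
      fdet (Suc k) (\<lambda>r j. bary V (omit i \<tau> ! r) (0, if j = 0 then u else ?v (j - 1))))"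
    have "((\<lambda>y. \<Sum>i\<le>CARD('n). F i * cell_whitney V (omit i \<tau>) y ?v) has_derivative ?d) (at x)"
      by (intro has_derivative_sum has_derivative_mult_right has_derivative_cell_whitney V len) simp
    hence "((\<lambda>y. w y ?v) has_derivative ?d) (at x)"
      by (rule has_derivative_transform_within_open[OF _ open_interior x]) (simp add: w)
    hence D: "frechet_derivative (\<lambda>y. w y ?v) (at x) = ?d" by (rule frechet_derivative_at[symmetric])
    have summand: "F i * (fact k * fdet (Suc k) (\<lambda>r j. bary V (omit i \<tau> ! r) (0, if j = 0 then v m else ?v (j - 1)))) =
        (- 1) ^ m * (fact k * ?D * ((- 1) ^ i * F i))" if i: "i \<le> CARD('n)" for i
    proof -
      let ?A = "\<lambda>r j. bary V (omit i \<tau> ! r) (0, v j)"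
      have "fdet (Suc k) (\<lambda>r j. bary V (omit i \<tau> ! r) (0, if j = 0 then v m else ?v (j - 1))) =
          fdet (Suc k) (\<lambda>r j. ?A r (if j = 0 then m else skip m (j - 1)))"
        by (intro fdet_cong) (auto simp: skip_def)
      also have "\<dots> = (- 1) ^ m * fdet (Suc k) ?A"
        using m by (intro fdet_column_to_front) simp
      also have "fdet (Suc k) ?A = (- 1) ^ i * frame_det V \<tau> * vdet v"
        using fdet_bary_omit[OF V(1) \<tau> i] k by simp
      finally show ?thesis by simp
    qed
    show ?thesis unfolding D sum_distrib_left by (intro sum.cong refl summand) simp
  qed
  hence "(\<Sum>m\<le>k. (- 1) ^ m * frechet_derivative (\<lambda>y. w y (\<lambda>j. if j < m then v j else v (Suc j))) (at x) (v m)) =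
      (\<Sum>m\<le>k. fact k * ?D * (\<Sum>i\<le>CARD('n). (- 1) ^ i * F i))"
    by (intro sum.cong refl) (simp add: power_add[symmetric] mult.assoc[symmetric])
  also have "\<dots> = fact CARD('n) * frame_det V \<tau> * vdet v * (\<Sum>i\<le>CARD('n). (- 1) ^ i * F i)"
    by (simp add: k)
  finally have "(\<Sum>m\<le>k. (- 1) ^ m * frechet_derivative (\<lambda>y. w y (\<lambda>j. if j < m then v j else v (Suc j))) (at x) (v m)) =
      fact CARD('n) * frame_det V \<tau> * vdet v * (\<Sum>i\<le>CARD('n). (- 1) ^ i * F i)" .
  moreover have "x \<in> cell_interiors X"
    using V x simplex_convex_hull[of V "int CARD('n)"]
    by (auto simp: cell_interiors_def cells_def affine_frame_def)
  ultimately show ?thesis by (simp add: ext_deriv_def k)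
qed

section \<open>Forms of top degree\<close>

lemma sum_cell_indicators:
  fixes X :: "(real ^ 'n) set set"
  assumes X: "simplicial_complex X" and T: "T \<in> cells X" "x \<in> interior T"
  shows "(\<Sum>T'\<in>cells X. K T' * indicator (interior T') x) = (K T :: real)"
proof -
  have "K T' * indicator (interior T') x = (if T' = T then K T else 0)" if "T' \<in> cells X" for T'
    using cell_interiors_disjoint[OF X T(1) that T(2)] T(2) by (cases "x \<in> interior T'") auto
  hence "(\<Sum>T'\<in>cells X. K T' * indicator (interior T') x) = (\<Sum>T'\<in>cells X. if T' = T then K T else 0)"
    by (intro sum.cong) auto
  thus ?thesis using T complex_finite[OF X] by (simp add: cells_def)
qed

text \<open>On a cell the determinant of size \<open>n + 1\<close> splits into a constant of the
  cell and the volume form.\<close>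

lemma top_form_density:
  fixes X :: "(real ^ 'n) set set"
  assumes X: "simplicial_complex X" and u: "u \<in> whitney_space X CARD('n)"
  obtains K where "\<And>x v. u x v = (\<Sum>T\<in>cells X. K T * indicator (interior T) x) * vdet v"
proof -
  let ?O = "oriented_simplices X CARD('n)"
  obtain c where c: "u = (\<lambda>x v. \<Sum>\<sigma>\<in>?O. c \<sigma> * whitney_form X \<sigma> x v)"
    using u by (auto simp: whitney_space_def)
  have "\<exists>V. affine_frame V \<and> T = convex hull V \<and> convex hull V \<in> X" if "T \<in> cells X" for T
    using cell_frame[OF X that] by metis
  then obtain V where V: "\<And>T. T \<in> cells X \<Longrightarrow> affine_frame (V T)"
    "\<And>T. T \<in> cells X \<Longrightarrow> T = convex hull (V T)" "\<And>T. T \<in> cells X \<Longrightarrow> convex hull (V T) \<in> X"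
    by metis
  define K where "K T = (\<Sum>\<sigma>\<in>?O. c \<sigma> * (fact CARD('n) * frame_det (V T) \<sigma>))" for T
  show thesis
  proof
    fix x v
    show "u x v = (\<Sum>T\<in>cells X. K T * indicator (interior T) x) * vdet v"
    proof (cases "x \<in> cell_interiors X")
      case True
      then obtain T where T: "T \<in> cells X" "x \<in> interior T" by (auto simp: cell_interiors_def)
      note sum = sum_cell_indicators[OF X T, of K]
      have "whitney_form X \<sigma> x v = fact CARD('n) * frame_det (V T) \<sigma> * vdet v" if "\<sigma> \<in> ?O" for \<sigma>
      proof -
        have len: "length \<sigma> = Suc CARD('n)" using that by (simp add: oriented_simplices_def)
        have "x \<in> interior (convex hull V T)" using T V(2) by metis
        hence "whitney_form X \<sigma> x v = cell_whitney (V T) \<sigma> x v"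
          by (rule whitney_form_on_cell[OF X V(1,3)[OF T(1)] _ len])
        thus ?thesis
          unfolding cell_whitney_def len fdet_bary[OF V(1)[OF T(1)]] hdet_hvec by simp
      qed
      thus ?thesis unfolding sum by (simp add: c K_def sum_distrib_right mult.assoc)
    next
      case False
      hence "(\<Sum>T\<in>cells X. K T * indicator (interior T) x) = 0"
        by (intro sum.neutral) (auto simp: cell_interiors_def)
      thus ?thesis using False by (simp add: c whitney_form_def)
    qed
  qed
qed

lemma AE_not_frontier:
  fixes S :: "(real ^ 'n) set"
  assumes "convex S"
  shows "AE y in lborel. y \<notin> frontier S"
proof -
  have "frontier S \<in> sets lborel" by (simp add: borel_closed)
  hence "frontier S \<in> null_sets lborel"
    using negligible_convex_frontier[OF assms] by (simp add: negligible_iff_null_sets null_sets_completion_iff)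
  thus ?thesis by (rule AE_not_in)
qed

lemma integral_over_cell:
  fixes V :: "(real ^ 'n) set"
  assumes V: "affine_frame V" and \<tau>: "length \<tau> = Suc CARD('n)" "distinct \<tau>" "set \<tau> = V"
    and g: "\<And>y. y \<in> interior (convex hull V) \<Longrightarrow> g y = K" "g \<in> borel_measurable borel"
  shows "(LINT y:convex hull V|lborel. g y) = K / (fact CARD('n) * \<bar>frame_det V \<tau>\<bar>)"
proof -
  have cpt: "compact (convex hull V)" using affine_frameD(1)[OF V] by (rule finite_imp_compact_convex_hull)
  hence [measurable]: "convex hull V \<in> sets borel" by (rule borel_compact)
  note [measurable] = g(2)
  have "AE y in lborel. indicator (convex hull V) y * g y = K * indicator (convex hull V) y"
    using AE_not_frontier[OF convex_convex_hull[of V]]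
  proof eventually_elim
    case (elim y)
    thus ?case using g(1)[of y] closure_subset[of "convex hull V"] by (auto simp: frontier_def indicator_def)
  qed
  hence "(LINT y|lborel. indicator (convex hull V) y * g y) = (LINT y|lborel. K * indicator (convex hull V) y)"
    by (intro integral_cong_AE) measurable
  also have "\<dots> = K * measure lborel (convex hull V)"
    by simp
  also have "measure lborel (convex hull V) = 1 / (fact CARD('n) * \<bar>frame_det V (\<tau> ! 0 # omit 0 \<tau>)\<bar>)"
    using \<tau> by (intro integral_cell_const[OF V]) (auto simp: set_omit distinct_omit)
  also have "frame_det V (\<tau> ! 0 # omit 0 \<tau>) = frame_det V \<tau>"
    using frame_det_move_to_front[OF \<tau>(1), of 0] by simp
  finally show ?thesis by (simp add: set_lebesgue_integral_def)
qed

text \<open>The alternating sum is a boundary integral over the cell. Each facet carries the sign of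
  the frame determinant and that of the coordinate of \<open>a\<close> at the opposite vertex, so
  the signed count of joins and cones applies.\<close>

lemma alternating_sum_facet_values:
  fixes V :: "(real ^ 'n) set"
  assumes V: "affine_frame V" and \<tau>: "length \<tau> = Suc CARD('n)" "distinct \<tau>" "set \<tau> = V"
    and a: "\<And>p. p \<in> V \<Longrightarrow> a \<notin> convex hull (V - {p})"
    and u: "\<And>x v. u x v = g x * vdet v"
    and g: "integrable lborel g" "(LINT y|lborel. g y) = 0" "\<And>y. y \<in> interior (convex hull V) \<Longrightarrow> g y = K"
  shows "fact CARD('n) * frame_det V \<tau> *
    (\<Sum>i\<le>CARD('n). (- 1) ^ i * (cone_integral a (omit i \<tau>) u - dual_cone_integral a (omit i \<tau>) u)) = K"
proof -
  have gm: "g \<in> borel_measurable borel" using borel_measurable_integrable[OF g(1)] by simp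
  let ?D = "frame_det V \<tau>"
  let ?J = "\<lambda>p. (LINT y:facet_join V p a|lborel. g y) - (LINT y:facet_cone V p a|lborel. g y)"
  have "\<tau> ! 0 \<in> V" using \<tau> nth_mem[of 0 \<tau>] by simp
  hence D: "?D \<noteq> 0"
    using vdet_facet(1)[OF V, of "\<tau> ! 0" "omit 0 \<tau>"] frame_det_move_to_front[OF \<tau>(1), of 0 V] \<tau>
    by (simp add: set_omit distinct_omit)
  have summand: "(- 1) ^ i * (cone_integral a (omit i \<tau>) u - dual_cone_integral a (omit i \<tau>) u) =
      sgn ?D * (sgn (bary V (\<tau> ! i) (1, a)) * ?J (\<tau> ! i))" if i: "i \<le> CARD('n)" for i
  proof -
    have f: "\<tau> ! i \<in> V" "distinct (omit i \<tau>)" "set (omit i \<tau>) = V - {\<tau> ! i}"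
      using \<tau> i by (auto simp: set_omit distinct_omit)
    have "vdet (\<lambda>j. omit i \<tau> ! j - a) = bary V (\<tau> ! i) (1, a) / ((- 1) ^ i * ?D)"
      using vdet_facet(2)[OF V f, of a] frame_det_move_to_front[OF \<tau>(1) i, of V] by simp
    \<comment> \<open>The power of -1 from the position of the omitted vertex cancels the one in the
      alternating sum.\<close>
    hence "sgn (vdet (\<lambda>j. omit i \<tau> ! j - a)) = (- 1) ^ i * sgn ?D * sgn (bary V (\<tau> ! i) (1, a))"
      using D by (cases "even i"; cases "?D > 0") (simp_all add: sgn_divide sgn_minus)
    thus ?thesis
      using cone_integrals_facet[where u = u, OF V f u gm, of a]
      by (simp add: right_diff_distrib power_add[symmetric] mult.assoc[symmetric])
  qed
  have "(\<Sum>i\<le>CARD('n). (- 1) ^ i * (cone_integral a (omit i \<tau>) u - dual_cone_integral a (omit i \<tau>) u)) =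
      (\<Sum>i<length \<tau>. sgn ?D * (sgn (bary V (\<tau> ! i) (1, a)) * ?J (\<tau> ! i)))"
    using summand \<tau>(1) by (intro sum.cong) auto
  also have "\<dots> = sgn ?D * (\<Sum>i<length \<tau>. sgn (bary V (\<tau> ! i) (1, a)) * ?J (\<tau> ! i))"
    by (simp add: sum_distrib_left)
  also have "(\<Sum>i<length \<tau>. sgn (bary V (\<tau> ! i) (1, a)) * ?J (\<tau> ! i)) =
      (\<Sum>p\<in>V. sgn (bary V p (1, a)) * ?J p)"
    by (rule sum.reindex_bij_betw[OF bij_betw_nth]) (use \<tau> in auto)
  also have "\<dots> = (LINT y:convex hull V|lborel. g y)"
    using a by (rule sum_facet_cone_integrals[OF V _ g(1,2)])
  also have "\<dots> = K / (fact CARD('n) * \<bar>?D\<bar>)"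
    by (rule integral_over_cell[OF V \<tau> g(3) gm])
  finally show ?thesis using D by (simp add: sgn_if split: if_splits)
qed

text \<open>In a cell containing the simplex, joins and cones depend on its vertex set only; the
  ordering enters through the sign of the tangent determinant alone.\<close>

lemma cone_difference_alternating:
  fixes X :: "(real ^ 'n) set set"
  assumes X: "simplicial_complex X"
    and T: "\<And>\<sigma>. \<sigma> \<in> oriented_simplices X (CARD('n) - 1) \<Longrightarrow> \<exists>T\<in>cells X. set \<sigma> \<subseteq> T"
    and u: "\<And>x v. u x v = g x * vdet v" and g: "g \<in> borel_measurable borel"
  shows "orientation_alternating X (CARD('n) - 1) (\<lambda>\<sigma>. cone_integral a \<sigma> u - dual_cone_integral a \<sigma> u)"
  unfolding orientation_alternating_def
proof (intro ballI impI)
  fix \<rho> \<sigma> assume \<rho>: "\<rho> \<in> oriented_simplices X (CARD('n) - 1)" and \<sigma>: "\<sigma> \<in> oriented_simplices X (CARD('n) - 1)"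
    and eq: "set \<rho> = set \<sigma>"
  obtain T' where T': "T' \<in> cells X" "set \<sigma> \<subseteq> T'" using T[OF \<sigma>] by blast
  obtain V where V: "affine_frame V" "T' = convex hull V" "convex hull V \<in> X"
    using cell_frame[OF X T'(1)] .
  have \<sigma>V: "set \<sigma> \<subseteq> V" using oriented_vertices_subset[OF X V(1,3) \<sigma>] T' V by simp
  obtain p where p: "p \<in> V" "set \<sigma> = V - {p}" using oriented_facet_opposite[OF V(1) \<sigma> \<sigma>V] .
  have d: "distinct \<rho>" "distinct \<sigma>" "length \<rho> = CARD('n)" "length \<sigma> = CARD('n)"
    using \<rho> \<sigma> by (auto simp: oriented_simplices_def)
  have "incidence \<sigma> \<rho> * incidence \<sigma> \<rho> = 1" using d eq by (intro incidence_inverse) auto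
  hence "sgn (incidence \<sigma> \<rho>) = incidence \<sigma> \<rho>" by (auto simp: square_eq_1_iff)
  moreover have "vdet (\<lambda>i. \<rho> ! i - a) = incidence \<sigma> \<rho> * vdet (\<lambda>i. \<sigma> ! i - a)"
    using d eq by (intro vdet_reorder) auto
  ultimately have s: "sgn (vdet (\<lambda>i. \<rho> ! i - a)) = incidence \<sigma> \<rho> * sgn (vdet (\<lambda>i. \<sigma> ! i - a))"
    by (simp add: sgn_mult)
  show "cone_integral a \<rho> u - dual_cone_integral a \<rho> u =
      incidence \<sigma> \<rho> * (cone_integral a \<sigma> u - dual_cone_integral a \<sigma> u)"
    using cone_integrals_facet[where u = u, OF V(1) p(1) d(1) _ u g, of a] cone_integrals_facet[where u = u, OF V(1) p(1) d(2) p(2) u g, of a]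
      eq p(2) s by (simp add: right_diff_distrib)
qed

text \<open>Points strictly behind a boundary facet, seen from \<open>a\<close>, are not interior: a homothety with
  centre \<open>a\<close> would carry a neighbourhood of such a point to a neighbourhood of a boundary point.\<close>
lemma cone_difference_boundary:
  fixes V :: "(real ^ 'n) set"
  assumes V: "affine_frame V" and p: "p \<in> V" and \<sigma>: "distinct \<sigma>" "set \<sigma> = V - {p}"
    and bd: "convex hull (V - {p}) \<subseteq> frontier \<Omega>" and star: "star_shaped_wrt \<Omega> a"
    and u: "\<And>x v. u x v = g x * vdet v" and g: "g \<in> borel_measurable borel"
    and supp: "\<And>y. g y \<noteq> 0 \<Longrightarrow> y \<in> interior \<Omega>"
  shows "cone_integral a \<sigma> u - dual_cone_integral a \<sigma> u = 0"
proof (cases "bary V p (1, a) = 0")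
  case True
  hence "vdet (\<lambda>i. \<sigma> ! i - a) = 0" using vdet_facet(2)[OF V p \<sigma>, of a] by simp
  thus ?thesis using cone_integrals_facet[where u = u, OF V p \<sigma> u g, of a] by simp
next
  case False
  have eq: "indicator (facet_join V p a) y * g y = indicator (facet_cone V p a) y * g y" for y
  proof (rule ccontr)
    assume neq: "indicator (facet_join V p a) y * g y \<noteq> indicator (facet_cone V p a) y * g y"
    let ?s = "facet_ratio V p a y"
    have y: "y \<in> facet_cone V p a" "?s > 1" "g y \<noteq> 0"
      using neq by (cases "y \<in> facet_cone V p a"; cases "?s \<le> 1"; simp add: facet_join_def)+
    \<comment> \<open>The homothety with centre \<open>a\<close> and ratio \<open>1 / ?s\<close>,
      which moves \<open>y\<close> onto the facet; the ratio is below 1, so star-shapedness keeps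
      images in the domain.\<close>
    let ?h = "\<lambda>z. (a - (1 / ?s) *\<^sub>R a) + (1 / ?s) *\<^sub>R z"
    have hseg: "?h z \<in> \<Omega>" if "z \<in> interior \<Omega>" for z
    proof -
      have "?h z = (1 - (1 - 1 / ?s)) *\<^sub>R z + (1 - 1 / ?s) *\<^sub>R a" by (simp add: algebra_simps)
      moreover have "0 \<le> 1 - 1 / ?s" "1 - 1 / ?s \<le> 1" using y(2) by auto
      ultimately have "?h z \<in> closed_segment z a" unfolding closed_segment_def by blast
      thus ?thesis using star that interior_subset unfolding star_shaped_wrt_def by blast
    qed
    have "open (?h ` interior \<Omega>)" using y(2) by (intro open_affinity) auto
    hence "?h y \<in> interior \<Omega>"
      using supp[OF y(3)] hseg by (intro interiorI[of "?h ` interior \<Omega>"]) auto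
    moreover have "?h y \<in> convex hull (V - {p})"
    proof -
      \<comment> \<open>Up to the positive factor \<open>?s\<close>, the coordinates of the image
        are those of the line at the parameter of the facet.\<close>
      have b: "?s * bary V q (1, ?h y) = bary V q (0, y - a) + ?s * bary V q (1, a)" for q
      proof -
        note lin = linear_bary[OF V, of q]
        have "?s *\<^sub>R (1 :: real, ?h y) = (0, y - a) + ?s *\<^sub>R (1, a)"
          using y(2) by (simp add: algebra_simps)
        hence "bary V q (?s *\<^sub>R (1, ?h y)) = bary V q (0, y - a) + bary V q (?s *\<^sub>R (1, a))"
          by (simp only: linear_add[OF lin])
        thus ?thesis by (simp only: linear_scale[OF lin] real_scaleR_def)
      qed
      have "0 \<le> bary V q (1, ?h y)" if "q \<in> V" for q
      proof -
        have "0 \<le> ?s * bary V q (1, ?h y)" using y(1) that unfolding b facet_cone_def by blast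
        thus ?thesis using y(2) by (simp add: zero_le_mult_iff)
      qed
      moreover have "?s * bary V p (1, ?h y) = 0"
        unfolding b using False by (simp add: facet_ratio_def)
      hence "bary V p (1, ?h y) = 0" using y(2) by simp
      ultimately show ?thesis
        unfolding convex_hull_subset_iff_bary[OF V Diff_subset] convex_hull_iff_bary[OF V] by auto
    qed
    ultimately show False using bd by (auto simp: frontier_def)
  qed
  show ?thesis
    using cone_integrals_facet[where u = u, OF V p \<sigma> u g, of a] by (simp add: set_lebesgue_integral_def eq)
qed

lemma ext_deriv_top_form:
  fixes X :: "(real ^ 'n) set set"
  assumes u: "\<And>x v. u x v = (\<Sum>T\<in>cells X. K T * indicator (interior T) x) * vdet v"
    and X: "simplicial_complex X"
  shows "ext_deriv X CARD('n) u x v = 0"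
proof (cases "x \<in> cell_interiors X")
  case True
  then obtain T where T: "T \<in> cells X" "x \<in> interior T" by (auto simp: cell_interiors_def)
  have "frechet_derivative (\<lambda>y. u y v') (at x) = (\<lambda>_. 0)" for v'
  proof -
    have const: "u y v' = u x v'" if y: "y \<in> interior T" for y
      unfolding u sum_cell_indicators[OF X T] sum_cell_indicators[OF X T(1) y] ..
    have "((\<lambda>y. u x v') has_derivative (\<lambda>_. 0)) (at x)" by simp
    hence "((\<lambda>y. u y v') has_derivative (\<lambda>_. 0)) (at x)"
      by (rule has_derivative_transform_within_open[OF _ open_interior T(2)]) (rule const[symmetric])
    thus ?thesis by (rule frechet_derivative_at[symmetric])
  qed
  thus ?thesis by (simp add: ext_deriv_def)
qed (simp add: ext_deriv_def)

text \<open>On a facet of the boundary with opposite vertex \<open>p\<close>, the form of the facet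
  itself has coefficient zero. Each other facet of the cell contains \<open>p\<close>, so its form
  has a row with the coordinate of \<open>p\<close>, which vanishes at points and tangent vectors of
  the boundary facet.\<close>

lemma interpolant_vanishing_trace:
  fixes X :: "(real ^ 'n) set set"
  assumes X: "simplicial_complex X" and f: "orientation_alternating X (CARD('n) - 1) f"
    and f0: "\<And>V p \<sigma>. affine_frame V \<Longrightarrow> convex hull V \<in> X \<Longrightarrow> p \<in> V \<Longrightarrow> distinct \<sigma> \<Longrightarrow> set \<sigma> = V - {p} \<Longrightarrow>
      convex hull (V - {p}) \<subseteq> frontier (\<Union>X) \<Longrightarrow> f \<sigma> = 0"
  shows "vanishing_trace X (CARD('n) - 1) (whitney_interpolant X (CARD('n) - 1) f)"
  unfolding vanishing_trace_def
proof (intro ballI allI impI)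
  fix S T x and v :: "nat \<Rightarrow> real ^ 'n"
  assume S: "S \<in> X" "(int CARD('n) - 1) simplex S \<and> S \<subseteq> frontier (\<Union>X)" and T: "T \<in> cells X" "S \<subseteq> T"
    and x: "x \<in> S" and v: "\<forall>i<CARD('n) - 1. x + v i \<in> affine hull S"
  obtain V where V: "affine_frame V" "T = convex hull V" "convex hull V \<in> X"
    using cell_frame[OF X T(1)] .
  obtain \<tau> where \<tau>: "distinct \<tau>" "set \<tau> = V" "length \<tau> = Suc CARD('n)"
    using affine_frame_list[OF V(1)] .
  have "T \<inter> S = S" using T by blast
  hence "S face_of (convex hull V)" using complex_Int[OF X V(3) S(1)] V(2) by simp
  then obtain W where W: "W \<subseteq> V" "S = convex hull W"
    using face_of_convex_hull_affine_independent[OF affine_frameD(2)[OF V(1)]] by blast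
  have indW: "\<not> affine_dependent W" using affine_independent_subset[OF affine_frameD(2)[OF V(1)] W(1)] .
  have "card W = CARD('n)"
    using S(2) aff_dim_simplex[of "int CARD('n) - 1" S] affine_independent_iff_card[of W] indW W(2)
    by (simp add: aff_dim_convex_hull)
  hence "card (V - W) = 1"
    using affine_frameD[OF V(1)] W(1) finite_subset by (subst card_Diff_subset) auto
  then obtain p where "V - W = {p}" by (auto simp: card_1_singleton_iff)
  hence p: "p \<in> V" "W = V - {p}" using W(1) by auto
  then obtain m where m: "m \<le> CARD('n)" "p = \<tau> ! m"
    using \<tau> by (metis in_set_conv_nth less_Suc_eq_le)
  \<comment> \<open>Tangency is stated through the affine hull of \<open>S\<close>, so the vanishing
    of the coordinate is extended from \<open>S\<close> to this hull.\<close>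
  let ?H = "{y. bary V p (1, y) = 0}"
  have "S \<subseteq> ?H"
    using convex_hull_subset_iff_bary[OF V(1) W(1)] p W(2) by auto
  moreover have "affine ?H"
    unfolding affine_def
  proof (intro ballI allI impI)
    fix y z and s t :: real assume yz: "y \<in> ?H" "z \<in> ?H" and st: "s + t = 1"
    note lin = linear_bary[OF V(1), of p]
    have "(1, s *\<^sub>R y + t *\<^sub>R z) = s *\<^sub>R (1 :: real, y) + t *\<^sub>R (1, z)" using st by simp
    hence "bary V p (1, s *\<^sub>R y + t *\<^sub>R z) = s * bary V p (1, y) + t * bary V p (1, z)"
      by (simp only: linear_add[OF lin] linear_scale[OF lin] real_scaleR_def)
    thus "s *\<^sub>R y + t *\<^sub>R z \<in> ?H" using yz by simp
  qed
  ultimately have hull: "affine hull S \<subseteq> ?H" by (rule hull_minimal)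
  have bx: "bary V p (1, x) = 0" using \<open>S \<subseteq> ?H\<close> x by blast
  have bv: "bary V p (0, v j) = 0" if "j < CARD('n) - 1" for j
    using bary_diff[OF V(1), of p 1 "x + v j" 1 x] v hull that bx by auto
  have "cell_extension (convex hull V) (whitney_interpolant X (CARD('n) - 1) f) x v =
      (\<Sum>i\<le>CARD('n). f (omit i \<tau>) * cell_whitney V (omit i \<tau>) x v)"
  proof (rule cell_extension_eq[OF V(1)])
    show "continuous_on UNIV (\<lambda>x. \<Sum>i\<le>CARD('n). f (omit i \<tau>) * cell_whitney V (omit i \<tau>) x v)"
      by (intro continuous_intros continuous_cell_whitney V)
    show "x \<in> convex hull V" using x T V by blast
  qed (rule whitney_interpolant_on_cell[OF X V(1,3) \<tau>(3,1,2) f])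
  also have "\<dots> = 0"
  proof (intro sum.neutral ballI)
    fix i assume i: "i \<in> {..CARD('n)}"
    show "f (omit i \<tau>) * cell_whitney V (omit i \<tau>) x v = 0"
    proof (cases "i = m")
      case True
      have "f (omit i \<tau>) = 0"
        using \<tau> m True p W S(2) by (intro f0[OF V(1,3) p(1)]) (auto simp: set_omit distinct_omit)
      thus ?thesis by simp
    next
      case False
      have len: "length (omit i \<tau>) = CARD('n)" using i \<tau> by (simp add: length_omit)
      have "p \<in> set (omit i \<tau>)"
        using i m \<tau> False p(1) by (auto simp: set_omit nth_eq_iff_index_eq)
      then obtain r where "r < length (omit i \<tau>)" "omit i \<tau> ! r = p" by (auto simp: in_set_conv_nth)
      thus ?thesis
        using cell_whitney_zero_row[of r "omit i \<tau>" V x v] bx bv len by simp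
    qed
  qed
  finally show "cell_extension T (whitney_interpolant X (CARD('n) - 1) f) x v = 0" using V(2) by simp
qed

theorem theorem7p11:
  fixes X :: "(real ^ 'n) set set" and \<Omega> :: "(real ^ 'n) set" and a :: "real ^ 'n"
  assumes "simplicial_complex X"
    and "\<Union>X = \<Omega>"
    and "polyhedral_domain \<Omega>"
    and "a \<in> \<Omega>"
    and "star_shaped_wrt \<Omega> a"
    and "\<forall>S\<in>X. (int CARD('n) - 1) simplex S \<longrightarrow> a \<notin> S"
  shows "\<forall>u \<in> whitney_space_mean0 X.
           B_op X a (CARD('n) - 1) u \<in> whitney_space_trace0 X (CARD('n) - 1) \<and>
           (\<forall>x v. B_op X a CARD('n) (ext_deriv X CARD('n) u) x v
                  + ext_deriv X (CARD('n) - 1) (B_op X a (CARD('n) - 1) u) x v = u x v) \<and>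
           (\<forall>x v. ext_deriv X CARD('n) u x v = 0) \<and>
           ext_deriv X (CARD('n) - 1) (B_op X a (CARD('n) - 1) u) = u"
proof
  fix u assume u: "u \<in> whitney_space_mean0 X"
  note X = assms(1)
  let ?k = "CARD('n) - 1"
  \<comment> \<open>Regularity of the domain puts every simplex into a cell, from which its
    integrals can be taken.\<close>
  have reg: "closure (interior (\<Union>X)) = \<Union>X" using assms(2,3) by (simp add: polyhedral_domain_def)
  have cell: "\<exists>T\<in>cells X. set \<sigma> \<subseteq> T" if "\<sigma> \<in> oriented_simplices X k" for \<sigma> k
  proof -
    have "convex hull (set \<sigma>) \<in> X" "convex hull (set \<sigma>) \<noteq> {}"
      using that by (auto simp: oriented_simplices_def)
    from cell_contains_simplex[OF X reg this] show ?thesis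
      using hull_subset[of "set \<sigma>" convex] by blast
  qed
  obtain K where K: "\<And>x v. u x v = (\<Sum>T\<in>cells X. K T * indicator (interior T) x) * vdet v"
    using top_form_density[OF X] u unfolding whitney_space_mean0_def by blast
  define g where "g x = (\<Sum>T\<in>cells X. K T * indicator (interior T) x)" for x
  have ug: "u x v = g x * vdet v" for x v by (simp add: K g_def)
  have cpt: "compact T" if "T \<in> cells X" for T
    using that compact_simplex by (auto simp: cells_def)
  have int_g: "integrable lborel g"
    unfolding g_def
  proof (intro Bochner_Integration.integrable_sum integrable_mult_right integrable_real_indicator)
    fix T assume "T \<in> cells X"
    hence "bounded (interior T)" using cpt compact_imp_bounded bounded_subset interior_subset by blast
    thus "emeasure lborel (interior T) < \<infinity>" by (rule emeasure_bounded_finite)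
  qed simp
  have gm: "g \<in> borel_measurable borel" using borel_measurable_integrable[OF int_g] by simp
  have supp: "y \<in> interior \<Omega>" if gy: "g y \<noteq> 0" for y
  proof -
    obtain T where T: "T \<in> cells X" "K T * indicator (interior T) y \<noteq> 0"
      using gy unfolding g_def by (rule sum.not_neutral_contains_not_neutral)
    hence "y \<in> interior T" by (cases "y \<in> interior T") auto
    moreover from T have "interior T \<subseteq> interior \<Omega>" using assms(2) by (intro interior_mono) (auto simp: cells_def)
    ultimately show ?thesis by blast
  qed
  \<comment> \<open>With the orientation of \<open>vdet\<close>, the integral of the form over the
    domain is that of its density.\<close>
  have "vdet (\<lambda>i. axis (idx i) 1 :: real ^ 'n) = 1"
    unfolding vdet_def by (subst fdet_upper_triangular) (auto simp: axis_def idx_eq_iff)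
  hence "domain_integral \<Omega> u = (LINT y:\<Omega>|lborel. g y)"
    by (simp add: domain_integral_def ug)
  also have "\<dots> = (LINT y|lborel. g y)"
    unfolding set_lebesgue_integral_def
    using supp interior_subset by (intro Bochner_Integration.integral_cong) (auto simp: indicator_def)
  finally have g0: "(LINT y|lborel. g y) = 0"
    using u assms(2) by (simp add: whitney_space_mean0_def)
  have g_cell: "g y = K T" if "T \<in> cells X" "y \<in> interior T" for T y
    unfolding g_def by (rule sum_cell_indicators[OF X that])
  have a_facet: "a \<notin> convex hull (V - {p})" if V: "affine_frame V" "convex hull V \<in> X" "p \<in> V" for V p
  proof -
    have "convex hull (V - {p}) \<in> X"
      using complex_subface[OF X affine_frameD(2)[OF V(1)] V(2)] by blast
    moreover have "(int CARD('n) - 1) simplex (convex hull (V - {p}))"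
      using affine_frameD[OF V(1)] V(3) affine_independent_subset[of V "V - {p}"]
      by (intro simplex_convex_hull) (auto simp: card_Diff_singleton)
    ultimately show ?thesis using assms(6) by blast
  qed
  define f where "f \<sigma> = cone_integral a \<sigma> u - dual_cone_integral a \<sigma> u" for \<sigma>
  have alt: "orientation_alternating X ?k f"
    unfolding f_def by (rule cone_difference_alternating[OF X cell ug gm])
  have B: "B_op X a ?k u = whitney_interpolant X ?k f"
    by (rule B_op_eq_interpolant[OF X cell alt]) (simp_all add: f_def)
  have "vanishing_trace X ?k (whitney_interpolant X ?k f)"
  proof (rule interpolant_vanishing_trace[OF X alt])
    fix V p \<sigma> assume V: "affine_frame V" "convex hull V \<in> X" "p \<in> V" "distinct \<sigma>" "set \<sigma> = V - {p}"
      "convex hull (V - {p}) \<subseteq> frontier (\<Union>X)"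
    thus "f \<sigma> = 0"
      unfolding f_def using assms(2,5)
      by (intro cone_difference_boundary[where u = u, OF V(1,3,4,5) _ _ ug gm supp]) simp_all
  qed
  hence trace: "B_op X a ?k u \<in> whitney_space_trace0 X ?k"
    unfolding B whitney_space_trace0_def using whitney_interpolant_in_space[OF X] by blast
  have du: "ext_deriv X CARD('n) u x v = 0" for x v
    by (rule ext_deriv_top_form[OF K X])
  have dBu: "ext_deriv X ?k (B_op X a ?k u) = u"
  proof (intro ext)
    fix x v
    show "ext_deriv X ?k (B_op X a ?k u) x v = u x v"
    proof (cases "x \<in> cell_interiors X")
      case True
      then obtain T where T: "T \<in> cells X" "x \<in> interior T" by (auto simp: cell_interiors_def)
      obtain V where V: "affine_frame V" "T = convex hull V" "convex hull V \<in> X"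
        using cell_frame[OF X T(1)] .
      obtain \<tau> where \<tau>: "distinct \<tau>" "set \<tau> = V" "length \<tau> = Suc CARD('n)"
        using affine_frame_list[OF V(1)] .
      have c: "g y = K T" if "y \<in> interior (convex hull V)" for y
        using g_cell[OF T(1)] that V(2) by simp
      have x: "x \<in> interior (convex hull V)" using T V by simp
      have "ext_deriv X ?k (B_op X a ?k u) x v = fact CARD('n) * frame_det V \<tau> * vdet v *
          (\<Sum>i\<le>CARD('n). (- 1) ^ i * f (omit i \<tau>))"
        unfolding B
        by (rule ext_deriv_on_cell[OF V(1,3) \<tau>(3,1,2) x])
           (rule whitney_interpolant_on_cell[OF X V(1,3) \<tau>(3,1,2) alt])
      also have "\<dots> = (fact CARD('n) * frame_det V \<tau> * (\<Sum>i\<le>CARD('n). (- 1) ^ i * f (omit i \<tau>))) * vdet v"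
        by simp
      also have "fact CARD('n) * frame_det V \<tau> * (\<Sum>i\<le>CARD('n). (- 1) ^ i * f (omit i \<tau>)) = K T"
        unfolding f_def
        by (rule alternating_sum_facet_values[OF V(1) \<tau>(3,1,2) a_facet[OF V(1,3)] ug int_g g0 c])
      finally show ?thesis unfolding ug[of x v] c[OF x] .
    next
      case False
      hence "g x = 0" unfolding g_def by (intro sum.neutral) (auto simp: cell_interiors_def)
      thus ?thesis using False by (simp add: ext_deriv_def ug)
    qed
  qed
  \<comment> \<open>In degree \<open>n\<close> the prescribed data are zero, and unisolvence leaves
    only the zero form.\<close>
  have "B_op X a CARD('n) (ext_deriv X CARD('n) u) = whitney_interpolant X CARD('n) (\<lambda>_. 0)"
  proof (rule B_op_eq_interpolant[OF X cell])
    show "orientation_alternating X CARD('n) (\<lambda>_. 0)" by (simp add: orientation_alternating_def)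
  qed (auto simp: cone_integral_def dual_cone_integral_def affine_integral_def
      set_lebesgue_integral_def du)
  hence "B_op X a CARD('n) (ext_deriv X CARD('n) u) x v = 0" for x v
    by (simp add: whitney_interpolant_def)
  thus "B_op X a ?k u \<in> whitney_space_trace0 X ?k \<and>
      (\<forall>x v. B_op X a CARD('n) (ext_deriv X CARD('n) u) x v + ext_deriv X ?k (B_op X a ?k u) x v = u x v) \<and>
      (\<forall>x v. ext_deriv X CARD('n) u x v = 0) \<and> ext_deriv X ?k (B_op X a ?k u) = u"
    using trace du dBu by simp
qed

end
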